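(* Fix $d>0$. For every measurable set $S\subset[0,2\pi]$ of positive measure there exists a set $\Lambda\subset\mathbb{Z}$ such that the limit $D^{\sharp}(\Lambda)=\lim_{n\to\infty}\frac{|\Lambda\cap[-n,n]|}{2n}$ exists and $D^{\sharp}(\Lambda)<(1+d)|S|$, and \[ C(d)\,|S|\,\|f\|_{L^2(\mathbb{R})}^2\le \sum_{\lambda\in\Lambda}|f(\lambda)|^2\qquad\text{for all } f\in PW_S, \] where $C(d)>0$ is a constant depending only on $d$.
   Context: $|S|$ denotes the normalized Lebesgue measure on $[0,2\pi]$, i.e. $|S|=\frac{1}{2\pi}\,\mathrm{Leb}(S)$; for a finite set, $|\cdot|$ denotes cardinality. The Fourier transform is $\hat f(t)=\int_{\mathbb{R}}e^{-ixt}f(x)\,\frac{dx}{2\pi}$. For $S\subset[0,2\pi]$, $PW_S$ is the space of all $f\in L^2(\mathbb{R})$ whose Fourier transform is supported in $S$, with the $L^2(\mathbb{R})$ norm. *)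

theory Defs
  imports "HOL-Analysis.Analysis"
begin

definition nmeasure :: "real set \<Rightarrow> real" where
  "nmeasure S = measure lebesgue S / (2 * pi)"

definition L2norm_sq :: "(real \<Rightarrow> complex) \<Rightarrow> real" where
  "L2norm_sq f = (\<integral>x. (cmod (f x))\<^sup>2 \<partial>lebesgue)"

text \<open>Paley--Wiener space PW_S for bounded measurable S: the L2(R) functions whose
  Fourier transform (convention hat f(t) = int e^{-ixt} f(x) dx/2pi) vanishes outside S.
  Equivalently (Fourier inversion / Plancherel) f(x) = int_S F(t) e^{ixt} dt with
  F = hat f in L2(S); this gives the continuous representative evaluated pointwise.\<close>
definition PW :: "real set \<Rightarrow> (real \<Rightarrow> complex) set" where
  "PW S = {f. f \<in> borel_measurable lebesgue \<and> integrable lebesgue (\<lambda>x. (cmod (f x))\<^sup>2) \<and>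
     (\<exists>F :: real \<Rightarrow> complex. F \<in> borel_measurable lebesgue \<and>
        integrable lebesgue (\<lambda>t. indicator S t * (cmod (F t))\<^sup>2) \<and>
        (\<forall>x. f x = (\<integral>t. indicator S t *\<^sub>R (F t * cis (x * t)) \<partial>lebesgue)))}"

definition has_density :: "int set \<Rightarrow> real \<Rightarrow> bool" where
  "has_density \<Lambda> D \<longleftrightarrow>
     ((\<lambda>n::nat. real (card (\<Lambda> \<inter> {- int n..int n})) / (2 * real n)) \<longlonglongrightarrow> D)"

end

theory Submission
  imports Defs "HOL-Complex_Analysis.Great_Picard"
begin

text \<open>
  Cover \<open>S\<close> by an open set \<open>U\<close> of nearly the same measure and exhaust \<open>U\<close> by finite unions \<open>U\<^sub>k\<close> of
  dyadic intervals. Cutting \<open>[0,2\<pi>)\<close> into \<open>m = 2\<^sup>k\<close> cells turns sampling \<open>PW\<close> of \<open>U\<^sub>k\<close> along a union of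
  residue classes modulo \<open>m\<close> into the choice of rows of an \<open>m \<times> n\<close> block of the discrete Fourier matrix,
  \<open>n\<close> being the number of cells of \<open>U\<^sub>k\<close>. At most \<open>(1 + d) n\<close> rows with lower frame bound of order \<open>n\<close> are
  found by the lower half of the barrier method of Batson, Spielman and Srivastava; selecting without
  repetition makes the upper barrier and the weights unnecessary.

  The sets obtained in this way have density at most \<open>(1 + d) |U|\<close>, but only for \<open>U\<^sub>k\<close>, and densities are
  not preserved when \<open>k\<close> tends to infinity. However, the family of all sets \<open>\<Lambda> \<subseteq> \<int>\<close> with the required
  sampling bound is invariant under translations and closed under pointwise limits (since the squared
  samples along \<open>\<int>\<close> are summable). In such a family the minimal number of points in windows of length
  \<open>N\<close> grows like \<open>h N\<close>, and a maximal inequality yields a member whose density exists and equals \<open>h\<close>.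
\<close>

section \<open>Selecting rows of a tight frame\<close>

text \<open>The slack \<open>d\<close> is spent twice. With \<open>d' = d / 2\<close>, the row
  selection costs a factor \<open>1 + d'\<close>, and \<open>U\<close> exceeds \<open>S\<close> by a
  factor smaller than \<open>(1 + 2 * d') / (1 + d')\<close>; the product is \<open>1 + d\<close>,
  and strictness comes from the outer approximation. An open \<open>U\<close> enters because
  \<open>S\<close> may contain no interval, so that no cell need fit inside it. The constant does
  not depend on \<open>S\<close>: the frame bound is a fixed multiple of \<open>n\<close>, and
  \<open>n / m\<close> tends to the normalized measure of \<open>U\<close>, so from some level on it
  exceeds half of it and one sampling constant serves all these levels. A larger \<open>k\<close>
  puts more functions under test, so the families of good sets decrease with \<open>k\<close>, and a
  limit of sets that are good for higher and higher levels is good for all of them. Such a limit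
  keeps the number of points in each fixed finite window and nothing more; hence only window counts
  are carried through, and the density is produced at the very end. The potential is the trace of
  the inverse of \<open>A - l I\<close>. Only rank-one updates, the resolvent identity and quadratic
  forms are used in place of eigenvalues: a bound on the trace of a positive inverse already bounds
  the form from below.\<close>

definition qform :: "'i set \<Rightarrow> ('i \<Rightarrow> 'i \<Rightarrow> complex) \<Rightarrow> ('i \<Rightarrow> complex) \<Rightarrow> real" where
  "qform L B x = Re (\<Sum>i\<in>L. \<Sum>j\<in>L. cnj (x i) * B i j * x j)"

definition hermitian_on :: "'i set \<Rightarrow> ('i \<Rightarrow> 'i \<Rightarrow> complex) \<Rightarrow> bool" where
  "hermitian_on L B \<longleftrightarrow> (\<forall>i\<in>L. \<forall>j\<in>L. B j i = cnj (B i j))"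

text \<open>One product is enough as an encoding: for Hermitian matrices the product in the other
  order is its adjoint.\<close>

definition inverse_on :: "'i set \<Rightarrow> ('i \<Rightarrow> 'i \<Rightarrow> complex) \<Rightarrow> ('i \<Rightarrow> 'i \<Rightarrow> complex) \<Rightarrow> bool" where
  "inverse_on L B R \<longleftrightarrow> hermitian_on L B \<and> hermitian_on L R \<and>
     (\<forall>i\<in>L. \<forall>j\<in>L. (\<Sum>k\<in>L. B i k * R k j) = (if i = j then 1 else 0))"

definition retrace :: "'i set \<Rightarrow> ('i \<Rightarrow> 'i \<Rightarrow> complex) \<Rightarrow> real" where
  "retrace L R = (\<Sum>i\<in>L. Re (R i i))"

lemma hermitian_on_cnj: "hermitian_on L B \<Longrightarrow> i \<in> L \<Longrightarrow> j \<in> L \<Longrightarrow> cnj (B i j) = B j i"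
  unfolding hermitian_on_def by metis

lemma hermitian_onI: "(\<And>i j. i \<in> L \<Longrightarrow> j \<in> L \<Longrightarrow> cnj (B i j) = B j i) \<Longrightarrow> hermitian_on L B"
  unfolding hermitian_on_def by metis

lemma inverse_on_hermitian: "inverse_on L B R \<Longrightarrow> hermitian_on L B" "inverse_on L B R \<Longrightarrow> hermitian_on L R"
  by (simp_all add: inverse_on_def)

lemma inverse_on_cong:
  assumes inv: "inverse_on L B R" and eq: "\<And>i j. i \<in> L \<Longrightarrow> j \<in> L \<Longrightarrow> B' i j = B i j"
  shows "inverse_on L B' R"
proof -
  have "hermitian_on L B'"
    by (rule hermitian_onI) (simp add: eq hermitian_on_cnj[OF inverse_on_hermitian(1)[OF inv]])
  moreover have "(\<Sum>k\<in>L. B' i k * R k j) = (\<Sum>k\<in>L. B i k * R k j)" if "i \<in> L" for i j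
    by (intro sum.cong refl) (simp add: eq that)
  ultimately show ?thesis using inv by (simp add: inverse_on_def)
qed

lemma inverse_on_left:
  assumes "inverse_on L B R" "i \<in> L" "j \<in> L"
  shows "(\<Sum>k\<in>L. R i k * B k j) = (if i = j then 1 else 0)"
proof -
  have "(\<Sum>k\<in>L. R i k * B k j) = cnj (\<Sum>k\<in>L. B j k * R k i)"
    unfolding cnj_sum complex_cnj_mult
    by (rule sum.cong) (simp_all add: assms hermitian_on_cnj[OF inverse_on_hermitian(1)[OF assms(1)]]
        hermitian_on_cnj[OF inverse_on_hermitian(2)[OF assms(1)]])
  also have "\<dots> = (if i = j then 1 else 0)"
    using assms by (auto simp: inverse_on_def)
  finally show ?thesis .
qed

lemma sum_single: "finite L \<Longrightarrow> i \<in> L \<Longrightarrow> (\<Sum>k\<in>L. (if i = k then 1 else 0) * f k) = (f i :: complex)"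
  "finite L \<Longrightarrow> i \<in> L \<Longrightarrow> (\<Sum>k\<in>L. f k * (if k = i then 1 else 0)) = (f i :: complex)"
   by (simp_all add: if_distrib[of "\<lambda>z. z * _"] if_distrib[of "\<lambda>z. _ * z"] cong: if_cong)

lemma inverse_on_apply:
  assumes inv: "inverse_on L B R" and fin: "finite L" and i: "i \<in> L"
  shows "(\<Sum>k\<in>L. B i k * (\<Sum>j\<in>L. R k j * x j)) = x i"
proof -
  have "(\<Sum>k\<in>L. B i k * (\<Sum>j\<in>L. R k j * x j)) = (\<Sum>j\<in>L. (\<Sum>k\<in>L. B i k * R k j) * x j)"
    unfolding sum_distrib_left sum_distrib_right by (subst sum.swap) (simp add: mult_ac)
  also have "\<dots> = (\<Sum>j\<in>L. (if i = j then 1 else 0) * x j)"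
    using inv i by (intro sum.cong) (auto simp: inverse_on_def)
  finally show ?thesis using sum_single(1)[OF fin i] by metis
qed

lemma qform_alt: "qform L B x = Re (\<Sum>i\<in>L. cnj (x i) * (\<Sum>j\<in>L. B i j * x j))"
  by (simp add: qform_def sum_distrib_left mult_ac)

lemma cnj_apply_hermitian:
  assumes "hermitian_on L R" "j \<in> L"
  shows "(\<Sum>k\<in>L. cnj (u k) * R k j) = cnj (\<Sum>k\<in>L. R j k * u k)"
  unfolding cnj_sum complex_cnj_mult
  by (rule sum.cong) (simp_all add: assms hermitian_on_cnj[OF assms(1)])

lemma form_real:
  assumes "hermitian_on L R"
  shows "(\<Sum>k\<in>L. cnj (u k) * (\<Sum>j\<in>L. R k j * u j)) = complex_of_real (qform L R u)"
proof -
  let ?s = "\<Sum>k\<in>L. cnj (u k) * (\<Sum>j\<in>L. R k j * u j)"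
  have "cnj ?s = (\<Sum>k\<in>L. u k * (\<Sum>j\<in>L. cnj (u j) * R j k))"
    unfolding cnj_sum complex_cnj_mult complex_cnj_cnj
    by (rule sum.cong[OF refl], rule arg_cong[of _ _ "(*) (u _)"], rule sum.cong[OF refl])
       (simp add: hermitian_on_cnj[OF assms(1)] mult.commute)
  also have "\<dots> = ?s"
    unfolding sum_distrib_left by (subst sum.swap) (simp add: mult_ac)
  finally have "Im (cnj ?s) = Im ?s" by (rule arg_cong)
  hence "Im ?s = 0" unfolding cnj.sel by linarith
  thus ?thesis by (simp add: qform_alt complex_eq_iff)
qed

text \<open>Sherman-Morrison formula. It serves with \<open>s = 1\<close> to add a row to a Gram
  matrix and with negative \<open>s\<close> and a unit vector to lower a single diagonal
  entry.\<close>

lemma rank_one_inverse: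
  assumes inv: "inverse_on L B R" and fin: "finite L"
    and B': "\<And>i j. i \<in> L \<Longrightarrow> j \<in> L \<Longrightarrow> B' i j = B i j + of_real s * u i * cnj (u j)"
    and nz: "1 + s * qform L R u \<noteq> 0"
  defines "w \<equiv> \<lambda>i. \<Sum>j\<in>L. R i j * u j"
  defines "c \<equiv> s / (1 + s * qform L R u)"
  shows "inverse_on L B' (\<lambda>i j. R i j - of_real c * w i * cnj (w j))"
  unfolding inverse_on_def
proof (intro conjI ballI)
  have hB: "hermitian_on L B" and hR: "hermitian_on L R" using inv by (auto simp: inverse_on_def)
  show "hermitian_on L B'"
    by (rule hermitian_onI) (simp add: hermitian_on_cnj[OF hB] B' mult_ac)
  show "hermitian_on L (\<lambda>i j. R i j - of_real c * w i * cnj (w j))"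
    by (rule hermitian_onI) (simp add: hermitian_on_cnj[OF hR] mult_ac)
  fix i j assume i: "i \<in> L" and j: "j \<in> L"
  have 1: "(\<Sum>k\<in>L. B i k * w k) = u i"
    unfolding w_def by (rule inverse_on_apply[OF inv fin i])
  have 2: "(\<Sum>k\<in>L. cnj (u k) * R k j) = cnj (w j)"
    unfolding w_def by (rule cnj_apply_hermitian[OF hR j])
  have 3: "(\<Sum>k\<in>L. cnj (u k) * w k) = of_real (qform L R u)"
    unfolding w_def by (rule form_real[OF hR])
  have 4: "(\<Sum>k\<in>L. B i k * R k j) = (if i = j then 1 else 0)"
    using inv i j by (auto simp: inverse_on_def)
  have "(\<Sum>k\<in>L. B' i k * (R k j - of_real c * w k * cnj (w j)))
      = (\<Sum>k\<in>L. B i k * R k j + of_real s * u i * (cnj (u k) * R k j)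
          - of_real c * cnj (w j) * (B i k * w k) - of_real s * u i * of_real c * cnj (w j) * (cnj (u k) * w k))"
    by (intro sum.cong refl) (simp add: B' i algebra_simps)
  also have "\<dots> = (\<Sum>k\<in>L. B i k * R k j) + of_real s * u i * (\<Sum>k\<in>L. cnj (u k) * R k j)
      - of_real c * cnj (w j) * (\<Sum>k\<in>L. B i k * w k) - of_real s * u i * of_real c * cnj (w j) * (\<Sum>k\<in>L. cnj (u k) * w k)"
    by (simp add: sum.distrib sum_subtractf sum_distrib_left)
  also have "\<dots> = (if i = j then 1 else 0) + u i * cnj (w j) * of_real (s - c - s * c * qform L R u)"
    unfolding 1 2 3 4 by (simp add: algebra_simps)
  also have "s - c - s * c * qform L R u = 0"
    using nz unfolding c_def by (simp add: field_simps) 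
  finally show "(\<Sum>k\<in>L. B' i k * (R k j - of_real c * w k * cnj (w j))) = (if i = j then 1 else 0)"
    by simp
qed

text \<open>Substitute \<open>y = R x\<close> in the form of \<open>B\<close> and cancel
  \<open>B R\<close>. This transfers positivity from a matrix to its inverse.\<close>

lemma qform_inverse:
  assumes inv: "inverse_on L B R" and fin: "finite L"
  shows "qform L R x = qform L B (\<lambda>i. \<Sum>j\<in>L. R i j * x j)"
proof -
  have hR: "hermitian_on L R" using inv by (auto simp: inverse_on_def)
  have "qform L B (\<lambda>i. \<Sum>j\<in>L. R i j * x j) = Re (\<Sum>i\<in>L. cnj (\<Sum>j\<in>L. R i j * x j) * x i)"
    unfolding qform_alt by (intro arg_cong[of _ _ Re] sum.cong refl) (simp add: inverse_on_apply[OF inv fin])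
  also have "(\<Sum>i\<in>L. cnj (\<Sum>j\<in>L. R i j * x j) * x i) = cnj (\<Sum>i\<in>L. cnj (x i) * (\<Sum>j\<in>L. R i j * x j))"
    by (simp add: mult_ac)
  finally show ?thesis unfolding qform_alt by (simp only: cnj.sel)
qed

lemma qform_add_scaled:
  assumes h: "hermitian_on L R"
  shows "qform L R (\<lambda>i. x i - of_real s * y i)
     = qform L R x - 2 * s * Re (\<Sum>i\<in>L. cnj (x i) * (\<Sum>j\<in>L. R i j * y j)) + s\<^sup>2 * qform L R y"
proof -
  let ?P = "\<lambda>x y. (\<Sum>i\<in>L. \<Sum>j\<in>L. cnj (x i) * R i j * y j)"
  have e: "?P (\<lambda>i. x i - of_real s * y i) (\<lambda>i. x i - of_real s * y i)
     = ?P x x - of_real s * ?P x y - of_real s * ?P y x + of_real (s\<^sup>2) * ?P y y"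
    unfolding sum_distrib_left sum.distrib[symmetric] sum_subtractf[symmetric]
    by (intro sum.cong refl) (simp add: algebra_simps power2_eq_square)
  have "?P y x = cnj (?P x y)"
  proof -
    have "cnj (?P x y) = (\<Sum>i\<in>L. \<Sum>j\<in>L. cnj (y j) * R j i * x i)"
      unfolding cnj_sum by (intro sum.cong refl) (simp add: hermitian_on_cnj[OF h] mult_ac)
    thus ?thesis by (subst sum.swap) simp
  qed
  hence "Re (?P y x) = Re (?P x y)" by (simp only: cnj.sel)
  moreover have "(\<Sum>i\<in>L. cnj (x i) * (\<Sum>j\<in>L. R i j * y j)) = ?P x y"
    by (simp add: sum_distrib_left mult_ac)
  ultimately show ?thesis unfolding qform_def e by (simp add: algebra_simps)
qed

text \<open>Positivity is tested on the vectors with entry \<open>cnj (x j)\<close> at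
  \<open>i\<close> and \<open>- cnj (x i)\<close> at \<open>j\<close>. Summed over all pairs, the
  diagonal terms give twice the right-hand side and the mixed terms twice the form, so no spectral
  decomposition is involved.\<close>

lemma qform_le_trace:
  assumes fin: "finite L" and h: "hermitian_on L R" and psd: "\<And>x. 0 \<le> qform L R x"
  shows "qform L R x \<le> retrace L R * (\<Sum>i\<in>L. (cmod (x i))\<^sup>2)"
proof -
  define v where "v = (\<lambda>i j k. (if k = i then cnj (x j) else 0) - of_real 1 * (if k = j then cnj (x i) else 0))"
  have s1: "(\<Sum>a\<in>L. (if a = i then c else 0) * f a) = c * f i" if "i \<in> L" for i c and f :: "'a \<Rightarrow> complex"
    using fin that by (simp add: if_distrib[of "\<lambda>z. z * _"] cong: if_cong)
  have s2: "(\<Sum>a\<in>L. f a * (if a = i then c else 0)) = f i * c" if "i \<in> L" for i c and f :: "'a \<Rightarrow> complex"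
    using fin that by (simp add: if_distrib[of "\<lambda>z. _ * z"] cong: if_cong)
  have c1: "cnj (if P then a else 0) = (if P then cnj a else 0)" for P a by simp
  have v: "qform L R (v i j) = (cmod (x j))\<^sup>2 * Re (R i i) + (cmod (x i))\<^sup>2 * Re (R j j) - 2 * Re (cnj (x i) * R i j * x j)"
    if i: "i \<in> L" and j: "j \<in> L" for i j
  proof -
    have q1: "qform L R (\<lambda>k. if k = i then c else 0) = (cmod c)\<^sup>2 * Re (R i i)" if i: "i \<in> L" for i c
    proof -
      have "qform L R (\<lambda>k. if k = i then c else 0) = Re (cnj c * R i i * c)"
        unfolding qform_alt c1 by (simp only: s1 s2 i mult.assoc)
      also have "cnj c * R i i * c = of_real ((cmod c)\<^sup>2) * R i i"
        unfolding complex_norm_square by (simp add: mult_ac)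
      finally show ?thesis by simp
    qed
    show ?thesis unfolding v_def qform_add_scaled[OF h] q1[OF i] q1[OF j] c1 s1[OF i] s2[OF j]
      by (simp add: algebra_simps)
  qed
  have qx: "qform L R x = (\<Sum>i\<in>L. \<Sum>j\<in>L. Re (cnj (x i) * R i j * x j))"
    by (simp only: qform_def Re_sum)
  have "0 \<le> (\<Sum>i\<in>L. \<Sum>j\<in>L. qform L R (v i j))" by (intro sum_nonneg psd)
  also have "\<dots> = (\<Sum>i\<in>L. \<Sum>j\<in>L. (cmod (x j))\<^sup>2 * Re (R i i)) + (\<Sum>i\<in>L. \<Sum>j\<in>L. (cmod (x i))\<^sup>2 * Re (R j j)) - 2 * qform L R x"
    unfolding qx sum_distrib_left sum.distrib[symmetric] sum_subtractf[symmetric]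
    by (intro sum.cong refl) (simp only: v)
  also have "(\<Sum>i\<in>L. \<Sum>j\<in>L. (cmod (x j))\<^sup>2 * Re (R i i)) = retrace L R * (\<Sum>i\<in>L. (cmod (x i))\<^sup>2)"
    unfolding retrace_def sum_product by (simp add: mult_ac)
  also have "(\<Sum>i\<in>L. \<Sum>j\<in>L. (cmod (x i))\<^sup>2 * Re (R j j)) = retrace L R * (\<Sum>i\<in>L. (cmod (x i))\<^sup>2)"
    unfolding retrace_def sum_product by (subst sum.swap) (simp add: mult_ac)
  finally show ?thesis by simp
qed

text \<open>In terms of eigenvalues: the least one of \<open>B\<close> is at least
  \<open>1 / \<phi>\<close>, because its reciprocal is one summand of the trace of \<open>R\<close>.
  The proof instead evaluates the form of \<open>B\<close> at \<open>x - R x / \<phi>\<close> and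
  bounds the form of \<open>R\<close> by its trace.\<close>

lemma inverse_trace_coercive:
  assumes fin: "finite L" and inv: "inverse_on L B R" and psd: "\<And>x. 0 \<le> qform L B x"
    and tr: "retrace L R \<le> \<phi>" and \<phi>: "\<phi> > 0"
  shows "(\<Sum>i\<in>L. (cmod (x i))\<^sup>2) / \<phi> \<le> qform L B x"
proof -
  have hB: "hermitian_on L B" and hR: "hermitian_on L R" using inv by (auto simp: inverse_on_def)
  let ?N = "\<Sum>i\<in>L. (cmod (x i))\<^sup>2"
  have psdR: "0 \<le> qform L R y" for y unfolding qform_inverse[OF inv fin] by (rule psd)
  have "Re (\<Sum>i\<in>L. cnj (x i) * (\<Sum>j\<in>L. B i j * (\<Sum>k\<in>L. R j k * x k))) = Re (\<Sum>i\<in>L. cnj (x i) * x i)"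
    by (intro arg_cong[of _ _ Re] sum.cong refl) (simp add: inverse_on_apply[OF inv fin])
  also have "\<dots> = ?N" unfolding Re_sum
    by (intro sum.cong refl) (metis Re_complex_of_real complex_norm_square mult.commute)
  finally have "0 \<le> qform L B x - 2 * (1/\<phi>) * ?N + (1/\<phi>)\<^sup>2 * qform L R x"
    using psd[of "\<lambda>i. x i - of_real (1/\<phi>) * (\<Sum>j\<in>L. R i j * x j)"]
    unfolding qform_add_scaled[OF hB] qform_inverse[OF inv fin, symmetric] by simp
  moreover have "qform L R x \<le> \<phi> * ?N"
    using qform_le_trace[OF fin hR psdR, of x] tr
    by (meson mult_right_mono order_trans sum_nonneg zero_le_power2)
  hence "(1/\<phi>)\<^sup>2 * qform L R x \<le> (1/\<phi>)\<^sup>2 * (\<phi> * ?N)" by (intro mult_left_mono) auto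
  moreover have "(1/\<phi>)\<^sup>2 * (\<phi> * ?N) = ?N / \<phi>" using \<phi> by (simp add: power2_eq_square)
  ultimately show ?thesis by simp
qed


section \<open>Resolvents: the effect of moving the barrier\<close>

lemma resolvent_identity:
  assumes fin: "finite L" and inv: "inverse_on L B R" and inv': "inverse_on L B' R'"
    and B: "\<And>i j. i \<in> L \<Longrightarrow> j \<in> L \<Longrightarrow> B i j = B' i j + (if i = j then of_real \<delta> else 0)"
    and i: "i \<in> L" and j: "j \<in> L"
  shows "R' i j - R i j = of_real \<delta> * (\<Sum>k\<in>L. R i k * R' k j)"
proof -
  have 1: "(\<Sum>l\<in>L. B k l * R' l j) = (if k = j then 1 else 0) + of_real \<delta> * R' k j" if k: "k \<in> L" for k
  proof -
    have "(\<Sum>l\<in>L. B k l * R' l j) = (\<Sum>l\<in>L. B' k l * R' l j + of_real \<delta> * ((if k = l then 1 else 0) * R' l j))"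
      by (intro sum.cong refl) (auto simp: B k algebra_simps)
    also have "\<dots> = (if k = j then 1 else 0) + of_real \<delta> * R' k j"
      unfolding sum.distrib sum_distrib_left[symmetric] sum_single[OF fin k]
      using inv' k j by (simp add: inverse_on_def)
    finally show ?thesis .
  qed
  have "R' i j = (\<Sum>l\<in>L. (if i = l then 1 else 0) * R' l j)"
    by (rule sum_single(1)[OF fin i, symmetric])
  also have "\<dots> = (\<Sum>l\<in>L. (\<Sum>k\<in>L. R i k * B k l) * R' l j)"
    by (intro sum.cong refl) (simp add: inverse_on_left[OF inv i])
  also have "\<dots> = (\<Sum>k\<in>L. R i k * (\<Sum>l\<in>L. B k l * R' l j))"
    unfolding sum_distrib_left sum_distrib_right by (subst sum.swap) (simp add: mult_ac)
  also have "\<dots> = (\<Sum>k\<in>L. R i k * (if k = j then 1 else 0) + of_real \<delta> * (R i k * R' k j))"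
    by (intro sum.cong refl) (simp add: 1 algebra_simps)
  also have "\<dots> = R i j + of_real \<delta> * (\<Sum>k\<in>L. R i k * R' k j)"
    unfolding sum.distrib sum_distrib_left[symmetric] sum_single[OF fin j] ..
  finally show ?thesis by simp
qed

definition frob :: "'i set \<Rightarrow> ('i \<Rightarrow> 'i \<Rightarrow> complex) \<Rightarrow> real" where
  "frob L R = (\<Sum>i\<in>L. \<Sum>j\<in>L. (cmod (R i j))\<^sup>2)"

text \<open>The right-hand side is the trace of \<open>(I - s R') R (I - s R')\<close>. By the
  resolvent identity \<open>b\<close> is the trace of \<open>R R'\<close>, and a second use of the
  identity gives \<open>(frob L R' - b) / \<delta>\<close> for the trace of \<open>R' R R'\<close>.
  The free parameter \<open>s\<close> stores a Cauchy-Schwarz inequality between these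
  traces.\<close>

lemma trace_shift_quadratic:
  assumes fin: "finite L" and inv: "inverse_on L B R" and inv': "inverse_on L B' R'"
    and B: "\<And>i j. i \<in> L \<Longrightarrow> j \<in> L \<Longrightarrow> B i j = B' i j + (if i = j then of_real \<delta> else 0)"
    and \<delta>: "\<delta> > 0" and psd: "\<And>x. 0 \<le> qform L R x"
  defines "b \<equiv> (retrace L R' - retrace L R) / \<delta>"
  shows "0 \<le> retrace L R - 2 * s * b + s\<^sup>2 * ((frob L R' - b) / \<delta>)"
proof -
  have hR: "hermitian_on L R" and hR': "hermitian_on L R'"
    using inverse_on_hermitian(2)[OF inv] inverse_on_hermitian(2)[OF inv'] .
  define P where "P = (\<lambda>i j. \<Sum>k\<in>L. R i k * R' k j)"
  have P: "P i j = (R' i j - R i j) / of_real \<delta>" if "i \<in> L" "j \<in> L" for i j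
    using resolvent_identity[OF fin inv inv' B that] \<delta> by (simp add: P_def)
  have bP: "b = (\<Sum>j\<in>L. Re (P j j))"
    unfolding b_def retrace_def sum_subtractf[symmetric] sum_divide_distrib
    by (intro sum.cong refl) (simp add: P)
  define e where "e = (\<lambda>(j::'a) i. if i = j then 1 else 0 :: complex)"
  have ce: "cnj (e j i) = e j i" for i j by (simp add: e_def)
  have se: "(\<Sum>i\<in>L. e j i * f i) = f j" "(\<Sum>i\<in>L. f i * e j i) = f j" if "j \<in> L" for j f
    using sum_single[OF fin that] by (simp_all add: e_def eq_commute)
  have 1: "qform L R (e j) = Re (R j j)" if "j \<in> L" for j
    unfolding qform_alt ce by (simp only: se that)
  have 2: "(\<Sum>i\<in>L. cnj (e j i) * (\<Sum>k\<in>L. R i k * R' k j)) = P j j" if "j \<in> L" for j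
    unfolding ce P_def by (simp only: se that)
  have 3: "qform L R (\<lambda>i. R' i j) = (\<Sum>i\<in>L. Re (cnj (R' i j) * P i j))" for j
    unfolding qform_alt P_def Re_sum ..
  have "(\<Sum>j\<in>L. \<Sum>i\<in>L. Re (cnj (R' i j) * R i j)) = (\<Sum>i\<in>L. Re (P i i))"
  proof -
    have "(\<Sum>j\<in>L. \<Sum>i\<in>L. Re (cnj (R' i j) * R i j)) = (\<Sum>i\<in>L. \<Sum>j\<in>L. Re (R i j * R' j i))"
      by (subst sum.swap, intro sum.cong refl) (simp add: hermitian_on_cnj[OF hR'] mult_ac del: times_complex.sel)
    thus ?thesis by (simp only: P_def Re_sum)
  qed
  note cross = this
  have cm: "Re (cnj z * z) = (cmod z)\<^sup>2" for z
    by (metis Re_complex_of_real complex_norm_square mult.commute)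
  have 4: "(\<Sum>j\<in>L. qform L R (\<lambda>i. R' i j)) = (frob L R' - b) / \<delta>"
  proof -
    have "(\<Sum>j\<in>L. qform L R (\<lambda>i. R' i j)) = (\<Sum>j\<in>L. \<Sum>i\<in>L. ((cmod (R' i j))\<^sup>2 - Re (cnj (R' i j) * R i j)) / \<delta>)"
      unfolding 3
    proof (intro sum.cong refl)
      fix i j assume "i \<in> L" "j \<in> L"
      have "cnj (R' i j) * P i j = (cnj (R' i j) * R' i j - cnj (R' i j) * R i j) / of_real \<delta>"
        unfolding P[OF \<open>i \<in> L\<close> \<open>j \<in> L\<close>] by (simp add: algebra_simps)
      thus "Re (cnj (R' i j) * P i j) = ((cmod (R' i j))\<^sup>2 - Re (cnj (R' i j) * R i j)) / \<delta>"
        by (simp only: Re_divide_of_real minus_complex.sel cm)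
    qed
    also have "\<dots> = ((\<Sum>j\<in>L. \<Sum>i\<in>L. (cmod (R' i j))\<^sup>2) - b) / \<delta>"
      unfolding sum_divide_distrib[symmetric] sum_subtractf cross bP ..
    also have "(\<Sum>j\<in>L. \<Sum>i\<in>L. (cmod (R' i j))\<^sup>2) = frob L R'"
      unfolding frob_def by (rule sum.swap)
    finally show ?thesis .
  qed
  have "0 \<le> (\<Sum>j\<in>L. qform L R (\<lambda>i. e j i - of_real s * R' i j))" by (intro sum_nonneg psd)
  also have "\<dots> = (\<Sum>j\<in>L. Re (R j j) - 2 * s * Re (P j j) + s\<^sup>2 * qform L R (\<lambda>i. R' i j))"
    unfolding qform_add_scaled[OF hR] by (intro sum.cong refl) (simp only: 1 2)
  also have "\<dots> = retrace L R - 2 * s * b + s\<^sup>2 * ((frob L R' - b) / \<delta>)"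
    unfolding sum.distrib sum_subtractf sum_distrib_left[symmetric] 4 bP retrace_def ..
  finally show ?thesis .
qed

lemma trace_le_frob:
  assumes fin: "finite L"
  shows "(retrace L R)\<^sup>2 \<le> card L * frob L R"
proof -
  have "(retrace L R)\<^sup>2 \<le> (\<Sum>i\<in>L. (Re (R i i))\<^sup>2) * card L"
    using Cauchy_Schwarz_ineq_sum[of "\<lambda>i. Re (R i i)" "\<lambda>_. 1" L] by (simp add: retrace_def)
  also have "(\<Sum>i\<in>L. (Re (R i i))\<^sup>2) \<le> frob L R"
    unfolding frob_def
  proof (intro sum_mono)
    fix i assume i: "i \<in> L"
    have "(Re (R i i))\<^sup>2 \<le> (cmod (R i i))\<^sup>2" by (metis abs_Re_le_cmod abs_le_square_iff abs_norm_cancel)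
    also have "\<dots> \<le> (\<Sum>j\<in>L. (cmod (R i j))\<^sup>2)" using i fin by (intro member_le_sum) auto
    finally show "(Re (R i i))\<^sup>2 \<le> (\<Sum>j\<in>L. (cmod (R i j))\<^sup>2)" .
  qed
  hence "(\<Sum>i\<in>L. (Re (R i i))\<^sup>2) * card L \<le> frob L R * card L" by (intro mult_right_mono) auto
  finally show ?thesis by (simp add: mult.commute)
qed

text \<open>The inverse of \<open>B - \<delta> I\<close> is built by subtracting the diagonal entries one at a time, each
  being a rank-one update.\<close>
lemma shifted_inverse_exists:
  assumes fin: "finite L" and inv: "inverse_on L B R" and \<delta>: "\<delta> > 0" and \<gamma>: "\<gamma> > \<delta>"
    and coercive: "\<And>x. \<gamma> * (\<Sum>i\<in>L. (cmod (x i))\<^sup>2) \<le> qform L B x"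
  shows "\<exists>R'. inverse_on L (\<lambda>i j. B i j - (if i = j then of_real \<delta> else 0)) R'"
proof -
  have "\<exists>R'. inverse_on L (\<lambda>i j. B i j - (if i = j \<and> i \<in> T then of_real \<delta> else 0)) R'" if "T \<subseteq> L" for T
    using finite_subset[OF that fin] that
  proof (induction T)
    case empty
    show ?case using inv by auto
  next
    case (insert e T)
    let ?B = "\<lambda>i j. B i j - (if i = j \<and> i \<in> T then of_real \<delta> else 0)"
    obtain R1 where R1: "inverse_on L ?B R1" using insert by auto
    have e: "e \<in> L" using insert by auto
    define u where "u = (\<lambda>i. if i = e then 1 else 0 :: complex)"
    define y where "y = (\<lambda>i. \<Sum>j\<in>L. R1 i j * u j)"
    have y: "y i = R1 i e" for i
      unfolding y_def u_def using fin e by (simp add: if_distrib[of "\<lambda>z. _ * z"] cong: if_cong)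
    define q where "q = qform L R1 u"
    have "complex_of_real q = (\<Sum>k\<in>L. cnj (u k) * y k)"
      unfolding q_def y_def by (rule form_real[OF inverse_on_hermitian(2)[OF R1], symmetric])
    also have "\<dots> = y e" unfolding u_def using fin e by (simp add: if_distrib[of "\<lambda>z. z * _"] if_distrib[of cnj] cong: if_cong)
    finally have q: "y e = of_real q" ..
    have "qform L ?B y = qform L B y - \<delta> * (\<Sum>i\<in>L. if i \<in> T then (cmod (y i))\<^sup>2 else 0)"
    proof -
      have "(\<Sum>i\<in>L. \<Sum>j\<in>L. cnj (y i) * ?B i j * y j)
         = (\<Sum>i\<in>L. (\<Sum>j\<in>L. cnj (y i) * B i j * y j) - (if i \<in> T then of_real (\<delta> * (cmod (y i))\<^sup>2) else 0))"
      proof (intro sum.cong refl)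
        fix i assume i: "i \<in> L"
        have "(\<Sum>j\<in>L. cnj (y i) * ?B i j * y j) = (\<Sum>j\<in>L. cnj (y i) * B i j * y j)
            - (\<Sum>j\<in>L. if i = j then (if i \<in> T then cnj (y i) * of_real \<delta> * y i else 0) else 0)"
          unfolding sum_subtractf[symmetric] by (intro sum.cong refl) (auto simp: algebra_simps)
        also have "(\<Sum>j\<in>L. if i = j then (if i \<in> T then cnj (y i) * of_real \<delta> * y i else 0) else 0)
            = (if i \<in> T then of_real (\<delta> * (cmod (y i))\<^sup>2) else 0)"
          using fin i by (simp add: complex_norm_square mult_ac del: of_real_power)
        finally show "(\<Sum>j\<in>L. cnj (y i) * ?B i j * y j) = (\<Sum>j\<in>L. cnj (y i) * B i j * y j) - (if i \<in> T then of_real (\<delta> * (cmod (y i))\<^sup>2) else 0)" .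
      qed
      moreover have "(\<Sum>i\<in>L. if i \<in> T then complex_of_real (\<delta> * (cmod (y i))\<^sup>2) else 0)
          = of_real (\<delta> * (\<Sum>i\<in>L. if i \<in> T then (cmod (y i))\<^sup>2 else 0))"
        unfolding sum_distrib_left of_real_sum by (intro sum.cong refl) auto
      ultimately show ?thesis unfolding qform_def sum_subtractf
        by (simp only: minus_complex.sel Re_complex_of_real)
    qed
    moreover have "qform L ?B y = q"
      unfolding q_def y_def by (rule qform_inverse[OF R1 fin, symmetric])
    moreover have "(\<Sum>i\<in>L. if i \<in> T then (cmod (y i))\<^sup>2 else 0) + (cmod (y e))\<^sup>2 \<le> (\<Sum>i\<in>L. (cmod (y i))\<^sup>2)"
    proof -
      have "(\<Sum>i\<in>L. if i \<in> T then (cmod (y i))\<^sup>2 else 0) + (cmod (y e))\<^sup>2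
         = (\<Sum>i\<in>L. (if i \<in> T then (cmod (y i))\<^sup>2 else 0) + (if i = e then (cmod (y e))\<^sup>2 else 0))"
        using fin e by (simp add: sum.distrib)
      also have "\<dots> \<le> (\<Sum>i\<in>L. (cmod (y i))\<^sup>2)" using insert(2) by (intro sum_mono) auto
      finally show ?thesis .
    qed
    hence "\<delta> * ((\<Sum>i\<in>L. if i \<in> T then (cmod (y i))\<^sup>2 else 0) + (cmod (y e))\<^sup>2) \<le> \<delta> * (\<Sum>i\<in>L. (cmod (y i))\<^sup>2)"
      using \<delta> by (intro mult_left_mono) auto
    moreover have "(cmod (y e))\<^sup>2 = q\<^sup>2" by (simp add: q)
    moreover note coercive[of y]
    ultimately have main: "(\<gamma> - \<delta>) * (\<Sum>i\<in>L. (cmod (y i))\<^sup>2) + \<delta> * q\<^sup>2 \<le> q"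
      by (simp add: algebra_simps)
    \<comment> \<open>The number \<open>q\<close> is both the \<open>e\<close>-th entry of
      \<open>y\<close> and the form of the current matrix at \<open>y\<close>. If
      \<open>\<delta> * q = 1\<close>, the two sides of \<open>main\<close> cancel up to the
      strictly coercive part, which forces \<open>y = 0\<close> and hence
      \<open>q = 0\<close>.\<close>
    have "1 + (- \<delta>) * q \<noteq> 0"
    proof
      assume a: "1 + (- \<delta>) * q = 0"
      hence "\<delta> * q\<^sup>2 = q" by (simp add: power2_eq_square)
      hence "(\<gamma> - \<delta>) * (\<Sum>i\<in>L. (cmod (y i))\<^sup>2) \<le> 0" using main by simp
      hence "(\<Sum>i\<in>L. (cmod (y i))\<^sup>2) \<le> 0" using \<gamma> by (simp add: mult_le_0_iff)
      moreover have "(cmod (y e))\<^sup>2 \<le> (\<Sum>i\<in>L. (cmod (y i))\<^sup>2)" using fin e by (intro member_le_sum) auto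
      ultimately have "q\<^sup>2 \<le> 0" by (simp only: q norm_of_real power2_abs)
      hence "q = 0" by simp
      thus False using a by simp
    qed
    hence nz: "1 + (- \<delta>) * qform L R1 u \<noteq> 0" by (simp only: q_def not_False_eq_True)
    have upd: "B i j - (if i = j \<and> i \<in> insert e T then of_real \<delta> else 0) = ?B i j + of_real (- \<delta>) * u i * cnj (u j)" for i j
      using insert(2) by (auto simp: u_def)
    show ?case using rank_one_inverse[OF R1 fin upd nz] by blast
  qed
  from this[of L] obtain R' where R': "inverse_on L (\<lambda>i j. B i j - (if i = j \<and> i \<in> L then of_real \<delta> else 0)) R'" by auto
  have "inverse_on L (\<lambda>i j. B i j - (if i = j then of_real \<delta> else 0)) R'"
    by (rule inverse_on_cong[OF R']) auto
  thus ?thesis by blast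
qed


section \<open>The lower barrier and the choice of rows\<close>

definition gram_shift :: "('t \<Rightarrow> 'i \<Rightarrow> complex) \<Rightarrow> 't set \<Rightarrow> real \<Rightarrow> 'i \<Rightarrow> 'i \<Rightarrow> complex" where
  "gram_shift u J l = (\<lambda>i j. (\<Sum>t\<in>J. u t i * cnj (u t j)) - (if i = j then of_real l else 0))"

text \<open>The lower barrier potential of Batson, Spielman and Srivastava: positivity together with
  the trace bound keeps every eigenvalue of the Gram matrix of the rows in \<open>J\<close> at least
  \<open>1 / \<phi>\<close> above \<open>l\<close>.\<close>

definition barrier :: "'i set \<Rightarrow> ('t \<Rightarrow> 'i \<Rightarrow> complex) \<Rightarrow> real \<Rightarrow> 't set \<Rightarrow> real \<Rightarrow> bool" where
  "barrier L u \<phi> J l \<longleftrightarrow> (\<exists>R. inverse_on L (gram_shift u J l) R \<and>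
     (\<forall>x. 0 \<le> qform L (gram_shift u J l) x) \<and> retrace L R \<le> \<phi>)"

lemma Re_cnj_mult_self: "Re (cnj z * z) = (cmod z)\<^sup>2"
  by (metis Re_complex_of_real complex_norm_square mult.commute)

lemma Re_of_real_mult: "Re (of_real c * z) = c * Re z"
  by simp

text \<open>Nonnegativity of this form says that the rows in \<open>J\<close> have lower frame bound
  \<open>l\<close>; this is how the final barrier is read off.\<close>

lemma qform_gram_shift:
  assumes "finite L" "finite J"
  shows "qform L (gram_shift u J l) x
     = (\<Sum>t\<in>J. (cmod (\<Sum>i\<in>L. cnj (u t i) * x i))\<^sup>2) - l * (\<Sum>i\<in>L. (cmod (x i))\<^sup>2)"
proof -
  have 1: "(\<Sum>i\<in>L. \<Sum>j\<in>L. cnj (x i) * (\<Sum>t\<in>J. u t i * cnj (u t j)) * x j)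
      = (\<Sum>t\<in>J. cnj (\<Sum>i\<in>L. cnj (u t i) * x i) * (\<Sum>j\<in>L. cnj (u t j) * x j))"
  proof -
    have "(\<Sum>t\<in>J. cnj (\<Sum>i\<in>L. cnj (u t i) * x i) * (\<Sum>j\<in>L. cnj (u t j) * x j))
       = (\<Sum>t\<in>J. \<Sum>i\<in>L. \<Sum>j\<in>L. cnj (x i) * (u t i * cnj (u t j)) * x j)"
      unfolding cnj_sum sum_product by (simp add: mult_ac)
    also have "\<dots> = (\<Sum>i\<in>L. \<Sum>t\<in>J. \<Sum>j\<in>L. cnj (x i) * (u t i * cnj (u t j)) * x j)"
      by (rule sum.swap)
    also have "\<dots> = (\<Sum>i\<in>L. \<Sum>j\<in>L. \<Sum>t\<in>J. cnj (x i) * (u t i * cnj (u t j)) * x j)"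
      by (intro sum.cong refl sum.swap)
    finally show ?thesis by (simp add: sum_distrib_left sum_distrib_right)
  qed
  have 2: "(\<Sum>i\<in>L. \<Sum>j\<in>L. cnj (x i) * (if i = j then of_real l else 0) * x j)
     = (\<Sum>i\<in>L. of_real l * (cnj (x i) * x i))"
  proof (intro sum.cong refl)
    fix i assume i: "i \<in> L"
    have "(\<Sum>j\<in>L. cnj (x i) * (if i = j then of_real l else 0) * x j)
       = (\<Sum>j\<in>L. if i = j then cnj (x i) * of_real l * x i else 0)"
      by (intro sum.cong refl) auto
    thus "(\<Sum>j\<in>L. cnj (x i) * (if i = j then of_real l else 0) * x j) = of_real l * (cnj (x i) * x i)"
      using assms i by simp
  qed
  have "qform L (gram_shift u J l) x
     = Re (\<Sum>t\<in>J. cnj (\<Sum>i\<in>L. cnj (u t i) * x i) * (\<Sum>j\<in>L. cnj (u t j) * x j))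
       - Re (of_real l * (\<Sum>i\<in>L. cnj (x i) * x i))"
    unfolding qform_def gram_shift_def 1[symmetric] sum_distrib_left[of "of_real l"] 2[symmetric]
      minus_complex.sel(1)[symmetric] sum_subtractf[symmetric]
    by (simp only: left_diff_distrib right_diff_distrib)
  thus ?thesis by (simp only: Re_of_real_mult Re_sum Re_cnj_mult_self)
qed

lemma sum_qform_gram:
  assumes fin: "finite L" and inv: "inverse_on L B R"
    and A: "\<And>i j. i \<in> L \<Longrightarrow> j \<in> L \<Longrightarrow> (\<Sum>t\<in>J. u t i * cnj (u t j)) = of_real c * B i j + (if i = j then of_real l else 0)"
  shows "(\<Sum>t\<in>J. qform L R (u t)) = c * card L + l * retrace L R"
    and "(\<Sum>t\<in>J. \<Sum>i\<in>L. (cmod (\<Sum>j\<in>L. R i j * u t j))\<^sup>2) = c * retrace L R + l * frob L R"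
proof -
  have hR: "hermitian_on L R" by (rule inverse_on_hermitian(2)[OF inv])
  have RA: "(\<Sum>j\<in>L. R i j * (\<Sum>t\<in>J. u t j * cnj (u t k))) = (if i = k then of_real c else 0) + of_real l * R i k"
    if i: "i \<in> L" and k: "k \<in> L" for i k
  proof -
    have "(\<Sum>j\<in>L. R i j * (\<Sum>t\<in>J. u t j * cnj (u t k))) = (\<Sum>j\<in>L. of_real c * (R i j * B j k) + of_real l * (R i j * (if j = k then 1 else 0)))"
      by (intro sum.cong refl) (auto simp: A k algebra_simps)
    also have "\<dots> = of_real c * (\<Sum>j\<in>L. R i j * B j k) + of_real l * R i k"
      unfolding sum.distrib sum_distrib_left[symmetric] sum_single[OF fin k] ..
    also have "of_real c * (\<Sum>j\<in>L. R i j * B j k) = (if i = k then of_real c else 0)"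
      unfolding inverse_on_left[OF inv i k] by simp
    finally show ?thesis .
  qed
  have "(\<Sum>t\<in>J. \<Sum>i\<in>L. \<Sum>j\<in>L. cnj (u t i) * R i j * u t j) = (\<Sum>i\<in>L. \<Sum>j\<in>L. R i j * (\<Sum>t\<in>J. u t j * cnj (u t i)))"
  proof -
    have "(\<Sum>t\<in>J. \<Sum>i\<in>L. \<Sum>j\<in>L. cnj (u t i) * R i j * u t j) = (\<Sum>i\<in>L. \<Sum>t\<in>J. \<Sum>j\<in>L. cnj (u t i) * R i j * u t j)"
      by (rule sum.swap)
    also have "\<dots> = (\<Sum>i\<in>L. \<Sum>j\<in>L. \<Sum>t\<in>J. cnj (u t i) * R i j * u t j)"
      by (intro sum.cong refl sum.swap)
    finally show ?thesis by (simp add: sum_distrib_left mult_ac)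
  qed
  also have "\<dots> = (\<Sum>i\<in>L. of_real c + of_real l * R i i)"
    by (intro sum.cong refl) (simp add: RA)
  finally have "(\<Sum>t\<in>J. qform L R (u t)) = Re (\<Sum>i\<in>L. of_real c + of_real l * R i i)"
    unfolding qform_def Re_sum[of _ J, symmetric] by (rule arg_cong)
  also have "\<dots> = c * card L + l * retrace L R"
    unfolding retrace_def by (simp add: sum.distrib sum_distrib_left)
  finally show "(\<Sum>t\<in>J. qform L R (u t)) = c * card L + l * retrace L R" .

  have e: "(\<Sum>t\<in>J. cnj (\<Sum>k\<in>L. R i k * u t k) * (\<Sum>j\<in>L. R i j * u t j))
     = of_real c * R i i + of_real l * (\<Sum>k\<in>L. cnj (R i k) * R i k)" if i: "i \<in> L" for i
  proof -
    have "(\<Sum>t\<in>J. cnj (\<Sum>k\<in>L. R i k * u t k) * (\<Sum>j\<in>L. R i j * u t j))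
       = (\<Sum>t\<in>J. \<Sum>k\<in>L. \<Sum>j\<in>L. cnj (R i k) * (R i j * (u t j * cnj (u t k))))"
      unfolding cnj_sum sum_product by (simp add: mult_ac)
    also have "\<dots> = (\<Sum>k\<in>L. \<Sum>t\<in>J. \<Sum>j\<in>L. cnj (R i k) * (R i j * (u t j * cnj (u t k))))"
      by (rule sum.swap)
    also have "\<dots> = (\<Sum>k\<in>L. \<Sum>j\<in>L. \<Sum>t\<in>J. cnj (R i k) * (R i j * (u t j * cnj (u t k))))"
      by (intro sum.cong refl sum.swap)
    also have "\<dots> = (\<Sum>k\<in>L. cnj (R i k) * (\<Sum>j\<in>L. R i j * (\<Sum>t\<in>J. u t j * cnj (u t k))))"
      by (simp add: sum_distrib_left)
    also have "\<dots> = (\<Sum>k\<in>L. of_real c * ((if i = k then 1 else 0) * cnj (R i k)) + of_real l * (cnj (R i k) * R i k))"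
      by (intro sum.cong refl) (auto simp: RA i algebra_simps)
    also have "\<dots> = of_real c * cnj (R i i) + of_real l * (\<Sum>k\<in>L. cnj (R i k) * R i k)"
      unfolding sum.distrib sum_distrib_left[symmetric] sum_single[OF fin i] ..
    finally show ?thesis by (simp only: hermitian_on_cnj[OF hR i i])
  qed
  have "(\<Sum>t\<in>J. \<Sum>i\<in>L. (cmod (\<Sum>j\<in>L. R i j * u t j))\<^sup>2)
     = (\<Sum>i\<in>L. Re (\<Sum>t\<in>J. cnj (\<Sum>k\<in>L. R i k * u t k) * (\<Sum>j\<in>L. R i j * u t j)))"
    unfolding Re_sum[of _ J] Re_cnj_mult_self by (rule sum.swap)
  also have "\<dots> = (\<Sum>i\<in>L. c * Re (R i i) + l * (\<Sum>k\<in>L. (cmod (R i k))\<^sup>2))"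
  proof (intro sum.cong refl)
    fix i assume i: "i \<in> L"
    have "Re (of_real l * (\<Sum>k\<in>L. cnj (R i k) * R i k)) = l * (\<Sum>k\<in>L. (cmod (R i k))\<^sup>2)"
      by (simp only: Re_of_real_mult Re_sum Re_cnj_mult_self)
    thus "Re (\<Sum>t\<in>J. cnj (\<Sum>k\<in>L. R i k * u t k) * (\<Sum>j\<in>L. R i j * u t j))
       = c * Re (R i i) + l * (\<Sum>k\<in>L. (cmod (R i k))\<^sup>2)"
      unfolding e[OF i] plus_complex.sel Re_of_real_mult[of c] by simp
  qed
  also have "\<dots> = c * retrace L R + l * frob L R"
    by (simp add: sum.distrib sum_distrib_left retrace_def frob_def)
  finally show "(\<Sum>t\<in>J. \<Sum>i\<in>L. (cmod (\<Sum>j\<in>L. R i j * u t j))\<^sup>2) = c * retrace L R + l * frob L R" .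
qed

text \<open>If \<open>\<Phi>' = tr R'\<close> exceeds \<open>\<phi>\<close> after the shift, adding the row \<open>u\<close> lowers it by
  \<open>|R'u|\<^sup>2 / (1 + u\<^sup>*R'u)\<close>. The sums of numerators and denominators over the unused rows are explicit in
  \<open>tr R'\<close> and \<open>tr R'\<^sup>2\<close>, because the used rows sum to \<open>B' + (l + \<delta>) I\<close> and all rows to a multiple of
  \<open>I\<close>; so some unused row lowers it enough.\<close>
lemma barrier_step:
  fixes L :: "'i set" and T :: "'t set"
  assumes fin: "finite L" "L \<noteq> {}" "finite T" and J: "J \<subseteq> T"
    and tight: "\<And>i j. i \<in> L \<Longrightarrow> j \<in> L \<Longrightarrow> (\<Sum>t\<in>T. u t i * cnj (u t j)) = (if i = j then of_nat (card T) else 0)"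
    and bar: "barrier L u \<phi> J l"
    and \<delta>: "\<delta> > 0" and \<phi>: "\<phi> > 0" "\<delta> * \<phi> < 1"
  defines "n \<equiv> real (card L)" and "M \<equiv> real (card T) - (l + \<delta>)"
  assumes c1: "M - n/\<phi> \<ge> 0" and c2: "(M - n/\<phi>)/\<phi> \<ge> M * \<delta>"
    and c3: "(M - n/\<phi>)/\<delta> - M * \<phi> + n > real (card T)"
  shows "\<exists>J'\<subseteq>T. card J' \<le> Suc (card J) \<and> barrier L u \<phi> J' (l + \<delta>)"
proof -
  define l' where "l' = l + \<delta>"
  let ?B = "gram_shift u J l" and ?B' = "gram_shift u J l'"
  have finJ: "finite J" using J fin finite_subset by auto
  obtain R where R: "inverse_on L ?B R" and psd: "\<And>x. 0 \<le> qform L ?B x" and tr: "retrace L R \<le> \<phi>"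
    using bar by (auto simp: barrier_def)
  have coercive: "(1/\<phi>) * (\<Sum>i\<in>L. (cmod (x i))\<^sup>2) \<le> qform L ?B x" for x
    using inverse_trace_coercive[OF fin(1) R psd tr \<phi>(1), of x] by simp
  have B': "?B' = (\<lambda>i j. ?B i j - (if i = j then of_real \<delta> else 0))"
    by (auto simp: gram_shift_def l'_def fun_eq_iff)
  have "1/\<phi> > \<delta>" using \<phi> by (simp add: field_simps)
  from shifted_inverse_exists[OF fin(1) R \<delta> this coercive]
  obtain R' where R': "inverse_on L ?B' R'" unfolding B' by auto
  have psd': "0 \<le> qform L ?B' x" for x
  proof -
    have "qform L ?B' x = qform L ?B x - \<delta> * (\<Sum>i\<in>L. (cmod (x i))\<^sup>2)"
      unfolding qform_gram_shift[OF fin(1) finJ] l'_def by (simp add: algebra_simps)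
    moreover have "\<delta> * (\<Sum>i\<in>L. (cmod (x i))\<^sup>2) \<le> (1/\<phi>) * (\<Sum>i\<in>L. (cmod (x i))\<^sup>2)"
      using \<open>1/\<phi> > \<delta>\<close> by (intro mult_right_mono sum_nonneg) auto
    ultimately show ?thesis using coercive[of x] by linarith
  qed
  have psdR: "0 \<le> qform L R x" for x unfolding qform_inverse[OF R fin(1)] by (rule psd)
  have psdR': "0 \<le> qform L R' x" for x unfolding qform_inverse[OF R' fin(1)] by (rule psd')
  define \<Phi> \<Phi>' F b where "\<Phi> = retrace L R" and "\<Phi>' = retrace L R'" and "F = frob L R'" and "b = (\<Phi>' - \<Phi>) / \<delta>"
  show ?thesis
  \<comment> \<open>If the trace stays below \<open>\<phi>\<close> after the shift, no row is spent
    in this step; this is why the cardinality bound is an inequality.\<close>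
  proof (cases "\<Phi>' \<le> \<phi>")
    case True
    hence "barrier L u \<phi> J l'" unfolding barrier_def using R' psd' by (auto simp: \<Phi>'_def)
    thus ?thesis using J by (auto simp: l'_def)
  next
    case False
    define D where "D = \<Phi>' - \<phi>"
    have D: "D > 0" using False by (simp add: D_def)
    define w where "w = (\<lambda>t i. \<Sum>j\<in>L. R' i j * u t j)"
    define W where "W = (\<lambda>t. \<Sum>i\<in>L. (cmod (w t i))\<^sup>2)"
    define q where "q = (\<lambda>t. qform L R' (u t))"
    have qf: "0 \<le> \<Phi> - 2 * s * b + s\<^sup>2 * ((F - b) / \<delta>)" for s
      unfolding \<Phi>_def b_def \<Phi>'_def F_def
      by (rule trace_shift_quadratic[OF fin(1) R R' _ \<delta> psdR]) (simp add: B')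
    have \<Phi>: "\<Phi> \<le> \<phi>" using tr by (simp add: \<Phi>_def)
    have b: "b > 0" using False \<Phi> \<delta> by (simp add: b_def)
    have Db: "D \<le> \<delta> * b" using \<Phi> \<delta> by (simp add: b_def D_def)
    \<comment> \<open>With \<open>s = \<phi> / b\<close> and \<open>\<Phi> \<le> \<phi>\<close> the
      quadratic inequality becomes
      \<open>b\<^sup>2 / \<phi> \<le> (F - b) / \<delta>\<close>.\<close>
    have F1: "b + \<delta> * b\<^sup>2 / \<phi> \<le> F"
    proof -
      have "0 \<le> (b/\<phi>) * (b / \<phi>) * (\<Phi> - 2 * (\<phi>/b) * b + (\<phi>/b)\<^sup>2 * ((F - b) / \<delta>))"
        using b \<phi> qf[of "\<phi>/b"] by (intro mult_nonneg_nonneg) auto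
      also have "\<dots> = (b/\<phi>)\<^sup>2 * (\<Phi> - 2 * \<phi>) + (F - b) / \<delta>"
        using b \<phi> \<delta> by (simp add: field_simps power2_eq_square)
      also have "\<dots> \<le> (b/\<phi>)\<^sup>2 * (- \<phi>) + (F - b) / \<delta>"
        using \<Phi> by (intro add_right_mono mult_left_mono) auto
      also have "\<dots> = (F - b) / \<delta> - b\<^sup>2/\<phi>" using \<phi> by (simp add: power2_eq_square)
      finally show ?thesis using \<delta> by (simp add: field_simps)
    qed
    \<comment> \<open>Cauchy-Schwarz on the diagonal, with one factor \<open>\<Phi>'\<close>
      replaced by the smaller \<open>\<phi>\<close>. Below, this absorbs the term
      \<open>- \<Phi>'\<close> of the numerators and leaves \<open>a * F\<close>.\<close>
    have F2: "\<Phi>' \<le> n * F / \<phi>"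
    proof -
      have "\<Phi>'\<^sup>2 \<le> n * F" using trace_le_frob[OF fin(1), of R'] by (simp add: \<Phi>'_def F_def n_def)
      moreover have "\<phi> * \<Phi>' \<le> \<Phi>'\<^sup>2" using False \<phi> by (simp add: power2_eq_square)
      ultimately show ?thesis using \<phi> by (simp add: field_simps)
    qed
    have hT: "(\<Sum>t\<in>T. u t i * cnj (u t j)) = of_real 0 * ?B' i j + (if i = j then of_real (real (card T)) else 0)"
      if "i \<in> L" "j \<in> L" for i j using tight[OF that] by simp
    have hJ: "(\<Sum>t\<in>J. u t i * cnj (u t j)) = of_real 1 * ?B' i j + (if i = j then of_real l' else 0)" for i j
      by (simp add: gram_shift_def)
    have W: "W t = (\<Sum>i\<in>L. (cmod (\<Sum>j\<in>L. R' i j * u t j))\<^sup>2)" for t by (simp add: W_def w_def)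
    note sums = sum_qform_gram[OF fin(1) R' hT, folded W q_def] sum_qform_gram[OF fin(1) R' hJ, folded W q_def]
    have Sq: "(\<Sum>t\<in>T-J. q t) = M * \<Phi>' - n" and SW: "(\<Sum>t\<in>T-J. W t) = M * F - \<Phi>'"
      using sum_diff[OF fin(3) J, of q] sum_diff[OF fin(3) J, of W] sums
      by (simp_all add: M_def n_def \<Phi>'_def F_def l'_def algebra_simps)
    have "\<exists>t\<in>T-J. D * (1 + q t) \<le> W t"
    proof (rule ccontr)
      assume "\<not> ?thesis"
      hence "(\<Sum>t\<in>T-J. W t) \<le> (\<Sum>t\<in>T-J. D * (1 + q t))" by (intro sum_mono) (meson le_cases)
      also have "\<dots> = D * (card (T - J) + (M * \<Phi>' - n))"
        unfolding Sq[symmetric] sum_distrib_left[symmetric] sum.distrib by simp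
      also have "\<dots> \<le> D * (card T + (M * \<Phi>' - n))"
        using D card_mono[OF fin(3), of "T - J"] by (intro mult_left_mono add_right_mono) auto
      finally have up: "M * F - \<Phi>' \<le> D * (card T + (M * \<Phi>' - n))" unfolding SW .
      define a where "a = M - n/\<phi>"
      have a0: "a \<ge> 0" using c1 by (simp add: a_def)
      have n0: "n \<ge> 0" by (simp add: n_def)
      have M0: "M \<ge> 0" using a0 n0 \<phi> unfolding a_def by (smt (verit) divide_nonneg_pos)
      \<comment> \<open>The part \<open>M * \<delta> * b\<close> is set aside to pay for
        \<open>\<Phi>'\<close> in the denominators, as
        \<open>\<Phi>' \<le> \<phi> + \<delta> * b\<close>. After division by \<open>D\<close> what
        remains contradicts \<open>c3\<close>.\<close>
      have "D * (a/\<delta> + M * \<delta> * b) \<le> D * (a/\<delta> + a/\<phi> * b)"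
        using D b c2 unfolding a_def[symmetric] by (intro mult_left_mono add_left_mono mult_right_mono) auto
      also have "\<dots> \<le> (\<delta> * b) * (a/\<delta> + a/\<phi> * b)"
        using Db a0 \<delta> \<phi> b by (intro mult_right_mono) auto
      also have "\<dots> = a * (b + \<delta> * b\<^sup>2 / \<phi>)" using \<delta> \<phi> by (simp add: field_simps power2_eq_square)
      also have "\<dots> \<le> a * F" using F1 a0 by (intro mult_left_mono)
      also have "\<dots> = M * F - n * F / \<phi>" by (simp add: a_def algebra_simps)
      also have "\<dots> \<le> M * F - \<Phi>'" using F2 by simp
      also note up
      finally have "a/\<delta> + M * \<delta> * b \<le> card T + (M * \<Phi>' - n)" using D by simp
      moreover have "M * \<Phi>' \<le> M * (\<phi> + \<delta> * b)" using M0 \<Phi> \<delta> by (intro mult_left_mono) (auto simp: b_def)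
      ultimately have "a / \<delta> - M * \<phi> + n \<le> card T" by (simp add: algebra_simps)
      thus False using c3 by (simp add: a_def)
    qed
    then obtain t where t: "t \<in> T" "t \<notin> J" and tW: "D * (1 + q t) \<le> W t" by auto
    have q0: "q t \<ge> 0" unfolding q_def by (rule psdR')
    let ?R = "\<lambda>i j. R' i j - of_real (1 / (1 + 1 * qform L R' (u t))) * w t i * cnj (w t j)"
    have ins: "gram_shift u (insert t J) l' i j = ?B' i j + of_real 1 * u t i * cnj (u t j)" for i j
      using t finJ by (simp add: gram_shift_def)
    have inv2: "inverse_on L (gram_shift u (insert t J) l') ?R"
      unfolding w_def by (rule rank_one_inverse[OF R' fin(1) ins]) (use q0 in \<open>auto simp: q_def\<close>)
    have "retrace L ?R = \<Phi>' - W t / (1 + q t)"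
    proof -
      have "retrace L ?R = \<Phi>' - (\<Sum>i\<in>L. 1 / (1 + q t) * (cmod (w t i))\<^sup>2)"
        unfolding retrace_def \<Phi>'_def sum_subtractf[symmetric]
      proof (intro sum.cong refl)
        fix i
        have "of_real (1 / (1 + 1 * qform L R' (u t))) * w t i * cnj (w t i) = of_real (1 / (1 + q t) * (cmod (w t i))\<^sup>2)"
          unfolding of_real_mult complex_norm_square by (simp add: q_def)
        thus "Re (?R i i) = Re (R' i i) - 1 / (1 + q t) * (cmod (w t i))\<^sup>2" by (simp only: minus_complex.sel Re_complex_of_real)
      qed
      thus ?thesis unfolding W_def sum_distrib_left[symmetric] by simp
    qed
    also have "\<dots> \<le> \<phi>" using tW q0 by (simp add: D_def field_simps)
    finally have "retrace L ?R \<le> \<phi>" .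
    moreover have "0 \<le> qform L (gram_shift u (insert t J) l') x" for x
    proof -
      have "qform L (gram_shift u (insert t J) l') x = qform L ?B' x + (cmod (\<Sum>i\<in>L. cnj (u t i) * x i))\<^sup>2"
        unfolding qform_gram_shift[OF fin(1) finJ] qform_gram_shift[OF fin(1) finite_insert[THEN iffD2, OF finJ]]
        using t finJ by simp
      thus ?thesis using psd'[of x] by simp
    qed
    ultimately have "barrier L u \<phi> (insert t J) l'" unfolding barrier_def using inv2 by blast
    moreover have "card (insert t J) \<le> Suc (card J)" using card_insert_le_m1 finJ t by simp
    ultimately show ?thesis using t J by (intro exI[of _ "insert t J"]) (auto simp: l'_def)
  qed
qed


text \<open>Starting position: without rows the shifted matrix is \<open>(n / \<phi>) I\<close> for
  \<open>n = card L\<close>, and its inverse has trace exactly \<open>\<phi>\<close>.\<close>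

lemma barrier_zero:
  assumes fin: "finite L" "L \<noteq> {}" and \<phi>: "\<phi> > 0"
  shows "barrier L u \<phi> {} (- (card L / \<phi>))"
proof -
  define n where "n = real (card L)"
  have n: "n > 0" using fin by (simp add: n_def card_gt_0_iff)
  let ?R = "\<lambda>i j. if i = j then complex_of_real (\<phi> / n) else 0"
  have B: "gram_shift u {} (- (n / \<phi>)) = (\<lambda>i j. if i = j then complex_of_real (n / \<phi>) else 0)"
    by (auto simp: gram_shift_def fun_eq_iff)
  have "inverse_on L (gram_shift u {} (- (n / \<phi>))) ?R"
    unfolding inverse_on_def
  proof (intro conjI ballI)
    fix i j assume ij: "i \<in> L" "j \<in> L"
    have "(\<Sum>k\<in>L. gram_shift u {} (- (n / \<phi>)) i k * ?R k j) = (\<Sum>k\<in>L. if k = i then (if i = j then 1 else 0) else 0)"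
      unfolding B using n \<phi> by (intro sum.cong refl) (auto simp: of_real_mult[symmetric] simp del: of_real_mult of_real_divide)
    thus "(\<Sum>k\<in>L. gram_shift u {} (- (n / \<phi>)) i k * ?R k j) = (if i = j then 1 else 0)"
      using fin ij by simp
  qed (auto simp: hermitian_on_def B)
  moreover have "0 \<le> qform L (gram_shift u {} (- (n / \<phi>))) x" for x
    unfolding qform_gram_shift[OF fin(1) finite.emptyI] using n \<phi> by (simp add: sum_nonneg)
  moreover have "retrace L ?R \<le> \<phi>" using n by (simp add: retrace_def n_def)
  ultimately show ?thesis unfolding barrier_def n_def by blast
qed

text \<open>The barrier climbs from \<open>- n / \<phi>\<close> by \<open>\<delta>\<close> per step,
  each step costing at most one row. About \<open>(d + 2) * n / 2\<close> of the
  \<open>(1 + d) * n\<close> steps bring it up to zero; the remaining \<open>d * n / 2\<close>, less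
  a rounding loss, yield the frame bound.\<close>

lemma row_selection:
  fixes L :: "'i set" and T :: "'t set" and d :: real
  assumes fin: "finite L" "L \<noteq> {}" "finite T" and le: "card L \<le> card T"
    and tight: "\<And>i j. i \<in> L \<Longrightarrow> j \<in> L \<Longrightarrow> (\<Sum>t\<in>T. u t i * cnj (u t j)) = (if i = j then of_nat (card T) else 0)"
    and d: "d > 0" and large: "d * card L \<ge> 4"
  shows "\<exists>J\<subseteq>T. card J \<le> (1 + d) * card L \<and>
    (\<forall>x. d\<^sup>2 / (4 * (1 + d) * (d + 2)) * card L * (\<Sum>i\<in>L. (cmod (x i))\<^sup>2)
        \<le> (\<Sum>t\<in>J. (cmod (\<Sum>i\<in>L. cnj (u t i) * x i))\<^sup>2))"
proof -
  \<comment> \<open>The choice of \<open>\<delta>\<close> amounts to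
    \<open>1 / \<delta> = 1 + d + \<phi>\<close>, which cancels \<open>M * \<phi>\<close> in the
    last condition of \<open>barrier_step\<close>. What that condition then asks is
    \<open>(1 + d) * l' + (1 + d) * n / \<phi> < d * m\<close>, and \<open>\<phi>\<close> makes each
    summand on the left at most \<open>n * d / 2\<close>.\<close>
  define \<phi> where "\<phi> = 2 * (1 + d) / d"
  define \<delta> where "\<delta> = d / ((1 + d) * (d + 2))"
  define n m where "n = real (card L)" and "m = real (card T)"
  have n: "n > 0" and nm: "n \<le> m" using fin le by (auto simp: n_def m_def card_gt_0_iff)
  have \<phi>0: "\<phi> > 0" and \<delta>0: "\<delta> > 0" using d by (auto simp: \<phi>_def \<delta>_def)
  have \<delta>\<phi>: "\<delta> * \<phi> = 2 / (d + 2)" using d by (simp add: \<phi>_def \<delta>_def divide_simps)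
  have np: "n / \<phi> = n * d / (2 * (1 + d))" by (simp add: \<phi>_def)
  have ld: "1 / \<delta> = 1 + d + \<phi>" using d by (simp add: \<phi>_def \<delta>_def field_simps)
  have steps: "\<exists>J\<subseteq>T. card J \<le> K \<and> barrier L u \<phi> J (- (n/\<phi>) + \<delta> * K)" if "K \<le> (1 + d) * n" for K :: nat
    using that
  proof (induction K)
    case 0
    show ?case using barrier_zero[OF fin(1,2) \<phi>0, of u] by (intro exI[of _ "{}"]) (auto simp: n_def)
  next
    case (Suc K)
    then obtain J where J: "J \<subseteq> T" "card J \<le> K" "barrier L u \<phi> J (- (n/\<phi>) + \<delta> * K)" by auto
    define l' where "l' = - (n/\<phi>) + \<delta> * K + \<delta>"
    have "\<delta> * Suc K \<le> \<delta> * ((1 + d) * n)" using Suc.prems \<delta>0 by (intro mult_left_mono) auto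
    hence "l' \<le> \<delta> * ((1 + d) * n) - n / \<phi>" by (simp add: l'_def algebra_simps)
    also have "\<dots> = n * d\<^sup>2 / (2 * (1 + d) * (d + 2))"
      unfolding np \<delta>_def using d by (simp add: divide_simps) (simp add: algebra_simps power2_eq_square)
    finally have l': "l' \<le> n * d\<^sup>2 / (2 * (1 + d) * (d + 2))" .
    hence "(1 + d) * l' \<le> (1 + d) * (n * d\<^sup>2 / (2 * (1 + d) * (d + 2)))" using d by (intro mult_left_mono) auto
    also have "\<dots> = n * d\<^sup>2 / (2 * (d + 2))" using d by (simp add: divide_simps) (simp add: algebra_simps)
    finally have l'1: "(1 + d) * l' \<le> n * d\<^sup>2 / (2 * (d + 2))" .
    have "d\<^sup>2 / (2 * (d + 2)) < d / 2" using d by (simp add: field_simps power2_eq_square)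
    hence "n * (d\<^sup>2 / (2 * (d + 2))) < n * (d / 2)" using n by (intro mult_strict_left_mono)
    hence l'2: "(1 + d) * l' < n * d / 2" using l'1 unfolding times_divide_eq_right by linarith
    define M where "M = m - l'"
    have M: "(1 + d) * M > n * (1 + d) - n * d / 2"
    proof -
      have "(1 + d) * n \<le> (1 + d) * m" using d nm by (intro mult_left_mono) auto
      thus ?thesis using l'2 by (simp add: M_def algebra_simps)
    qed
    have c1: "M - n / \<phi> \<ge> 0"
    proof -
      have "(1 + d) * (M - n / \<phi>) = (1 + d) * M - n * d / 2" unfolding np using d by (simp add: field_simps)
      moreover have "n * (1 + d) - n * d / 2 - n * d / 2 = n" by (simp add: algebra_simps)
      ultimately have "0 < (1 + d) * (M - n / \<phi>)" using n M by linarith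
      thus ?thesis using d by (simp add: zero_less_mult_iff)
    qed
    have c2: "(M - n/\<phi>)/\<phi> \<ge> M * \<delta>"
    proof -
      have "M * (d / (d + 2)) \<ge> n / \<phi>"
      proof -
        have "2 * (1 + d) * M \<ge> n * (d + 2)" using M by (simp add: algebra_simps)
        hence "d * (n * (d + 2)) \<le> d * (2 * (1 + d) * M)" using d by (intro mult_left_mono) auto
        thus ?thesis unfolding np using d by (simp add: field_simps)
      qed
      moreover have "M * (d / (d + 2)) = M * (1 - \<delta> * \<phi>)" unfolding \<delta>\<phi> using d by (simp add: field_simps)
      ultimately have "n / \<phi> \<le> M - M * \<delta> * \<phi>" by (simp add: algebra_simps)
      thus ?thesis using \<phi>0 by (simp add: pos_le_divide_eq)
    qed
    have c3: "(M - n/\<phi>)/\<delta> - M * \<phi> + n > m"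
    proof -
      have e1: "(M - n/\<phi>)/\<delta> = (M - n/\<phi>) * (1 + d + \<phi>)" unfolding ld[symmetric] by simp
      have "n / \<phi> * (1 + d + \<phi>) = n / \<phi> * (1 + d) + n" using \<phi>0 by (simp add: field_simps)
      also have "n / \<phi> * (1 + d) = n * d / 2" unfolding np using d by (simp add: field_simps)
      finally have e2: "n / \<phi> * (1 + d + \<phi>) = n * d / 2 + n" .
      have "(M - n/\<phi>)/\<delta> - M * \<phi> + n = M * (1 + d) - n / \<phi> * (1 + d + \<phi>) + n"
        unfolding e1 by (simp add: algebra_simps)
      also have "\<dots> = (1 + d) * m - (1 + d) * l' - n * d / 2" unfolding e2 by (simp add: M_def algebra_simps)
      finally have "(M - n/\<phi>)/\<delta> - M * \<phi> + n = (1 + d) * m - (1 + d) * l' - n * d / 2" .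
      moreover have "n * d \<le> m * d" using nm d by (intro mult_right_mono) auto
      ultimately show ?thesis using l'2 by (simp add: algebra_simps)
    qed
    have "\<exists>J'\<subseteq>T. card J' \<le> Suc (card J) \<and> barrier L u \<phi> J' (- (n/\<phi>) + \<delta> * K + \<delta>)"
      using c1 c2 c3 d unfolding M_def l'_def m_def n_def
      by (intro barrier_step[OF fin J(1) tight J(3)[unfolded n_def] \<delta>0 \<phi>0]) (auto simp: \<delta>\<phi>)
    then obtain J' where "J' \<subseteq> T" "card J' \<le> Suc (card J)" "barrier L u \<phi> J' (- (n/\<phi>) + \<delta> * K + \<delta>)" by auto
    thus ?case using J(2) by (intro exI[of _ J']) (auto simp: algebra_simps)
  qed
  define K where "K = nat \<lfloor>(1 + d) * n\<rfloor>"
  have K: "real K \<le> (1 + d) * n" "real K > (1 + d) * n - 1"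
    using n d unfolding K_def by (auto simp: of_nat_nat)
  from steps[OF K(1)] obtain J where J: "J \<subseteq> T" "card J \<le> K" "barrier L u \<phi> J (- (n/\<phi>) + \<delta> * K)" by auto
  have finJ: "finite J" using J fin finite_subset by auto
  \<comment> \<open>Rounding \<open>K\<close> down loses less than one step; by
    \<open>d * n \<ge> 4\<close> this is at most half of the available \<open>d * n / 2\<close>
    steps. Hence the constant \<open>\<delta> * d / 4\<close>.\<close>
  have "\<delta> * d / 4 * n \<le> - (n/\<phi>) + \<delta> * K"
  proof -
    have "\<delta> * ((1 + d) * n - 1) \<le> \<delta> * K" using K \<delta>0 by (intro mult_left_mono) auto
    moreover have "n / \<phi> = \<delta> * (n * (d + 2) / 2)" unfolding np \<delta>_def using d by (simp add: divide_simps)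
    moreover have "(1 + d) * n - 1 - n * (d + 2) / 2 = d * n / 2 - 1" by (simp add: field_simps)
    hence "d / 4 * n \<le> (1 + d) * n - 1 - n * (d + 2) / 2" using large unfolding n_def by simp
    hence "\<delta> * (d / 4 * n) \<le> \<delta> * ((1 + d) * n - 1 - n * (d + 2) / 2)"
      using \<delta>0 by (intro mult_left_mono) auto
    moreover have "\<delta> * ((1 + d) * n - 1 - n * (d + 2) / 2) = \<delta> * ((1 + d) * n - 1) - \<delta> * (n * (d + 2) / 2)"
      by (rule right_diff_distrib)
    moreover have "\<delta> * d / 4 * n = \<delta> * (d / 4 * n)" by simp
    ultimately show ?thesis by linarith
  qed
  moreover have "\<delta> * d / 4 = d\<^sup>2 / (4 * (1 + d) * (d + 2))" by (simp add: \<delta>_def power2_eq_square)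
  ultimately have bound: "d\<^sup>2 / (4 * (1 + d) * (d + 2)) * n \<le> - (n/\<phi>) + \<delta> * K" by simp
  have "d\<^sup>2 / (4 * (1 + d) * (d + 2)) * n * (\<Sum>i\<in>L. (cmod (x i))\<^sup>2)
        \<le> (\<Sum>t\<in>J. (cmod (\<Sum>i\<in>L. cnj (u t i) * x i))\<^sup>2)" for x
  proof -
    have "0 \<le> qform L (gram_shift u J (- (n/\<phi>) + \<delta> * K)) x" using J(3) by (auto simp: barrier_def)
    moreover have "d\<^sup>2 / (4 * (1 + d) * (d + 2)) * n * (\<Sum>i\<in>L. (cmod (x i))\<^sup>2)
       \<le> (- (n/\<phi>) + \<delta> * K) * (\<Sum>i\<in>L. (cmod (x i))\<^sup>2)"
      by (intro mult_right_mono bound sum_nonneg) auto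
    ultimately show ?thesis unfolding qform_gram_shift[OF fin(1) finJ] by linarith
  qed
  thus ?thesis using J(1,2) K(1) unfolding n_def by (intro exI[of _ J]) (auto intro: order_trans)
qed

section \<open>Fourier coefficients of square integrable functions on a period\<close>

text \<open>A concrete model of the square integrable functions on a period: genuine functions
  extended by zero, so that Fourier coefficients are integrals over the line and make sense at every
  real frequency.\<close>

definition L2per :: "(real \<Rightarrow> complex) set" where
  "L2per = {g. g \<in> borel_measurable borel \<and> (\<forall>t. t \<notin> {0..2*pi} \<longrightarrow> g t = 0) \<and>
     integrable lborel (\<lambda>t. (cmod (g t))\<^sup>2)}"

definition L2_sq :: "(real \<Rightarrow> complex) \<Rightarrow> real" where
  "L2_sq g = (\<integral>t. (cmod (g t))\<^sup>2 \<partial>lborel)"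

text \<open>Positive exponent and no factor \<open>1 / (2 * pi)\<close>: this is the synthesis
  integral of \<open>PW\<close>, so that samples of \<open>f\<close> at integers are Fourier
  coefficients of its spectrum.\<close>

definition fourier :: "(real \<Rightarrow> complex) \<Rightarrow> real \<Rightarrow> complex" where
  "fourier g x = (\<integral>t. g t * cis (x * t) \<partial>lborel)"

lemma L2perD:
  assumes "g \<in> L2per"
  shows "g \<in> borel_measurable borel" "t \<notin> {0..2*pi} \<Longrightarrow> g t = 0" "integrable lborel (\<lambda>t. (cmod (g t))\<^sup>2)"
  using assms by (auto simp: L2per_def)

lemma measurable_cnj [measurable]: "cnj \<in> borel_measurable borel"
  by (intro borel_measurable_continuous_onI continuous_intros)

lemma measurable_cis [measurable]: "cis \<in> borel_measurable borel"
  by (intro borel_measurable_continuous_onI continuous_intros)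

lemma cmod_add_sq_le: "(cmod (a + b))\<^sup>2 \<le> 2 * (cmod a)\<^sup>2 + 2 * (cmod b)\<^sup>2"
proof -
  have "(cmod (a + b))\<^sup>2 \<le> (cmod a + cmod b)\<^sup>2" by (intro power_mono norm_triangle_ineq) auto
  also have "\<dots> \<le> 2 * (cmod a)\<^sup>2 + 2 * (cmod b)\<^sup>2"
    using zero_le_power2[of "cmod a - cmod b"] by (simp add: power2_eq_square algebra_simps)
  finally show ?thesis .
qed

lemma L2per_mult_bounded:
  assumes g: "g \<in> L2per" and h: "h \<in> borel_measurable borel" and B: "\<And>t. cmod (h t) \<le> B"
  shows "(\<lambda>t. h t * g t) \<in> L2per"
proof -
  have "integrable lborel (\<lambda>t. (cmod (h t * g t))\<^sup>2)"
  proof (rule Bochner_Integration.integrable_bound)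
    show "integrable lborel (\<lambda>t. B\<^sup>2 * (cmod (g t))\<^sup>2)" using L2perD(3)[OF g] by simp
    show "(\<lambda>t. (cmod (h t * g t))\<^sup>2) \<in> borel_measurable lborel" using h L2perD(1)[OF g] by measurable
    show "AE t in lborel. norm ((cmod (h t * g t))\<^sup>2) \<le> norm (B\<^sup>2 * (cmod (g t))\<^sup>2)"
    proof (rule AE_I2)
      fix t
      have "(cmod (h t))\<^sup>2 \<le> B\<^sup>2" using B[of t] by (intro power_mono) auto
      thus "norm ((cmod (h t * g t))\<^sup>2) \<le> norm (B\<^sup>2 * (cmod (g t))\<^sup>2)"
        by (simp add: norm_mult power_mult_distrib mult_right_mono)
    qed
  qed
  thus ?thesis using g h by (auto simp: L2per_def)
qed

lemma L2per_scale: "g \<in> L2per \<Longrightarrow> (\<lambda>t. c * g t) \<in> L2per"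
  by (rule L2per_mult_bounded[where B = "cmod c"]) auto

lemma L2per_add:
  assumes g: "g \<in> L2per" and h: "h \<in> L2per"
  shows "(\<lambda>t. g t + h t) \<in> L2per"
proof -
  have "integrable lborel (\<lambda>t. (cmod (g t + h t))\<^sup>2)"
  proof (rule Bochner_Integration.integrable_bound)
    show "integrable lborel (\<lambda>t. 2 * (cmod (g t))\<^sup>2 + 2 * (cmod (h t))\<^sup>2)" using L2perD(3)[OF g] L2perD(3)[OF h] by simp
    show "(\<lambda>t. (cmod (g t + h t))\<^sup>2) \<in> borel_measurable lborel" using L2perD(1)[OF h] L2perD(1)[OF g] by measurable
  qed (use cmod_add_sq_le in auto)
  thus ?thesis using g h by (auto simp: L2per_def)
qed

lemma L2per_diff: "g \<in> L2per \<Longrightarrow> h \<in> L2per \<Longrightarrow> (\<lambda>t. g t - h t) \<in> L2per"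
  using L2per_add[of g "\<lambda>t. (-1) * h t"] L2per_scale[of h "-1"] by simp

lemma L2per_sum: "(\<And>k. k \<in> K \<Longrightarrow> g k \<in> L2per) \<Longrightarrow> (\<lambda>t. \<Sum>k\<in>K. g k t) \<in> L2per"
proof (induction K rule: infinite_finite_induct)
  case (insert k K)
  thus ?case by (auto intro!: L2per_add)
qed (simp_all add: L2per_def)

lemma L2per_indicator:
  assumes "A \<in> sets borel"
  shows "(\<lambda>t. indicator (A \<inter> {0..2*pi}) t :: complex) \<in> L2per"
proof -
  have "(\<lambda>t. (cmod (indicator (A \<inter> {0..2*pi}) t))\<^sup>2) = (indicator (A \<inter> {0..2*pi}) :: real \<Rightarrow> real)"
    by (auto simp: indicator_def)
  moreover have "integrable lborel (indicator (A \<inter> {0..2*pi}) :: real \<Rightarrow> real)"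
  proof (rule integrable_real_indicator)
    have "emeasure lborel (A \<inter> {0..2*pi}) \<le> emeasure lborel {0..2*pi}" using assms by (intro emeasure_mono) auto
    thus "emeasure lborel (A \<inter> {0..2*pi}) < \<infinity>" by (simp add: order_le_less_trans)
  qed (use assms in auto)
  ultimately show ?thesis using assms by (auto simp: L2per_def)
qed

lemma L2per_prod_integrable:
  assumes g: "g \<in> L2per" and h: "h \<in> L2per"
  shows "integrable lborel (\<lambda>t. g t * cnj (h t))"
proof (rule Bochner_Integration.integrable_bound)
  show "integrable lborel (\<lambda>t. (cmod (g t))\<^sup>2 + (cmod (h t))\<^sup>2)" using L2perD(3)[OF g] L2perD(3)[OF h] by simp
  show "(\<lambda>t. g t * cnj (h t)) \<in> borel_measurable lborel" using L2perD(1)[OF h] L2perD(1)[OF g] by measurable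
  show "AE t in lborel. norm (g t * cnj (h t)) \<le> norm ((cmod (g t))\<^sup>2 + (cmod (h t))\<^sup>2)"
  proof (rule AE_I2)
    fix t
    have "2 * (cmod (g t) * cmod (h t)) \<le> (cmod (g t))\<^sup>2 + (cmod (h t))\<^sup>2"
      using zero_le_power2[of "cmod (g t) - cmod (h t)"] by (simp add: power2_eq_square algebra_simps)
    moreover have "0 \<le> cmod (g t) * cmod (h t)" by simp
    ultimately have "cmod (g t) * cmod (h t) \<le> (cmod (g t))\<^sup>2 + (cmod (h t))\<^sup>2" by linarith
    thus "norm (g t * cnj (h t)) \<le> norm ((cmod (g t))\<^sup>2 + (cmod (h t))\<^sup>2)" by (simp add: norm_mult)
  qed
qed

definition cexp :: "real \<Rightarrow> real \<Rightarrow> complex" where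
  "cexp x t = indicator {0..2*pi} t * cis (x * t)"

lemma cexp_L2per: "cexp x \<in> L2per"
proof -
  have "(\<lambda>t. cis (x * t) * indicator (UNIV \<inter> {0..2*pi}) t) \<in> L2per"
    by (rule L2per_mult_bounded[OF L2per_indicator, where B = 1]) auto
  moreover have "(\<lambda>t. cis (x * t) * indicator (UNIV \<inter> {0..2*pi}) t) = cexp x" by (auto simp: cexp_def)
  ultimately show ?thesis by simp
qed

lemma L2per_mult_cnj_cexp: "g \<in> L2per \<Longrightarrow> g t * cnj (cexp (- x) t) = g t * cis (x * t)"
  by (cases "t \<in> {0..2*pi}") (auto simp: cexp_def cis_cnj dest: L2perD(2))

lemma fourier_eq: "g \<in> L2per \<Longrightarrow> fourier g x = (\<integral>t. g t * cnj (cexp (- x) t) \<partial>lborel)"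
  unfolding fourier_def by (simp add: L2per_mult_cnj_cexp)

lemma fourier_integrable: "g \<in> L2per \<Longrightarrow> integrable lborel (\<lambda>t. g t * cis (x * t))"
  using L2per_prod_integrable[OF _ cexp_L2per, of g "- x"] by (simp add: L2per_mult_cnj_cexp)

lemma fourier_diff: "g \<in> L2per \<Longrightarrow> h \<in> L2per \<Longrightarrow> fourier (\<lambda>t. g t - h t) x = fourier g x - fourier h x"
  unfolding fourier_def by (simp add: left_diff_distrib fourier_integrable)

lemma fourier_scale: "fourier (\<lambda>t. c * g t) x = c * fourier g x"
  unfolding fourier_def by (simp add: mult.assoc)

lemma fourier_sum: "finite K \<Longrightarrow> (\<And>k. k \<in> K \<Longrightarrow> g k \<in> L2per) \<Longrightarrow> fourier (\<lambda>t. \<Sum>k\<in>K. g k t) x = (\<Sum>k\<in>K. fourier (g k) x)"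
  unfolding fourier_def sum_distrib_right by (simp add: fourier_integrable)

lemma L2_sq_nonneg: "0 \<le> L2_sq g" unfolding L2_sq_def by simp

lemma L2_sq_scale: "L2_sq (\<lambda>t. c * g t) = (cmod c)\<^sup>2 * L2_sq g"
  unfolding L2_sq_def by (simp add: norm_mult power_mult_distrib)

lemma L2_sq_add_le:
  assumes "g \<in> L2per" "h \<in> L2per"
  shows "L2_sq (\<lambda>t. g t + h t) \<le> 2 * L2_sq g + 2 * L2_sq h"
proof -
  have "L2_sq (\<lambda>t. g t + h t) \<le> (\<integral>t. 2 * (cmod (g t))\<^sup>2 + 2 * (cmod (h t))\<^sup>2 \<partial>lborel)"
    unfolding L2_sq_def using assms L2perD(3) L2per_add[OF assms]
    by (intro integral_mono) (auto simp: cmod_add_sq_le)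
  thus ?thesis unfolding L2_sq_def using assms by (simp add: L2perD(3))
qed

lemma L2_sq_diff_expand:
  assumes g: "g \<in> L2per" and h: "h \<in> L2per"
  shows "L2_sq (\<lambda>t. g t - h t) = L2_sq g - 2 * Re (\<integral>t. g t * cnj (h t) \<partial>lborel) + L2_sq h"
proof -
  have e: "(cmod (a - b))\<^sup>2 = (cmod a)\<^sup>2 - 2 * Re (a * cnj b) + (cmod b)\<^sup>2" for a b
    unfolding cmod_power2 by (simp add: power2_eq_square algebra_simps)
  have i: "integrable lborel (\<lambda>t. Re (g t * cnj (h t)))"
    using L2per_prod_integrable[OF g h] by (rule integrable_Re)
  have "Re (\<integral>t. g t * cnj (h t) \<partial>lborel) = (\<integral>t. Re (g t * cnj (h t)) \<partial>lborel)"
    by (rule integral_Re[OF L2per_prod_integrable[OF g h], symmetric])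
  thus ?thesis unfolding L2_sq_def e using i g h by (simp add: L2perD(3) del: times_complex.sel)
qed

lemma integral_cexp:
  "(\<integral>t. cexp (of_int k) t \<partial>lborel) = (if k = 0 then 2 * complex_of_real pi else 0)"
proof (cases "k = 0")
  case True
  have "(\<integral>t. cexp (of_int k) t \<partial>lborel) = (\<integral>t. indicator {0..2*pi} t *\<^sub>R (1::complex) \<partial>lborel)"
    using True by (intro Bochner_Integration.integral_cong refl) (auto simp: cexp_def indicator_def)
  thus ?thesis using True by (simp add: scaleR_conv_of_real)
next
  case False
  have "has_bochner_integral lborel (\<lambda>t. indicator {0..2*pi} t *\<^sub>R cis (of_int k * t))
     (cis (of_int k * (2*pi)) / (\<i> * of_int k) - cis (of_int k * 0) / (\<i> * of_int k))"
  proof (rule has_bochner_integral_FTC_Icc)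
    fix x :: real
    have "((\<lambda>t. exp (\<i> * of_int k * complex_of_real t) / (\<i> * of_int k)) has_vector_derivative exp (\<i> * of_int k * complex_of_real x)) (at x within {0..2*pi})"
      by (rule has_vector_derivative_real_field) (use False in \<open>auto intro!: derivative_eq_intros\<close>)
    thus "((\<lambda>t. cis (of_int k * t) / (\<i> * of_int k)) has_vector_derivative cis (of_int k * x)) (at x within {0..2*pi})"
      by (simp add: cis_conv_exp mult_ac)
  qed (auto intro!: continuous_intros)
  moreover have "cis (of_int k * (2*pi)) = 1" using cis_multiple_2pi[of "of_int k"] by (simp add: mult_ac)
  ultimately have "(\<integral>t. indicator {0..2*pi} t *\<^sub>R cis (of_int k * t) \<partial>lborel) = 0"
    by (simp add: has_bochner_integral_integral_eq)
  thus ?thesis using False by (simp add: cexp_def scaleR_conv_of_real of_real_indicator)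
qed

lemma fourier_cexp: "fourier (cexp (of_int j)) (of_int k) = (if j + k = 0 then 2 * complex_of_real pi else 0)"
proof -
  have "fourier (cexp (of_int j)) (of_int k) = (\<integral>t. cexp (of_int (j + k)) t \<partial>lborel)"
    unfolding fourier_def cexp_def by (intro Bochner_Integration.integral_cong refl) (simp add: cis_mult[symmetric] algebra_simps)
  thus ?thesis unfolding integral_cexp .
qed

text \<open>The minus sign pairs the coefficient with index \<open>k\<close> with
  \<open>fourier g k\<close>, whose kernel has a positive exponent.\<close>

definition trigpoly :: "int set \<Rightarrow> (int \<Rightarrow> complex) \<Rightarrow> real \<Rightarrow> complex" where
  "trigpoly K c = (\<lambda>t. \<Sum>k\<in>K. c k * cexp (- of_int k) t)"

lemma trigpoly_L2per: "trigpoly K c \<in> L2per"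
  unfolding trigpoly_def by (intro L2per_sum L2per_scale cexp_L2per)

text \<open>Completing the square, coefficient by coefficient. The last sum vanishes for the Fourier
  coefficients of \<open>g\<close> divided by \<open>2 * pi\<close>, which gives Bessel's
  inequality; dropping it for arbitrary \<open>c\<close> gives the Parseval bound from any
  approximation.\<close>

lemma L2_sq_diff_trigpoly:
  fixes c :: "int \<Rightarrow> complex"
  assumes g: "g \<in> L2per" and K: "finite K"
  shows "L2_sq (\<lambda>t. g t - trigpoly K c t)
    = L2_sq g - (\<Sum>k\<in>K. (cmod (fourier g k))\<^sup>2) / (2 * pi) + (\<Sum>k\<in>K. (cmod (fourier g k - 2 * complex_of_real pi * c k))\<^sup>2) / (2 * pi)"
proof -
  have ip: "(\<integral>t. g t * cnj (trigpoly K c t) \<partial>lborel) = (\<Sum>k\<in>K. cnj (c k) * fourier g k)" if g: "g \<in> L2per" for g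
  proof -
    have "(\<integral>t. g t * cnj (trigpoly K c t) \<partial>lborel) = (\<integral>t. (\<Sum>k\<in>K. cnj (c k) * (g t * cnj (cexp (- of_int k) t))) \<partial>lborel)"
      unfolding trigpoly_def by (intro Bochner_Integration.integral_cong refl) (simp add: sum_distrib_left mult_ac)
    also have "\<dots> = (\<Sum>k\<in>K. cnj (c k) * (\<integral>t. g t * cnj (cexp (- of_int k) t) \<partial>lborel))"
      using L2per_prod_integrable[OF g cexp_L2per] by simp
    finally show ?thesis by (simp add: fourier_eq[OF g])
  qed
  have fp: "fourier (trigpoly K c) (of_int k) = 2 * complex_of_real pi * c k" if "k \<in> K" for k
  proof -
    have "fourier (trigpoly K c) (of_int k) = (\<Sum>j\<in>K. c j * fourier (cexp (of_int (- j))) (of_int k))"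
      unfolding trigpoly_def using K by (subst fourier_sum) (auto intro!: L2per_scale cexp_L2per simp: fourier_scale)
    also have "\<dots> = (\<Sum>j\<in>K. if j = k then c k * (2 * complex_of_real pi) else 0)"
      unfolding fourier_cexp by (intro sum.cong refl) auto
    finally show ?thesis using K that by simp
  qed
  have "L2_sq (trigpoly K c) = Re (\<integral>t. trigpoly K c t * cnj (trigpoly K c t) \<partial>lborel)"
    unfolding L2_sq_def integral_complex_of_real[symmetric] complex_norm_square
    by (simp add: complex_norm_square[symmetric] del: of_real_power)
  also have "\<dots> = (\<Sum>k\<in>K. Re (cnj (c k) * (2 * complex_of_real pi * c k)))"
    unfolding ip[OF trigpoly_L2per] Re_sum by (intro sum.cong refl) (simp only: fp)
  finally have np: "L2_sq (trigpoly K c) = (\<Sum>k\<in>K. Re (cnj (c k) * (2 * complex_of_real pi * c k)))" .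
  have alg: "(cmod (f - 2 * complex_of_real pi * c))\<^sup>2 / (2 * pi) = (cmod f)\<^sup>2 / (2 * pi) - 2 * Re (cnj c * f) + Re (cnj c * (2 * complex_of_real pi * c))" for f c :: complex
    unfolding cmod_power2 by (simp add: field_simps power2_eq_square)
  show ?thesis
    unfolding L2_sq_diff_expand[OF g trigpoly_L2per] ip[OF g] np sum_divide_distrib alg sum.distrib sum_subtractf Re_sum
      sum_distrib_left by simp
qed

lemma bessel:
  assumes "g \<in> L2per" "finite K"
  shows "(\<Sum>k\<in>K. (cmod (fourier g (of_int k)))\<^sup>2) \<le> 2 * pi * L2_sq g"
proof -
  have "0 \<le> L2_sq (\<lambda>t. g t - trigpoly K (\<lambda>k. fourier g k / (2 * pi)) t)" by (rule L2_sq_nonneg)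
  also have "\<dots> = L2_sq g - (\<Sum>k\<in>K. (cmod (fourier g k))\<^sup>2) / (2 * pi)"
    unfolding L2_sq_diff_trigpoly[OF assms] by simp
  finally show ?thesis by (simp add: field_simps)
qed


section \<open>Density of trigonometric polynomials\<close>

definition trigpolys :: "(real \<Rightarrow> complex) set" where
  "trigpolys = {trigpoly K c | K c. finite K}"

lemma trigpolys_L2per: "p \<in> trigpolys \<Longrightarrow> p \<in> L2per"
  by (auto simp: trigpolys_def trigpoly_L2per)

lemma trigpolys_cexp: "(\<lambda>t. c * cexp (of_int j) t) \<in> trigpolys"
proof -
  have "(\<lambda>t. c * cexp (of_int j) t) = trigpoly {- j} (\<lambda>_. c)" by (simp add: trigpoly_def)
  thus ?thesis unfolding trigpolys_def by blast
qed

lemma trigpolys_add: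
  assumes "p \<in> trigpolys" "q \<in> trigpolys"
  shows "(\<lambda>t. p t + q t) \<in> trigpolys"
proof -
  obtain K c where p: "p = trigpoly K c" "finite K" using assms by (auto simp: trigpolys_def)
  obtain K' c' where q: "q = trigpoly K' c'" "finite K'" using assms by (auto simp: trigpolys_def)
  have "(\<lambda>t. p t + q t) = trigpoly (K \<union> K') (\<lambda>k. (if k \<in> K then c k else 0) + (if k \<in> K' then c' k else 0))"
  proof
    fix t
    have 1: "(\<Sum>k\<in>K. c k * cexp (- of_int k) t) = (\<Sum>k\<in>K \<union> K'. (if k \<in> K then c k else 0) * cexp (- of_int k) t)"
      using p q by (intro sum.mono_neutral_cong_left) auto
    have 2: "(\<Sum>k\<in>K'. c' k * cexp (- of_int k) t) = (\<Sum>k\<in>K \<union> K'. (if k \<in> K' then c' k else 0) * cexp (- of_int k) t)"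
      using p q by (intro sum.mono_neutral_cong_left) auto
    show "p t + q t = trigpoly (K \<union> K') (\<lambda>k. (if k \<in> K then c k else 0) + (if k \<in> K' then c' k else 0)) t"
      unfolding p q trigpoly_def 1 2 by (simp add: sum.distrib[symmetric] distrib_right)
  qed
  thus ?thesis using p q unfolding trigpolys_def by blast
qed

lemma trigpolys_zero: "(\<lambda>t. 0) \<in> trigpolys"
  using trigpolys_cexp[of 0 0] by simp

lemma trigpolys_sum: "(\<And>k. k \<in> K \<Longrightarrow> p k \<in> trigpolys) \<Longrightarrow> (\<lambda>t. \<Sum>k\<in>K. p k t) \<in> trigpolys"
proof (induction K rule: infinite_finite_induct)
  case (insert k K)
  thus ?case by (auto intro!: trigpolys_add)
qed (simp_all add: trigpolys_zero)

lemma cexp_mult: "cexp x t * cexp y t = cexp (x + y) t"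
  by (auto simp: cexp_def indicator_def cis_mult algebra_simps)

lemma trigpolys_mult:
  assumes "p \<in> trigpolys" "q \<in> trigpolys"
  shows "(\<lambda>t. p t * q t) \<in> trigpolys"
proof -
  obtain K c where p: "p = trigpoly K c" "finite K" using assms by (auto simp: trigpolys_def)
  obtain K' c' where q: "q = trigpoly K' c'" "finite K'" using assms by (auto simp: trigpolys_def)
  have e: "cexp (of_int (- k - j)) t = cexp (- of_int k) t * cexp (- of_int j) t" for k j t
    by (simp add: cexp_mult)
  have "(\<lambda>t. p t * q t) = (\<lambda>t. \<Sum>k\<in>K. \<Sum>j\<in>K'. (c k * c' j) * cexp (of_int (- k - j)) t)"
    unfolding p q trigpoly_def sum_product
    by (intro ext sum.cong refl) (simp only: e mult_ac)
  also have "\<dots> \<in> trigpolys" by (intro trigpolys_sum trigpolys_cexp)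
  finally show ?thesis .
qed

definition approximable :: "(real \<Rightarrow> complex) \<Rightarrow> bool" where
  "approximable g \<longleftrightarrow> g \<in> L2per \<and> (\<forall>e>0. \<exists>p\<in>trigpolys. L2_sq (\<lambda>t. g t - p t) < e)"

lemma approximable_trigpolys: "p \<in> trigpolys \<Longrightarrow> approximable p"
  unfolding approximable_def by (auto intro!: bexI[of _ p] simp: trigpolys_L2per L2_sq_def)

lemma approximable_closure:
  assumes g: "g \<in> L2per" and a: "\<And>e. e > 0 \<Longrightarrow> \<exists>h. approximable h \<and> L2_sq (\<lambda>t. g t - h t) < e"
  shows "approximable g"
  unfolding approximable_def
proof (intro conjI g allI impI)
  fix e :: real assume e: "e > 0"
  obtain h where h: "approximable h" "L2_sq (\<lambda>t. g t - h t) < e/4" using a[of "e/4"] e by auto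
  obtain p where p: "p \<in> trigpolys" "L2_sq (\<lambda>t. h t - p t) < e/4" using h e unfolding approximable_def by (meson divide_pos_pos zero_less_numeral)
  have hL: "h \<in> L2per" using h by (simp add: approximable_def)
  have "L2_sq (\<lambda>t. g t - p t) = L2_sq (\<lambda>t. (g t - h t) + (h t - p t))" by simp
  also have "\<dots> \<le> 2 * L2_sq (\<lambda>t. g t - h t) + 2 * L2_sq (\<lambda>t. h t - p t)"
    by (intro L2_sq_add_le L2per_diff g hL trigpolys_L2per p)
  also have "\<dots> < e" using h p by simp
  finally show "\<exists>p\<in>trigpolys. L2_sq (\<lambda>t. g t - p t) < e" using p by blast
qed

lemma approximable_add:
  assumes g: "approximable g" and h: "approximable h"
  shows "approximable (\<lambda>t. g t + h t)"
  unfolding approximable_def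
proof (intro conjI allI impI)
  have gL: "g \<in> L2per" and hL: "h \<in> L2per" using g h by (auto simp: approximable_def)
  show "(\<lambda>t. g t + h t) \<in> L2per" by (intro L2per_add gL hL)
  fix e :: real assume e: "e > 0"
  hence e4: "e / 4 > 0" by simp
  obtain p where p: "p \<in> trigpolys" "L2_sq (\<lambda>t. g t - p t) < e/4" using g e4 unfolding approximable_def by blast
  obtain q where q: "q \<in> trigpolys" "L2_sq (\<lambda>t. h t - q t) < e/4" using h e4 unfolding approximable_def by blast
  have "L2_sq (\<lambda>t. g t + h t - (p t + q t)) = L2_sq (\<lambda>t. (g t - p t) + (h t - q t))" by (simp add: algebra_simps)
  also have "\<dots> \<le> 2 * L2_sq (\<lambda>t. g t - p t) + 2 * L2_sq (\<lambda>t. h t - q t)"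
    by (intro L2_sq_add_le L2per_diff gL hL trigpolys_L2per p q)
  also have "\<dots> < e" using p q by simp
  finally show "\<exists>p\<in>trigpolys. L2_sq (\<lambda>t. g t + h t - p t) < e"
    by (intro bexI[of _ "\<lambda>t. p t + q t"] trigpolys_add p q)
qed

lemma approximable_scale:
  assumes g: "approximable g"
  shows "approximable (\<lambda>t. c * g t)"
  unfolding approximable_def
proof (intro conjI allI impI)
  have gL: "g \<in> L2per" using g by (auto simp: approximable_def)
  show "(\<lambda>t. c * g t) \<in> L2per" by (intro L2per_scale gL)
  fix e :: real assume e: "e > 0"
  have C: "(cmod c)\<^sup>2 + 1 > 0" by (simp add: add_nonneg_pos)
  hence "e / ((cmod c)\<^sup>2 + 1) > 0" using e by simp
  then obtain p where p: "p \<in> trigpolys" "L2_sq (\<lambda>t. g t - p t) < e / ((cmod c)\<^sup>2 + 1)"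
    using g unfolding approximable_def by blast
  have "L2_sq (\<lambda>t. c * g t - c * p t) = (cmod c)\<^sup>2 * L2_sq (\<lambda>t. g t - p t)"
    unfolding L2_sq_scale[symmetric] by (simp add: right_diff_distrib)
  also have "\<dots> \<le> ((cmod c)\<^sup>2 + 1) * L2_sq (\<lambda>t. g t - p t)" by (intro mult_right_mono L2_sq_nonneg) auto
  also have "\<dots> < e" using p C by (simp add: field_simps)
  finally show "\<exists>p\<in>trigpolys. L2_sq (\<lambda>t. c * g t - p t) < e"
    using trigpolys_mult[OF trigpolys_cexp[of c 0] p(1)]
  proof (intro bexI[of _ "\<lambda>t. c * cexp (of_int 0) t * p t"])
    have "c * cexp (of_int 0) t * p t = c * p t" for t
      using trigpolys_L2per[OF p(1)] by (cases "t \<in> {0..2*pi}") (auto simp: cexp_def dest: L2perD(2))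
    thus "L2_sq (\<lambda>t. c * g t - c * p t) < e \<Longrightarrow> L2_sq (\<lambda>t. c * g t - c * cexp (of_int 0) t * p t) < e" by (simp only:)
  qed
qed

lemma approximable_sum: "(\<And>k. k \<in> K \<Longrightarrow> approximable (g k)) \<Longrightarrow> approximable (\<lambda>t. \<Sum>k\<in>K. g k t)"
proof (induction K rule: infinite_finite_induct)
  case (insert k K)
  thus ?case by (auto intro!: approximable_add)
qed (simp_all add: approximable_trigpolys trigpolys_zero)

lemma approximable_limit:
  assumes s: "\<And>n::nat. approximable (s n)" and g: "g \<in> L2per"
    and lim: "AE t in lborel. (\<lambda>n. s n t) \<longlonglongrightarrow> g t"
    and w: "integrable lborel w" and dom: "\<And>n t. (cmod (g t - s n t))\<^sup>2 \<le> w t"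
  shows "approximable g"
proof (rule approximable_closure[OF g])
  fix e :: real assume e: "e > 0"
  have sL: "s n \<in> L2per" for n using s by (simp add: approximable_def)
  have "(\<lambda>n. \<integral>t. (cmod (g t - s n t))\<^sup>2 \<partial>lborel) \<longlonglongrightarrow> (\<integral>t. 0 \<partial>(lborel :: real measure))"
  proof (rule integral_dominated_convergence[where w = w])
    show "AE t in lborel. (\<lambda>n. (cmod (g t - s n t))\<^sup>2) \<longlonglongrightarrow> 0"
      using lim
    proof eventually_elim
      case (elim t)
      have "(\<lambda>n. (cmod (g t - s n t))\<^sup>2) \<longlonglongrightarrow> (cmod (g t - g t))\<^sup>2" by (intro tendsto_intros elim)
      thus ?case by simp
    qed
    show "(\<lambda>t. (cmod (g t - s n t))\<^sup>2) \<in> borel_measurable lborel" for n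
      using L2perD(1)[OF g] L2perD(1)[OF sL[of n]] by measurable
  qed (use w dom in auto)
  hence "eventually (\<lambda>n. L2_sq (\<lambda>t. g t - s n t) < e) sequentially"
    unfolding L2_sq_def using e by (auto dest: order_tendstoD)
  then obtain n where "L2_sq (\<lambda>t. g t - s n t) < e" by (auto simp: eventually_sequentially)
  thus "\<exists>h. approximable h \<and> L2_sq (\<lambda>t. g t - h t) < e" using s by blast
qed

lemma cexp_0: "cexp 0 t = indicator {0..2*pi} t" by (simp add: cexp_def)

text \<open>On the circle a real linear function is a combination of \<open>cis t\<close> and
  \<open>cis (- t)\<close>; sums and products of polynomials correspond to sums and products in
  \<open>trigpolys\<close>. The factor \<open>cexp 0\<close> cuts everything off to the
  period.\<close>

lemma trigpolys_real_polynomial: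
  assumes "real_polynomial_function (q :: complex \<Rightarrow> real)"
  shows "(\<lambda>t. cexp 0 t * of_real (q (cis t))) \<in> trigpolys"
  using assms
proof (induction q)
  case (linear f)
  interpret bounded_linear f by fact
  have f: "f (cis t) = cos t * f 1 + sin t * f \<i>" for t
  proof -
    have "cis t = cos t *\<^sub>R 1 + sin t *\<^sub>R \<i>" by (simp add: complex_eq_iff)
    thus ?thesis by (metis add scaleR real_scaleR_def)
  qed
  have c: "complex_of_real (cos t) = (cis t + cis (- t)) / 2" and s: "complex_of_real (sin t) = (cis t - cis (- t)) / (2 * \<i>)" for t
    by (auto simp: complex_eq_iff Re_divide Im_divide power2_eq_square)
  have "(\<lambda>t. cexp 0 t * of_real (f (cis t)))
     = (\<lambda>t. (of_real (f 1) / 2 + of_real (f \<i>) / (2 * \<i>)) * cexp (of_int 1) t + (of_real (f 1) / 2 - of_real (f \<i>) / (2 * \<i>)) * cexp (of_int (- 1)) t)"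
  proof
    fix t
    have e: "cexp (of_int 1) t = cexp 0 t * cis t" "cexp (of_int (- 1)) t = cexp 0 t * cis (- t)" by (simp_all add: cexp_def)
    show "cexp 0 t * of_real (f (cis t)) = (of_real (f 1) / 2 + of_real (f \<i>) / (2 * \<i>)) * cexp (of_int 1) t + (of_real (f 1) / 2 - of_real (f \<i>) / (2 * \<i>)) * cexp (of_int (- 1)) t"
      unfolding e f of_real_add of_real_mult c s by (simp add: field_simps)
  qed
  also have "\<dots> \<in> trigpolys" by (intro trigpolys_add trigpolys_cexp)
  finally show ?case .
next
  case (const c)
  show ?case using trigpolys_cexp[of "of_real c" 0] by (simp add: mult.commute)
next
  case (add f g)
  thus ?case using trigpolys_add[OF add.IH] by (simp add: algebra_simps)
next
  case (mult f g)
  have "cexp 0 t * of_real (f (cis t)) * (cexp 0 t * of_real (g (cis t))) = cexp 0 t * of_real (f (cis t) * g (cis t))" for t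
    by (simp add: cexp_0 indicator_def)
  thus ?case using trigpolys_mult[OF mult.IH] by (simp only:)
qed

lemma L2_sq_cexp: "L2_sq (cexp x) = 2 * pi"
proof -
  have "(\<lambda>t. (cmod (cexp x t))\<^sup>2) = indicator {0..2*pi}" by (auto simp: cexp_def indicator_def norm_mult)
  thus ?thesis by (simp add: L2_sq_def)
qed

text \<open>Stone-Weierstrass on the unit circle. Working on the circle rather than on the interval
  builds the agreement at the endpoints \<open>0\<close> and \<open>2 * pi\<close> into the
  function.\<close>

lemma approximable_circle_continuous:
  fixes F :: "complex \<Rightarrow> real"
  assumes F: "continuous_on (sphere 0 1) F"
  shows "approximable (\<lambda>t. cexp 0 t * of_real (F (cis t)))"
proof -
  have "compact (F ` sphere 0 1)" by (intro compact_continuous_image F) auto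
  hence "bounded (F ` sphere 0 1)" by (rule compact_imp_bounded)
  then obtain B where "\<forall>y\<in>F ` sphere 0 1. norm y \<le> B" unfolding bounded_iff by blast
  hence B: "\<bar>F z\<bar> \<le> B" if "z \<in> sphere 0 1" for z using that by auto
  have cont: "continuous_on UNIV (\<lambda>t. F (cis t))"
    by (rule continuous_on_compose2[OF F]) (auto intro!: continuous_intros)
  hence meas: "(\<lambda>t. complex_of_real (F (cis t))) \<in> borel_measurable borel"
    by (intro borel_measurable_continuous_onI continuous_intros)
  have gL: "(\<lambda>t. cexp 0 t * of_real (F (cis t))) \<in> L2per"
    using L2per_mult_bounded[OF cexp_L2per[of 0] meas, of B] B by (simp add: mult.commute)
  show ?thesis unfolding approximable_def
  proof (intro conjI gL allI impI)
    fix e :: real assume e: "e > 0"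
    \<comment> \<open>A uniform error \<open>d\<close> over the period contributes
      \<open>2 * pi * d\<^sup>2 = e / 4\<close>.\<close>
    define d where "d = sqrt (e / (8 * pi))"
    have d: "d > 0" "d\<^sup>2 = e / (8 * pi)" using e by (auto simp: d_def)
    obtain q where q: "real_polynomial_function q" "\<And>z. z \<in> sphere 0 1 \<Longrightarrow> \<bar>F z - q z\<bar> < d"
      using Stone_Weierstrass_real_polynomial_function[OF compact_sphere F d(1)] by blast
    let ?p = "\<lambda>t. cexp 0 t * of_real (q (cis t))"
    have p: "?p \<in> trigpolys" by (rule trigpolys_real_polynomial[OF q(1)])
    have "L2_sq (\<lambda>t. cexp 0 t * of_real (F (cis t)) - ?p t) \<le> L2_sq (\<lambda>t. of_real d * cexp 0 t)"
      unfolding L2_sq_def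
    proof (rule integral_mono)
      show "integrable lborel (\<lambda>t. (cmod (cexp 0 t * of_real (F (cis t)) - ?p t))\<^sup>2)"
        by (rule L2perD(3)[OF L2per_diff[OF gL trigpolys_L2per[OF p]]])
      show "integrable lborel (\<lambda>t. (cmod (of_real d * cexp 0 t))\<^sup>2)"
        by (rule L2perD(3)[OF L2per_scale[OF cexp_L2per]])
      fix t
      have "cmod (cexp 0 t * of_real (F (cis t)) - ?p t) = cmod (cexp 0 t) * \<bar>F (cis t) - q (cis t)\<bar>"
        by (metis norm_mult norm_of_real of_real_diff right_diff_distrib)
      also have "\<dots> \<le> cmod (cexp 0 t) * d" using q(2)[of "cis t"] by (intro mult_left_mono) auto
      finally show "(cmod (cexp 0 t * of_real (F (cis t)) - ?p t))\<^sup>2 \<le> (cmod (of_real d * cexp 0 t))\<^sup>2"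
        using d by (intro power_mono) (auto simp: norm_mult mult.commute)
    qed
    also have "\<dots> = e / 4" unfolding L2_sq_scale L2_sq_cexp using d by simp
    finally show "\<exists>p\<in>trigpolys. L2_sq (\<lambda>t. cexp 0 t * of_real (F (cis t)) - p t) < e"
      using e p by (intro bexI[of _ ?p]) auto
  qed
qed


text \<open>The chord from \<open>1\<close> to \<open>cis a\<close> cuts the arc of angles between
  \<open>0\<close> and \<open>a\<close> off the circle, and the half-plane beyond the chord has
  normal direction \<open>cis (a/2)\<close>. This makes indicators of initial segments limits of
  continuous functions on the circle.\<close>

lemma cos_arc:
  assumes a: "0 \<le> a" "a < 2 * pi" and t: "0 < t" "t < 2 * pi" "t \<noteq> a"
  shows "cos (t - a/2) > cos (a/2) \<longleftrightarrow> t < a"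
proof (cases "t < a")
  case True
  have "\<bar>t - a/2\<bar> < a/2" using t True by linarith
  hence "cos (a/2) < cos \<bar>t - a/2\<bar>" using a by (intro cos_monotone_0_pi) auto
  thus ?thesis using True by simp
next
  case False
  hence ta: "t > a" using t by simp
  have "cos (t - a/2) \<le> cos (a/2)"
  proof (cases "t - a/2 \<le> pi")
    case True
    thus ?thesis using a ta by (intro cos_monotone_0_pi_le) auto
  next
    case False
    have "cos (t - a/2) = cos (2 * pi - (t - a/2))" by (simp add: cos_diff)
    also have "\<dots> \<le> cos (a/2)" using False a t by (intro cos_monotone_0_pi_le) auto
    finally show ?thesis .
  qed
  thus ?thesis using ta by simp
qed

lemma approximable_atMost: "approximable (\<lambda>t. indicator ({..a} \<inter> {0..2*pi}) t)"
proof -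
  consider "a < 0" | "a \<ge> 2 * pi" | "0 \<le> a" "a < 2 * pi" by linarith
  thus ?thesis
  proof cases
    case 1
    hence "{..a} \<inter> {0..2*pi} = {}" by auto
    thus ?thesis by (simp add: approximable_trigpolys trigpolys_zero)
  next
    case 2
    hence "(\<lambda>t. indicator ({..a} \<inter> {0..2*pi}) t) = (\<lambda>t. 1 * cexp (of_int 0) t)"
      by (auto simp: cexp_def indicator_def)
    thus ?thesis using trigpolys_cexp[of 1 0] by (simp add: approximable_trigpolys)
  next
    case 3
    \<comment> \<open>Ramps increasing to the indicator of the half-plane of \<open>cos_arc\<close>.
      The angles \<open>0\<close>, \<open>a\<close> and \<open>2 * pi\<close>, where the arc
      description may fail, form a null set.\<close>
    define F where "F = (\<lambda>(n::nat) z. min 1 (max 0 (real n * (Re (z * cis (- (a/2))) - cos (a/2)))))"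
    have F01: "0 \<le> F n z" "F n z \<le> 1" for n z by (auto simp: F_def)
    define s where "s = (\<lambda>n t. cexp 0 t * of_real (F n (cis t)))"
    have s01: "cmod (s n t) \<le> 1" for n t
      using F01[of n "cis t"] by (auto simp: s_def cexp_0 norm_mult indicator_def)
    show ?thesis
    proof (rule approximable_limit[of s])
      show "approximable (s n)" for n
        unfolding s_def F_def by (intro approximable_circle_continuous continuous_intros)
      show "(\<lambda>t. indicator ({..a} \<inter> {0..2*pi}) t) \<in> L2per" by (intro L2per_indicator) simp
      show "integrable lborel (\<lambda>t. 4 * indicator {0..2*pi} t :: real)" by simp
      show "(cmod (indicator ({..a} \<inter> {0..2*pi}) t - s n t))\<^sup>2 \<le> 4 * indicator {0..2*pi} t" for n t
      proof (cases "t \<in> {0..2*pi}")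
        case True
        have "cmod (indicator ({..a} \<inter> {0..2*pi}) t - s n t) \<le> cmod (indicator ({..a} \<inter> {0..2*pi}) t) + cmod (s n t)"
          by (rule norm_triangle_ineq4)
        also have "\<dots> \<le> 1 + 1" using s01 by (intro add_mono) (auto simp: indicator_def)
        finally have "(cmod (indicator ({..a} \<inter> {0..2*pi}) t - s n t))\<^sup>2 \<le> 2\<^sup>2" by (intro power_mono) auto
        thus ?thesis using True by simp
      qed (auto simp: s_def cexp_0)
      show "AE t in lborel. (\<lambda>n. s n t) \<longlonglongrightarrow> indicator ({..a} \<inter> {0..2*pi}) t"
        using AE_lborel_singleton[of 0] AE_lborel_singleton[of "2 * pi"] AE_lborel_singleton[of a]
      proof eventually_elim
        case (elim t)
        show ?case
        proof (cases "t \<in> {0..2*pi}")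
          case False
          thus ?thesis by (auto simp: s_def cexp_0 intro!: tendsto_eventually)
        next
          case True
          define x where "x = cos (t - a/2) - cos (a/2)"
          have Fx: "F n (cis t) = min 1 (max 0 (real n * x))" for n
            by (simp add: F_def x_def cis_mult cos_diff)
          have arc: "x > 0 \<longleftrightarrow> t < a" using cos_arc[of a t] 3 True elim by (simp add: x_def)
          have "(\<lambda>n. F n (cis t)) \<longlonglongrightarrow> (if t < a then 1 else 0)"
          proof (cases "t < a")
            case True
            hence x0: "x > 0" using arc by simp
            obtain N :: nat where N: "real N * x > 1" using reals_Archimedean3[OF x0] by blast
            have "F n (cis t) = 1" if "n \<ge> N" for n
            proof -
              have "real N * x \<le> real n * x" using that x0 by (intro mult_right_mono) auto
              thus ?thesis using N by (simp add: Fx)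
            qed
            thus ?thesis using True by (auto intro!: tendsto_eventually eventually_sequentiallyI[of N])
          next
            case False
            hence "x \<le> 0" using arc by simp
            hence "F n (cis t) = 0" for n by (simp add: Fx mult_nonneg_nonpos)
            thus ?thesis using False by simp
          qed
          hence "(\<lambda>n. complex_of_real (F n (cis t))) \<longlonglongrightarrow> of_real (if t < a then 1 else 0)" by (rule tendsto_of_real)
          moreover have "s n t = of_real (F n (cis t))" for n using True by (simp add: s_def cexp_0)
          moreover have "indicator ({..a} \<inter> {0..2*pi}) t = complex_of_real (if t < a then 1 else 0)"
            using True elim by (auto simp: indicator_def)
          ultimately show ?thesis by simp
        qed
      qed
    qed
  qed
qed

text \<open>Dynkin induction starting from half-lines: complements use the constant function on the
  period, disjoint unions use dominated convergence of the partial sums.\<close>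

lemma approximable_indicator:
  assumes "A \<in> sets borel"
  shows "approximable (\<lambda>t. indicator (A \<inter> {0..2*pi}) t)"
proof -
  have A: "A \<in> sigma_sets UNIV (range (\<lambda>a::real. {..a}))"
    using assms unfolding borel_eq_atMost by (simp add: sets_measure_of)
  have "Int_stable (range (\<lambda>a::real. {..a}))"
    by (auto simp: Int_stable_def image_iff)
  from this subset_UNIV[of "range (\<lambda>a::real. {..a})", folded Pow_UNIV] A show ?thesis
  proof (induction A rule: sigma_sets_induct_disjoint)
    case (basic A) thus ?case using approximable_atMost by auto
  next
    case empty thus ?case by (simp add: approximable_trigpolys trigpolys_zero)
  next
    case (compl A)
    have "(\<lambda>t. indicator ((UNIV - A) \<inter> {0..2*pi}) t :: complex) = (\<lambda>t. 1 * cexp (of_int 0) t + (-1) * indicator (A \<inter> {0..2*pi}) t)"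
      by (auto simp: cexp_def indicator_def)
    moreover have "approximable (\<lambda>t. 1 * cexp (of_int 0) t + (-1) * indicator (A \<inter> {0..2*pi}) t)"
      by (intro approximable_add approximable_scale compl approximable_trigpolys trigpolys_cexp)
    ultimately show ?case by (simp only:)
  next
    case (union A)
    have Am: "A i \<in> sets borel" for i
      using union(2) unfolding borel_eq_atMost by (auto simp: sets_measure_of)
    define s where "s = (\<lambda>n t. \<Sum>i<n. indicator (A i \<inter> {0..2*pi}) t :: complex)"
    have s: "s n t = indicator ((\<Union>i<n. A i) \<inter> {0..2*pi}) t" for n t
    proof (induction n)
      case (Suc n)
      have "A n \<inter> A i = {}" if "i < n" for i
        using disjoint_family_onD[OF union(1), of n i] that by auto
      hence "t \<in> A n \<Longrightarrow> t \<notin> (\<Union>i<n. A i)" by auto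
      moreover have "s (Suc n) t = s n t + indicator (A n \<inter> {0..2*pi}) t" by (simp add: s_def)
      ultimately show ?case unfolding Suc by (auto simp: indicator_def less_Suc_eq)
    qed (simp add: s_def)
    show ?case
    proof (rule approximable_limit[of s])
      show "approximable (s n)" for n unfolding s_def using union(3) by (intro approximable_sum)
      show "(\<lambda>t. indicator (\<Union> (range A) \<inter> {0..2*pi}) t) \<in> L2per" using Am by (intro L2per_indicator) auto
      show "integrable lborel (\<lambda>t. indicator {0..2*pi} t :: real)" by simp
      show "(cmod (indicator (\<Union> (range A) \<inter> {0..2*pi}) t - s n t))\<^sup>2 \<le> indicator {0..2*pi} t" for n t
        unfolding s by (auto simp: indicator_def)
      show "AE t in lborel. (\<lambda>n. s n t) \<longlonglongrightarrow> indicator (\<Union> (range A) \<inter> {0..2*pi}) t"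
      proof (rule AE_I2)
        fix t
        show "(\<lambda>n. s n t) \<longlonglongrightarrow> indicator (\<Union> (range A) \<inter> {0..2*pi}) t"
        proof (cases "\<exists>i. t \<in> A i")
          case True
          then obtain i where i: "t \<in> A i" by auto
          hence "s n t = indicator (\<Union> (range A) \<inter> {0..2*pi}) t" if "n \<ge> Suc i" for n
            using that unfolding s by (auto simp: indicator_def intro!: bexI[of _ i])
          thus ?thesis by (auto intro!: tendsto_eventually eventually_sequentiallyI[of "Suc i"])
        qed (auto simp: s)
      qed
    qed
  qed
qed

text \<open>Simple functions \<open>s i\<close> with
  \<open>cmod (s i t) \<le> 2 * cmod (g t)\<close>. This bound makes them vanish off the period and
  provides the dominating function, the factor \<open>9\<close> being
  \<open>(1 + 2)\<^sup>2\<close>.\<close>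

lemma approximable_L2per:
  assumes g: "g \<in> L2per"
  shows "approximable g"
proof -
  have "g \<in> borel_measurable borel" by (rule L2perD(1)[OF g])
  from borel_measurable_implies_sequence_metric[OF this, of 0] obtain s where
    s: "\<And>i. simple_function borel (s i)" and lim: "\<And>t. (\<lambda>i. s i t) \<longlonglongrightarrow> g t"
    and bound: "\<And>i t. cmod (s i t) \<le> 2 * cmod (g t)" by (auto simp: dist_norm)
  show ?thesis
  proof (rule approximable_limit[of s])
    show "approximable (s i)" for i
    proof -
      have fin: "finite (range (s i))" using s[of i] by (simp add: simple_function_def)
      have "s i = (\<lambda>t. \<Sum>y\<in>range (s i). y * indicator (s i -` {y} \<inter> {0..2*pi}) t)"
      proof
        fix t
        show "s i t = (\<Sum>y\<in>range (s i). y * indicator (s i -` {y} \<inter> {0..2*pi}) t)"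
        proof (cases "t \<in> {0..2*pi}")
          case True
          have "(\<Sum>y\<in>range (s i). y * indicator (s i -` {y} \<inter> {0..2*pi}) t) = (\<Sum>y\<in>range (s i). if y = s i t then y else 0)"
            using True by (intro sum.cong refl) (auto simp: indicator_def)
          thus ?thesis using fin by simp
        next
          case False
          hence "s i t = 0" using bound[of i t] L2perD(2)[OF g] by simp
          thus ?thesis using False by (auto simp: indicator_def intro!: sum.neutral)
        qed
      qed
      moreover have "approximable (\<lambda>t. \<Sum>y\<in>range (s i). y * indicator (s i -` {y} \<inter> {0..2*pi}) t)"
      proof (intro approximable_sum approximable_scale approximable_indicator)
        fix y
        show "s i -` {y} \<in> sets borel" using s[of i] by (auto simp: simple_function_def dest: borel_measurable_simple_function)
            (use borel_measurable_simple_function[OF s[of i]] in \<open>metis borel_singleton measurable_sets_borel sets.empty_sets\<close>)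
      qed
      ultimately show ?thesis by simp
    qed
    show "g \<in> L2per" by fact
    show "AE t in lborel. (\<lambda>n. s n t) \<longlonglongrightarrow> g t" using lim by auto
    show "integrable lborel (\<lambda>t. 9 * (cmod (g t))\<^sup>2)" using L2perD(3)[OF g] by simp
    show "(cmod (g t - s n t))\<^sup>2 \<le> 9 * (cmod (g t))\<^sup>2" for n t
    proof -
      have "cmod (g t - s n t) \<le> cmod (g t) + cmod (s n t)" by (rule norm_triangle_ineq4)
      also have "\<dots> \<le> 3 * cmod (g t)" using bound[of n t] by simp
      finally have "(cmod (g t - s n t))\<^sup>2 \<le> (3 * cmod (g t))\<^sup>2" by (intro power_mono) auto
      thus ?thesis by (simp add: power_mult_distrib)
    qed
  qed
qed

text \<open>Among trigonometric polynomials with frequencies in \<open>K\<close> the partial Fourier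
  sum is closest to \<open>g\<close>, so the defect in Bessel's inequality over \<open>K\<close> is
  controlled by any approximation of that kind.\<close>

lemma parseval_lower:
  assumes g: "g \<in> L2per" and e: "e > 0"
  shows "\<exists>K. finite K \<and> 2 * pi * L2_sq g - e < (\<Sum>k\<in>K. (cmod (fourier g (of_int k)))\<^sup>2)"
proof -
  obtain p where p: "p \<in> trigpolys" "L2_sq (\<lambda>t. g t - p t) < e / (2 * pi)"
    using approximable_L2per[OF g] e unfolding approximable_def by (meson divide_pos_pos pi_gt_zero zero_less_mult_iff zero_less_numeral)
  then obtain K c where K: "finite K" "p = trigpoly K c" by (auto simp: trigpolys_def)
  have "L2_sq g - (\<Sum>k\<in>K. (cmod (fourier g k))\<^sup>2) / (2 * pi) \<le> L2_sq (\<lambda>t. g t - p t)"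
    unfolding K(2) L2_sq_diff_trigpoly[OF g K(1)] by (simp add: sum_nonneg)
  also note p(2)
  finally have "2 * pi * (L2_sq g - (\<Sum>k\<in>K. (cmod (fourier g k))\<^sup>2) / (2 * pi)) < 2 * pi * (e / (2 * pi))"
    by (intro mult_strict_left_mono) auto
  hence "2 * pi * L2_sq g - e < (\<Sum>k\<in>K. (cmod (fourier g k))\<^sup>2)" by (simp add: right_diff_distrib)
  thus ?thesis using K(1) by blast
qed


section \<open>Modulation, and the norm over the whole line\<close>

lemma modulate_L2per: "g \<in> L2per \<Longrightarrow> (\<lambda>t. cis (x * t) * g t) \<in> L2per"
  by (rule L2per_mult_bounded[where B = 1]) auto

lemma fourier_modulate: "fourier (\<lambda>t. cis (x * t) * g t) y = fourier g (x + y)"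
  unfolding fourier_def by (intro Bochner_Integration.integral_cong refl) (simp add: distrib_right cis_mult[symmetric])

lemma L2_sq_modulate: "L2_sq (\<lambda>t. cis (x * t) * g t) = L2_sq g"
  by (simp add: L2_sq_def norm_mult)

lemma L2per_integrable: "g \<in> L2per \<Longrightarrow> integrable lborel g"
  using fourier_integrable[of g 0] by simp

lemma continuous_fourier:
  assumes g: "g \<in> L2per"
  shows "continuous_on UNIV (fourier g)"
proof (rule continuous_on_sequentiallyI)
  fix u :: "nat \<Rightarrow> real" and a assume u: "u \<longlonglongrightarrow> a"
  show "(\<lambda>n. fourier g (u n)) \<longlonglongrightarrow> fourier g a" unfolding fourier_def
  proof (rule integral_dominated_convergence[where w = "\<lambda>t. cmod (g t)"])
    show "(\<lambda>t. g t * cis (a * t)) \<in> borel_measurable lborel"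
      "\<And>n. (\<lambda>t. g t * cis (u n * t)) \<in> borel_measurable lborel" using L2perD(1)[OF g] by measurable
    show "integrable lborel (\<lambda>t. cmod (g t))" using L2per_integrable[OF g] by simp
    have "continuous_on UNIV cis" by (intro continuous_intros)
    hence "isCont cis x" for x by (simp add: continuous_on_eq_continuous_at)
    hence "(\<lambda>n. cis (u n * t)) \<longlonglongrightarrow> cis (a * t)" for t
      by (rule isCont_tendsto_compose) (intro tendsto_intros u)
    thus "AE t in lborel. (\<lambda>n. g t * cis (u n * t)) \<longlonglongrightarrow> g t * cis (a * t)"
      by (intro AE_I2 tendsto_mult tendsto_const) auto
  qed (auto simp: norm_mult)
qed

text \<open>Cut the line into unit intervals: for every \<open>x\<close> the values at \<open>x + k\<close>, \<open>k \<in> \<int>\<close>, are Fourier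
  coefficients of a modulation of \<open>g\<close>, so Bessel's inequality applies under the integral.\<close>
lemma integral_fourier_le:
  assumes g: "g \<in> L2per" and i: "integrable lborel (\<lambda>x. (cmod (fourier g x))\<^sup>2)"
  shows "(\<integral>x. (cmod (fourier g x))\<^sup>2 \<partial>lborel) \<le> 2 * pi * L2_sq g"
proof -
  define F where "F = (\<lambda>x. (cmod (fourier g x))\<^sup>2)"
  have iF: "integrable lborel F" using i by (simp add: F_def)
  have mF: "F \<in> borel_measurable borel"
    unfolding F_def using borel_measurable_continuous_onI[OF continuous_fourier[OF g]] by measurable
  have bound: "(\<integral>x. indicator {- real N..<real N} x * F x \<partial>lborel) \<le> 2 * pi * L2_sq g" for N :: nat
  proof -
    define K where "K = {- int N..<int N}"
    have ik: "integrable lborel (\<lambda>x. indicator {a..<b} x * F x)" for a b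
      using integrable_real_mult_indicator[OF _ iF, of "{a..<b}"] by (simp add: mult.commute)
    have ik': "integrable lborel (\<lambda>x. indicator {0..<1} x * F (of_int k + x))" for k :: int
    proof -
      have "integrable lborel (\<lambda>x. indicator {of_int k..<of_int k + 1} (of_int k + 1 * x) * F (of_int k + 1 * x))"
        by (rule lborel_integrable_real_affine[OF ik]) simp
      moreover have "indicat_real {of_int k..<of_int k + 1} (of_int k + 1 * x) = indicator {0..<1} x" for x :: real
        by (auto simp: indicator_def)
      ultimately show ?thesis by simp
    qed
    have dec: "indicat_real {- real N..<real N} x = (\<Sum>k\<in>K. indicator {of_int k..<of_int k + 1} x)" for x
    proof -
      have "(\<Sum>k\<in>K. indicat_real {of_int k..<of_int k + 1} x) = (\<Sum>k\<in>K. if k = \<lfloor>x\<rfloor> then 1 else 0)"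
        by (intro sum.cong refl) (auto simp: indicator_def floor_eq_iff intro: floor_unique[symmetric])
      also have "\<dots> = (if \<lfloor>x\<rfloor> \<in> K then 1 else 0)" by (simp add: K_def)
      also have "\<lfloor>x\<rfloor> \<in> K \<longleftrightarrow> x \<in> {- real N..<real N}"
        unfolding K_def by (auto simp: le_floor_iff floor_less_iff)
      finally show ?thesis by (simp add: indicator_def)
    qed
    have "(\<integral>x. indicator {- real N..<real N} x * F x \<partial>lborel) = (\<Sum>k\<in>K. \<integral>x. indicator {of_int k..<of_int k + 1} x * F x \<partial>lborel)"
      unfolding dec sum_distrib_right by (intro Bochner_Integration.integral_sum ik)
    also have "\<dots> = (\<Sum>k\<in>K. \<integral>x. indicator {0..<1} x * F (of_int k + x) \<partial>lborel)"
    proof (intro sum.cong refl)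
      fix k :: int
      have "indicat_real {of_int k..<of_int k + 1} (of_int k + 1 * x) = indicator {0..<1} x" for x :: real
        by (auto simp: indicator_def)
      thus "(\<integral>x. indicator {of_int k..<of_int k + 1} x * F x \<partial>lborel) = (\<integral>x. indicator {0..<1} x * F (of_int k + x) \<partial>lborel)"
        using lborel_integral_real_affine[of 1 "\<lambda>x. indicator {of_int k..<of_int k + 1} x * F x" "of_int k"] by simp
    qed
    also have "\<dots> = (\<integral>x. (\<Sum>k\<in>K. indicator {0..<1} x * F (of_int k + x)) \<partial>lborel)"
      by (intro Bochner_Integration.integral_sum[symmetric] ik')
    also have "\<dots> \<le> (\<integral>x. indicator {0..<1::real} x * (2 * pi * L2_sq g) \<partial>lborel)"
    proof (rule Bochner_Integration.integral_mono)
      show "integrable lborel (\<lambda>x. \<Sum>k\<in>K. indicator {0..<1} x * F (of_int k + x))" by (intro Bochner_Integration.integrable_sum ik')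
      show "integrable lborel (\<lambda>x::real. indicator {0..<1} x * (2 * pi * L2_sq g) :: real)" by simp
      fix x :: real
      have "(\<Sum>k\<in>K. F (of_int k + x)) = (\<Sum>k\<in>K. (cmod (fourier (\<lambda>t. cis (x * t) * g t) (of_int k)))\<^sup>2)"
        by (simp add: F_def fourier_modulate add.commute)
      also have "\<dots> \<le> 2 * pi * L2_sq g" using bessel[OF modulate_L2per[OF g, of x], of K] by (simp add: L2_sq_modulate K_def)
      finally show "(\<Sum>k\<in>K. indicator {0..<1} x * F (of_int k + x)) \<le> indicator {0..<1} x * (2 * pi * L2_sq g)"
        unfolding sum_distrib_left[symmetric] by (intro mult_left_mono) auto
    qed
    also have "\<dots> = 2 * pi * L2_sq g" by simp
    finally show ?thesis .
  qed
  have "(\<lambda>N. \<integral>x. indicator {- real N..<real N} x * F x \<partial>lborel) \<longlonglongrightarrow> (\<integral>x. F x \<partial>lborel)"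
  proof (rule integral_dominated_convergence[where w = F])
    show "AE x in lborel. (\<lambda>N. indicator {- real N..<real N} x * F x) \<longlonglongrightarrow> F x"
    proof (rule AE_I2)
      fix x :: real
      obtain N0 :: nat where N0: "\<bar>x\<bar> < real N0" using reals_Archimedean2 by blast
      hence "indicator {- real N..<real N} x * F x = F x" if "N \<ge> N0" for N
        using that by (auto simp: indicator_def)
      thus "(\<lambda>N. indicator {- real N..<real N} x * F x) \<longlonglongrightarrow> F x"
        by (intro tendsto_eventually eventually_sequentiallyI[of N0]) auto
    qed
  qed (use iF mF in \<open>auto simp: indicator_def F_def\<close>)
  hence "(\<integral>x. F x \<partial>lborel) \<le> 2 * pi * L2_sq g" by (rule LIMSEQ_le_const2) (use bound in auto)
  thus ?thesis by (simp add: F_def)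
qed

section \<open>Densities in translation invariant families\<close>

text \<open>Compactness of the subsets of a countable type: a diagonal argument makes all indicators
  converge, and a convergent sequence of zeros and ones is eventually constant.\<close>

lemma sets_convergent_subsequence:
  fixes A :: "nat \<Rightarrow> 'a::countable set"
  obtains r B where "strict_mono (r :: nat \<Rightarrow> nat)"
    "\<And>x. eventually (\<lambda>k. x \<in> A (r k) \<longleftrightarrow> x \<in> B) sequentially"
proof -
  obtain r where r: "strict_mono (r :: nat \<Rightarrow> nat)"
      and lim: "\<And>x. x \<in> UNIV \<Longrightarrow> \<exists>l. (\<lambda>n. indicator (A (r n)) x :: real) \<longlonglongrightarrow> l"
    by (rule function_convergent_subsequence[of "UNIV :: 'a set" "\<lambda>n x. indicator (A n) x :: real" 1])
       (auto simp: indicator_def)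
  define B where "B = {x. (\<lambda>n. indicator (A (r n)) x :: real) \<longlonglongrightarrow> 1}"
  have "eventually (\<lambda>k. x \<in> A (r k) \<longleftrightarrow> x \<in> B) sequentially" for x
  proof -
    obtain l where l: "(\<lambda>n. indicator (A (r n)) x :: real) \<longlonglongrightarrow> l" using lim by auto
    have B: "x \<in> B \<longleftrightarrow> l = 1" using l LIMSEQ_unique by (auto simp: B_def)
    have "eventually (\<lambda>n. dist (indicator (A (r n)) x) l < 1/2) sequentially"
      using l by (rule tendstoD) auto
    hence ev: "eventually (\<lambda>n. \<bar>indicator (A (r n)) x - l\<bar> < 1/2) sequentially"
      by (simp add: dist_real_def)
    show ?thesis
    proof (cases "l = 1")
      case True
      thus ?thesis using ev B by (auto elim!: eventually_mono simp: indicator_def of_bool_def split: if_splits)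
    next
      case False
      have "eventually (\<lambda>n. indicator (A (r n)) x = (0::real)) sequentially"
      proof (rule ccontr)
        assume "\<not> ?thesis"
        hence "frequently (\<lambda>n. x \<in> A (r n)) sequentially"
          unfolding frequently_def by (simp add: indicator_def)
        with ev have "\<exists>n. x \<in> A (r n) \<and> \<bar>indicator (A (r n)) x - l\<bar> < 1/2"
          using frequently_eventually_conj frequently_ex by fastforce
        hence *: "\<bar>1 - l\<bar> < 1/2" by auto
        have "eventually (\<lambda>n. x \<in> A (r n)) sequentially"
          using ev by eventually_elim (use * in \<open>auto simp: indicator_def of_bool_def split: if_splits\<close>)
        hence "(\<lambda>n. indicator (A (r n)) x :: real) \<longlonglongrightarrow> 1"
          by (intro tendsto_eventually) (auto elim!: eventually_mono)
        thus False using False l LIMSEQ_unique by blast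
      qed
      thus ?thesis by eventually_elim (use False B in \<open>auto simp: indicator_def of_bool_def split: if_splits\<close>)
    qed
  qed
  thus ?thesis using that r by blast
qed

section \<open>Window counts and one-sided maximal inequalities\<close>

definition wcount :: "int set \<Rightarrow> int \<Rightarrow> int \<Rightarrow> real" where
  "wcount A a b = (\<Sum>x\<in>{a..<b}. indicator A x)"

lemma wcount_card: "wcount A a b = card (A \<inter> {a..<b})"
  by (simp add: wcount_def indicator_def of_bool_def sum.If_cases Int_def conj_commute)

lemma wcount_split: "a \<le> b \<Longrightarrow> b \<le> c \<Longrightarrow> wcount A a c = wcount A a b + wcount A b c"
  unfolding wcount_def by (subst sum.union_disjoint[symmetric]) (auto simp: ivl_disj_un)

lemma wcount_nonneg: "0 \<le> wcount A a b"
  by (simp add: wcount_def sum_nonneg)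

lemma wcount_le: "a \<le> b \<Longrightarrow> wcount A a b \<le> b - a"
proof -
  assume "a \<le> b"
  have "wcount A a b \<le> (\<Sum>x\<in>{a..<b}. 1)" unfolding wcount_def by (intro sum_mono) (auto simp: indicator_def)
  thus ?thesis using \<open>a \<le> b\<close> by simp
qed

lemma wcount_shift: "wcount ((+) p ` A) (p + a) (p + b) = wcount A a b"
proof -
  have "wcount ((+) p ` A) (p + a) (p + b) = (\<Sum>x\<in>(+) p ` {a..<b}. indicator ((+) p ` A) x)"
    unfolding wcount_def by (simp add: image_add_atLeastLessThan add.commute)
  also have "\<dots> = (\<Sum>x\<in>{a..<b}. indicator ((+) p ` A) (p + x))"
    by (subst sum.reindex) auto
  also have "\<dots> = wcount A a b" unfolding wcount_def by (intro sum.cong refl) (auto simp: indicator_def)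
  finally show ?thesis .
qed

lemma wcount_window_sum:
  "(\<Sum>y\<in>{a..<b}. wcount A y (y + int R)) = (\<Sum>i<R. wcount A (a + int i) (b + int i))"
proof -
  have 1: "wcount A y (y + int R) = (\<Sum>i<R. indicator A (y + int i))" for y
  proof -
    have "{y..<y + int R} = (\<lambda>i. y + int i) ` {..<R}"
    proof (intro set_eqI iffI)
      fix x assume "x \<in> {y..<y + int R}"
      hence "x = y + int (nat (x - y))" "nat (x - y) < R" by auto
      thus "x \<in> (\<lambda>i. y + int i) ` {..<R}" by blast
    qed auto
    thus ?thesis unfolding wcount_def by (simp add: sum.reindex inj_on_def)
  qed
  have "(\<Sum>y\<in>{a..<b}. wcount A y (y + int R)) = (\<Sum>i<R. \<Sum>y\<in>{a..<b}. indicator A (y + int i))"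
    unfolding 1 by (rule sum.swap)
  also have "\<dots> = (\<Sum>i<R. wcount A (a + int i) (b + int i))"
  proof (intro sum.cong refl)
    fix i
    have "(\<Sum>x\<in>(\<lambda>x. x + int i) ` {a..<b}. indicat_real A x) = (\<Sum>y\<in>{a..<b}. indicator A (y + int i))"
      by (subst sum.reindex) (auto simp: inj_on_def)
    thus "(\<Sum>y\<in>{a..<b}. indicator A (y + int i)) = wcount A (a + int i) (b + int i)"
      unfolding wcount_def by simp
  qed
  finally show ?thesis .
qed

text \<open>The sum over sliding windows equals the sum of the counts in \<open>R\<close> translates
  of the window from \<open>a\<close> to \<open>b\<close>; each translate is moved by less than
  \<open>R\<close> and so changes the count by at most \<open>R\<close>.\<close>

lemma wcount_window_average:
  assumes "a \<le> b"
  shows "\<bar>(\<Sum>y\<in>{a..<b}. wcount A y (y + int R)) - R * wcount A a b\<bar> \<le> (real R)\<^sup>2"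
proof -
  have 3: "\<bar>wcount A (a + int i) (b + int i) - wcount A a b\<bar> \<le> R" if "i < R" for i
  proof -
    have "wcount A a (a + int i) + wcount A (a + int i) (b + int i) = wcount A a b + wcount A b (b + int i)"
      using wcount_split[of a "a + int i" "b + int i" A] wcount_split[of a b "b + int i" A] assms by simp
    moreover have "wcount A a (a + int i) \<le> i" "wcount A b (b + int i) \<le> i" "0 \<le> wcount A a (a + int i)" "0 \<le> wcount A b (b + int i)"
      using wcount_le[of a "a + int i" A] wcount_le[of b "b + int i" A] wcount_nonneg by simp_all
    ultimately show ?thesis using that by (auto simp: abs_le_iff)
  qed
  have "\<bar>(\<Sum>i<R. wcount A (a + int i) (b + int i)) - R * wcount A a b\<bar> = \<bar>\<Sum>i<R. (wcount A (a + int i) (b + int i) - wcount A a b)\<bar>"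
    by (simp add: sum_subtractf)
  also have "\<dots> \<le> (\<Sum>i<R. \<bar>wcount A (a + int i) (b + int i) - wcount A a b\<bar>)" by (rule sum_abs)
  also have "\<dots> \<le> (\<Sum>i<R. real R)" by (intro sum_mono) (simp add: 3)
  finally show ?thesis unfolding wcount_window_sum by (simp add: power2_eq_square)
qed

text \<open>Discrete rising sun argument with constant one, scanning from the left: a bad point
  \<open>a\<close> opens a block up to \<open>y\<close> whose sum pays for all its points, and the
  scan resumes at \<open>y\<close>; a good point is skipped.\<close>

lemma right_maximal_count:
  fixes g :: "int \<Rightarrow> real" and a b :: int
  assumes g: "\<And>x. 0 \<le> g x" and T: "T > 0"
  shows "T * card {x \<in> {a..<b}. \<exists>y>x. y \<le> b \<and> T * of_int (y - x) < sum g {x..<y}} \<le> sum g {a..<b}"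
proof (induction "nat (b - a)" arbitrary: a rule: less_induct)
  case less
  let ?bad = "\<lambda>a. {x \<in> {a..<b}. \<exists>y>x. y \<le> b \<and> T * of_int (y - x) < sum g {x..<y}}"
  show ?case
  proof (cases "a < b")
    case False
    thus ?thesis by simp
  next
    case True
    show ?thesis
    proof (cases "a \<in> ?bad a")
      case True
      then obtain y where y: "y > a" "y \<le> b" "T * of_int (y - a) < sum g {a..<y}" by auto
      have "card (?bad a) \<le> card ({a..<y} \<union> ?bad y)" by (intro card_mono finite_UnI) (auto intro: finite_subset[of _ "{y..<b}"])
      also have "\<dots> \<le> card {a..<y} + card (?bad y)" by (rule card_Un_le)
      finally have "T * card (?bad a) \<le> T * (card {a..<y} + card (?bad y))"
        using T by (intro mult_left_mono) auto
      also have "\<dots> = T * of_int (y - a) + T * card (?bad y)" using y by (simp add: algebra_simps)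
      also have "T * card (?bad y) \<le> sum g {y..<b}" using y by (intro less) auto
      also have "T * of_int (y - a) \<le> sum g {a..<y}" using y by simp
      also have "sum g {a..<y} + sum g {y..<b} = sum g {a..<b}"
        using y by (subst sum.union_disjoint[symmetric]) (auto simp: ivl_disj_un)
      finally show ?thesis by simp
    next
      case False
      hence "?bad a \<subseteq> ?bad (a + 1)" by auto (metis atLeastLessThan_iff le_less zless_imp_add1_zle)
      hence "T * card (?bad a) \<le> T * card (?bad (a + 1))"
        using T by (intro mult_left_mono of_nat_mono card_mono) (auto intro: finite_subset[of _ "{a+1..<b}"])
      also have "\<dots> \<le> sum g {a+1..<b}" using \<open>a < b\<close> by (intro less) auto
      also have "\<dots> \<le> sum g {a..<b}" using g by (intro sum_mono2) auto
      finally show ?thesis .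
    qed
  qed
qed

text \<open>Reflection of the previous inequality under \<open>x \<mapsto> - 1 - x\<close>, which
  exchanges half-open intervals with half-open intervals.\<close>

lemma left_maximal_count:
  fixes g :: "int \<Rightarrow> real" and a b :: int
  assumes g: "\<And>x. 0 \<le> g x" and T: "T > 0"
  shows "T * card {x \<in> {a..<b}. \<exists>y\<le>x. a \<le> y \<and> T * of_int (x + 1 - y) < sum g {y..x}} \<le> sum g {a..<b}"
proof -
  define s where "s = (\<lambda>x::int. - 1 - x)"
  have inj: "inj_on s A" for A by (auto simp: s_def inj_on_def)
  have img: "s ` {u..<v} = {- v..<- u}" "s ` {u..v} = {-1 - v..<- u}" for u v
    by (auto simp: s_def image_iff intro!: bexI[of _ "- 1 - _"])
  have sm: "sum (g \<circ> s) {- v..<- u} = sum g {u..<v}" for u v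
  proof -
    have "sum g {u..<v} = sum g (s ` {- v..<- u})" unfolding img by simp
    thus ?thesis by (simp add: sum.reindex[OF inj])
  qed
  let ?L = "{x \<in> {a..<b}. \<exists>y\<le>x. a \<le> y \<and> T * of_int (x + 1 - y) < sum g {y..x}}"
  let ?R = "{x \<in> {-b..<-a}. \<exists>y>x. y \<le> -a \<and> T * of_int (y - x) < sum (g \<circ> s) {x..<y}}"
  have "s ` ?L \<subseteq> ?R"
  proof (rule image_subsetI)
    fix x assume "x \<in> ?L"
    then obtain y where y: "x \<in> {a..<b}" "y \<le> x" "a \<le> y" "T * of_int (x + 1 - y) < sum g {y..x}" by auto
    have "{y..x} = {y..<x+1}" by auto
    hence "T * of_int (- y - s x) < sum (g \<circ> s) {s x..<- y}"
      using y(4) sm[of "x + 1" y] by (simp add: s_def algebra_simps)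
    thus "s x \<in> ?R" using y by (auto simp: s_def intro!: exI[of _ "- y"])
  qed
  moreover have "finite ?R" by (rule finite_subset[of _ "{-b..<-a}"]) auto
  ultimately have "card ?L \<le> card ?R" using card_inj_on_le[OF inj] by blast
  hence "T * card ?L \<le> T * card ?R" using T by (intro mult_left_mono) auto
  also have "\<dots> \<le> sum (g \<circ> s) {-b..<-a}" using g T by (intro right_maximal_count) auto
  finally show ?thesis unfolding sm .
qed


section \<open>From minimal windows to a density\<close>

lemma eventually_Int_window_eq:
  assumes "\<And>x. eventually (\<lambda>k. x \<in> A k \<longleftrightarrow> x \<in> B) sequentially"
  shows "eventually (\<lambda>k. A k \<inter> {a..<b} = B \<inter> {a..<b::int}) sequentially"
proof -
  have "eventually (\<lambda>k. \<forall>x\<in>{a..<b}. x \<in> A k \<longleftrightarrow> x \<in> B) sequentially"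
    using assms by (intro eventually_ball_finite) auto
  thus ?thesis by eventually_elim auto
qed

text \<open>The excess \<open>g\<close> of sliding windows of length \<open>R\<close> over their
  lower bound \<open>\<mu>\<close> is nonnegative. A centre with a symmetric window that is too full
  has a large one-sided average of \<open>g\<close>, so the two maximal inequalities bound the
  number of such centres by the total excess. The additive terms \<open>R\<close> come from
  replacing sliding sums by counts.\<close>

lemma window_bound:
  fixes N R :: nat and \<epsilon> \<mu> :: real
  assumes R: "R > 0" and \<epsilon>: "\<epsilon> > 0" and lower: "\<And>a. \<mu> \<le> wcount A a (a + int R)"
  defines "bad \<equiv> {x \<in> {0..<int N}. \<exists>n. int n \<le> x \<and> x + int n < int N \<and>
      (2 * real n + 1) * (\<mu> / R) + \<epsilon> * (2 * real n + 2) + R < wcount A (x - int n) (x + int n + 1)}"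
  shows "\<epsilon> * card bad \<le> 2 * (wcount A 0 N + R - N * (\<mu> / R))"
proof -
  define g where "g = (\<lambda>y. wcount A y (y + int R) - \<mu>)"
  define T where "T = \<epsilon> * R"
  have g0: "0 \<le> g y" for y using lower by (simp add: g_def)
  have T: "T > 0" using R \<epsilon> by (simp add: T_def)
  have sg: "\<bar>sum g {a..<b} - (R * wcount A a b - of_int (b - a) * \<mu>)\<bar> \<le> (real R)\<^sup>2" if "a \<le> b" for a b
    using wcount_window_average[OF that, of A R] that by (simp add: g_def sum_subtractf algebra_simps)
  let ?BR = "{x \<in> {0..<int N}. \<exists>y>x. y \<le> int N \<and> T * of_int (y - x) < sum g {x..<y}}"
  let ?BL = "{x \<in> {0..<int N}. \<exists>y\<le>x. 0 \<le> y \<and> T * of_int (x + 1 - y) < sum g {y..x}}"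
  have fin: "finite ?BR" "finite ?BL" by (rule finite_subset[of _ "{0..<int N}"]; auto)+
  have "bad \<subseteq> ?BR \<union> ?BL"
  proof
    fix x assume "x \<in> bad"
    then obtain n where n: "x \<in> {0..<int N}" "int n \<le> x" "x + int n < int N"
      "(2 * real n + 1) * (\<mu> / R) + \<epsilon> * (2 * real n + 2) + R < wcount A (x - int n) (x + int n + 1)" by (auto simp: bad_def)
    show "x \<in> ?BR \<union> ?BL"
    proof (rule ccontr)
      assume "x \<notin> ?BR \<union> ?BL"
      hence r': "\<And>y. x < y \<Longrightarrow> y \<le> int N \<Longrightarrow> sum g {x..<y} \<le> T * of_int (y - x)"
        and l': "\<And>y. y \<le> x \<Longrightarrow> 0 \<le> y \<Longrightarrow> sum g {y..x} \<le> T * of_int (x + 1 - y)"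
        using n(1) by (auto simp: not_less)
      have r: "sum g {x..<x + int n + 1} \<le> T * of_int ((x + int n + 1) - x)"
        and l: "sum g {x - int n..x} \<le> T * of_int (x + 1 - (x - int n))"
        using n r'[of "x + int n + 1"] l'[of "x - int n"] by simp_all
      \<comment> \<open>The two one-sided ranges overlap in \<open>x\<close>, hence
        \<open>2 * n + 2\<close> in the threshold rather than \<open>2 * n + 1\<close>.\<close>
      have "sum g {x - int n..<x + int n + 1} \<le> sum g {x - int n..x} + sum g {x..<x + int n + 1}"
      proof -
        have "sum g ({x - int n..x} \<union> {x..<x + int n + 1}) \<le> sum g {x - int n..x} + sum g {x..<x + int n + 1}"
          using sum.union_inter[of "{x - int n..x}" "{x..<x + int n + 1}" g] g0
            sum_nonneg[of "{x - int n..x} \<inter> {x..<x + int n + 1}" g] by simp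
        moreover have "{x - int n..x} \<union> {x..<x + int n + 1} = {x - int n..<x + int n + 1}" by auto
        ultimately show ?thesis by simp
      qed
      hence "sum g {x - int n..<x + int n + 1} \<le> T * (2 * real n + 2)" using r l by (simp add: algebra_simps)
      moreover have "R * wcount A (x - int n) (x + int n + 1) - (2 * real n + 1) * \<mu> - (real R)\<^sup>2 \<le> sum g {x - int n..<x + int n + 1}"
        using sg[of "x - int n" "x + int n + 1"] by (simp add: abs_le_iff algebra_simps)
      ultimately have "R * wcount A (x - int n) (x + int n + 1) \<le> (2 * real n + 1) * \<mu> + T * (2 * real n + 2) + (real R)\<^sup>2" by simp
      also have "\<dots> = R * ((2 * real n + 1) * (\<mu> / R) + \<epsilon> * (2 * real n + 2) + R)"
        using R by (simp add: T_def field_simps power2_eq_square)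
      finally have "wcount A (x - int n) (x + int n + 1) \<le> (2 * real n + 1) * (\<mu> / R) + \<epsilon> * (2 * real n + 2) + R"
        using R by (simp only: mult_le_cancel_left_pos of_nat_0_less_iff)
      thus False using n(4) by linarith
    qed
  qed
  hence "card bad \<le> card ?BR + card ?BL"
    using fin by (meson card_Un_le card_mono finite_UnI order_trans)
  hence "T * card bad \<le> T * (card ?BR + card ?BL)" using T by (intro mult_left_mono) auto
  also have "\<dots> = T * card ?BR + T * card ?BL" by (simp add: algebra_simps)
  also have "\<dots> \<le> sum g {0..<int N} + sum g {0..<int N}"
    by (intro add_mono right_maximal_count left_maximal_count g0 T)
  also have "\<dots> \<le> 2 * (R * wcount A 0 N - N * \<mu> + (real R)\<^sup>2)"
    using sg[of 0 "int N"] by (simp add: abs_le_iff)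
  also have "\<dots> = R * (2 * (wcount A 0 N + R - N * (\<mu> / R)))"
    using R by (simp add: field_simps power2_eq_square)
  finally have "R * (\<epsilon> * card bad) \<le> R * (2 * (wcount A 0 N + R - N * (\<mu> / R)))" by (simp add: T_def mult_ac)
  thus ?thesis using R by simp
qed

text \<open>With \<open>h = sup \<mu>(n) / n\<close>, every window of length \<open>R\<close> of every member has almost \<open>h R\<close> points, while
  a long extremal window has at most \<open>h\<close> per unit length. The excess is thus nonnegative with small mean,
  and the maximal inequality finds a centre around which all windows are nearly minimal.\<close>
lemma closed_shift_invariant_density:
  fixes X :: "int set set" and D :: real
  assumes shift: "\<And>A p. A \<in> X \<Longrightarrow> (+) p ` A \<in> X"
    and closed: "\<And>s A. (\<And>k::nat. s k \<in> X) \<Longrightarrow> (\<And>x. eventually (\<lambda>k. x \<in> s k \<longleftrightarrow> x \<in> A) sequentially) \<Longrightarrow> A \<in> X"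
    and small: "\<And>n. \<exists>A\<in>X. wcount A 0 (int n) \<le> D * real n"
  shows "\<exists>A\<in>X. \<exists>h\<le>D. has_density A h"
proof -
  define \<mu> where "\<mu> = (\<lambda>n::nat. LEAST k. \<exists>A\<in>X. card (A \<inter> {0..<int n}) = k)"
  have \<mu>_ex: "\<exists>A\<in>X. wcount A 0 (int n) = \<mu> n" for n
  proof -
    have "\<exists>A\<in>X. card (A \<inter> {0..<int n}) = \<mu> n"
      unfolding \<mu>_def by (rule LeastI_ex) (use small in blast)
    thus ?thesis by (auto simp: wcount_card)
  qed
  have \<mu>_le: "\<mu> n \<le> wcount A a (a + int n)" if "A \<in> X" for A a n
  proof -
    have "(+) (- a) ` A \<in> X" by (rule shift[OF that])
    hence "\<mu> n \<le> card ((+) (- a) ` A \<inter> {0..<int n})" unfolding \<mu>_def by (intro Least_le) blast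
    hence "\<mu> n \<le> wcount ((+) (- a) ` A) (- a + a) (- a + (a + int n))" by (simp add: wcount_card)
    thus ?thesis unfolding wcount_shift .
  qed
  have \<mu>_D: "\<mu> n \<le> D * n" for n
    using small[of n] \<mu>_le[of _ n 0] by force
  \<comment> \<open>As a supremum, \<open>h\<close> bounds the extremal window of every length from
    above, while suitable lengths \<open>R j\<close> come within \<open>\<eta> j\<close> of it from
    below; no convergence of \<open>\<mu> n / n\<close> enters.\<close>
  define h where "h = (SUP n\<in>{1::nat..}. \<mu> n / n)"
  have bdd: "bdd_above ((\<lambda>n. \<mu> n / real n) ` {1..})"
    using \<mu>_D by (intro bdd_aboveI[of _ D]) (auto simp: divide_le_eq)
  have hD: "h \<le> D" unfolding h_def using \<mu>_D by (intro cSUP_least) (auto simp: divide_le_eq)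
  have \<mu>_h: "\<mu> n / n \<le> h" if "n > 0" for n
    unfolding h_def using bdd that by (intro cSUP_upper) auto
  define \<epsilon> where "\<epsilon> = (\<lambda>j::nat. 1 / real (Suc j))"
  \<comment> \<open>The tolerance \<open>\<epsilon> j\<close> costs a proportion
    \<open>2 * \<eta> j / \<epsilon> j\<close> of bad centres; these proportions sum to at most
    \<open>1/4\<close> over all \<open>j\<close>.\<close>
  define \<eta> where "\<eta> = (\<lambda>j. \<epsilon> j / 2 ^ (j + 4))"
  have \<epsilon>0: "\<epsilon> j > 0" and \<eta>0: "\<eta> j > 0" for j by (auto simp: \<epsilon>_def \<eta>_def)
  have "\<exists>R>0. \<mu> R / R > h - \<eta> j" for j
  proof -
    have "\<exists>R\<in>{1::nat..}. h - \<eta> j < \<mu> R / R"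
      using \<eta>0[of j] bdd unfolding h_def by (subst less_cSUP_iff[symmetric]) auto
    thus ?thesis by (force simp: Suc_le_eq)
  qed
  then obtain R where R: "\<And>j. R j > 0" "\<And>j. \<mu> (R j) / R j > h - \<eta> j" by metis
  have "\<exists>A\<in>X. \<forall>j\<le>k. \<forall>n\<le>k. wcount A (- int n) (int n + 1) \<le> (2 * real n + 1) * h + \<epsilon> j * (2 * real n + 2) + R j" for k
  proof -
    \<comment> \<open>\<open>W\<close> collects the boundary terms of \<open>window_bound\<close>,
      and \<open>Q\<close> exceeds it. With \<open>N = 4 * Q\<close> the bad centres number fewer
      than \<open>Q + Q\<close>.\<close>
    define W where "W = (\<Sum>j\<le>k. 2 * R j / \<epsilon> j)"
    define Q where "Q = k + 1 + nat \<lceil>W\<rceil>"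
    have Q: "real Q > W" "k < Q" unfolding Q_def by linarith+
    define N where "N = 4 * Q"
    obtain A where A: "A \<in> X" "wcount A 0 (int N) = \<mu> N" using \<mu>_ex by blast
    have AN: "wcount A 0 (int N) \<le> N * h" unfolding A(2) using \<mu>_h[of N] Q by (simp add: N_def field_simps)
    define bad where "bad = (\<lambda>j. {x \<in> {0..<int N}. \<exists>n. int n \<le> x \<and> x + int n < int N \<and>
      (2 * real n + 1) * (\<mu> (R j) / R j) + \<epsilon> j * (2 * real n + 2) + R j < wcount A (x - int n) (x + int n + 1)})"
    have card: "real (card (bad j)) \<le> 2 * N * (\<eta> j / \<epsilon> j) + 2 * R j / \<epsilon> j" for j
    proof -
      have "\<epsilon> j * card (bad j) \<le> 2 * (wcount A 0 N + R j - N * (\<mu> (R j) / R j))"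
        unfolding bad_def by (rule window_bound[OF R(1) \<epsilon>0 \<mu>_le[OF A(1)]])
      also have "\<dots> \<le> 2 * (N * h + R j - N * (h - \<eta> j))"
        using AN R(2)[of j] by (intro mult_left_mono diff_mono add_right_mono) (auto intro: mult_left_mono)
      also have "\<dots> = \<epsilon> j * (2 * N * (\<eta> j / \<epsilon> j) + 2 * R j / \<epsilon> j)"
        using \<epsilon>0[of j] by (simp add: field_simps)
      finally show ?thesis using \<epsilon>0[of j] by simp
    qed
    have "real (card (\<Union>j\<le>k. bad j)) \<le> (\<Sum>j\<le>k. real (card (bad j)))"
      using card_UN_le[of "{..k}" bad] by (metis finite_atMost of_nat_le_iff of_nat_sum)
    also have "\<dots> \<le> (\<Sum>j\<le>k. 2 * N * (\<eta> j / \<epsilon> j) + 2 * R j / \<epsilon> j)" by (intro sum_mono card)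
    also have "\<dots> = 2 * N * (\<Sum>j\<le>k. \<eta> j / \<epsilon> j) + W" by (simp add: W_def sum.distrib sum_distrib_left)
    finally have c: "real (card (\<Union>j\<le>k. bad j)) \<le> real (2 * N) * (\<Sum>j\<le>k. \<eta> j / \<epsilon> j) + W" by simp
    have "\<eta> j / \<epsilon> j = (1/2)^j / 16" for j
      unfolding \<eta>_def using \<epsilon>0[of j] by (simp add: power_add power_one_over)
    hence "(\<Sum>j\<le>k. \<eta> j / \<epsilon> j) = (\<Sum>j\<le>k. (1/2)^j) / 16" by (simp only: sum_divide_distrib)
    also have "(\<Sum>j\<le>k. (1/2::real)^j) = 2 - (1/2)^k"
      by (induction k) (auto simp: field_simps)
    also have "(2 - (1/2)^k) / 16 \<le> (1/8::real)" by simp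
    finally have "real (2 * N) * (\<Sum>j\<le>k. \<eta> j / \<epsilon> j) \<le> real (2 * N) * (1/8)" by (intro mult_left_mono) auto
    moreover have "real (2 * N) * (1/8) = Q" by (simp add: N_def)
    ultimately have lt: "real (card (\<Union>j\<le>k. bad j)) < 2 * Q" using c Q(1) by linarith
    \<comment> \<open>The middle half has \<open>2 * Q\<close> points, so one of them is a good
      centre; since \<open>k < Q\<close>, all symmetric windows of radius at most \<open>k\<close>
      around it stay inside the extremal window.\<close>
    have "\<not> {int Q..<3 * int Q} \<subseteq> (\<Union>j\<le>k. bad j)"
    proof
      assume s: "{int Q..<3 * int Q} \<subseteq> (\<Union>j\<le>k. bad j)"
      have "finite (\<Union>j\<le>k. bad j)" by (rule finite_subset[of _ "{0..<int N}"]) (auto simp: bad_def)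
      from card_mono[OF this s] lt show False by simp
    qed
    then obtain x where x1: "x \<in> {int Q..<3 * int Q}" "x \<notin> (\<Union>j\<le>k. bad j)" by (meson subsetI)
    hence x2: "x \<notin> bad j" if "j \<le> k" for j using that by blast
    note x = x1(1) x2
    have "wcount ((+) (- x) ` A) (- int n) (int n + 1) \<le> (2 * real n + 1) * h + \<epsilon> j * (2 * real n + 2) + R j" if "j \<le> k" "n \<le> k" for j n
    proof -
      have "wcount ((+) (- x) ` A) (- int n) (int n + 1) = wcount ((+) (- x) ` A) (- x + (x - int n)) (- x + (x + int n + 1))"
        by simp
      also have "\<dots> = wcount A (x - int n) (x + int n + 1)" by (rule wcount_shift)
      also have "\<dots> \<le> (2 * real n + 1) * (\<mu> (R j) / R j) + \<epsilon> j * (2 * real n + 2) + R j"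
      proof (rule ccontr)
        assume "\<not> ?thesis"
        hence "x \<in> bad j" unfolding bad_def N_def using x(1) that(2) Q(2)
          by (intro CollectI conjI exI[of _ n]) auto
        thus False using x(2)[OF that(1)] by simp
      qed
      also have "\<dots> \<le> (2 * real n + 1) * h + \<epsilon> j * (2 * real n + 2) + R j"
        using \<mu>_h[OF R(1), of j] by (intro add_right_mono mult_left_mono) auto
      finally show ?thesis .
    qed
    thus ?thesis using shift[OF A(1)] by blast
  qed
  then obtain s where s: "\<And>k. s k \<in> X"
    "\<And>k j n. j \<le> k \<Longrightarrow> n \<le> k \<Longrightarrow> wcount (s k) (- int n) (int n + 1) \<le> (2 * real n + 1) * h + \<epsilon> j * (2 * real n + 2) + R j"
    by metis
  obtain r A where r: "strict_mono r" and A: "\<And>x. eventually (\<lambda>k. x \<in> s (r k) \<longleftrightarrow> x \<in> A) sequentially"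
    using sets_convergent_subsequence[of s] by blast
  have AX: "A \<in> X" by (rule closed[of "\<lambda>k. s (r k)"]) (use s A in auto)
  \<comment> \<open>For fixed \<open>j\<close> and \<open>n\<close> the bound concerns one finite
    window, on which \<open>A\<close> agrees with some \<open>s (r k)\<close> whose index is large
    enough for the bound to hold.\<close>
  have up: "wcount A (- int n) (int n + 1) \<le> (2 * real n + 1) * h + \<epsilon> j * (2 * real n + 2) + R j" for j n
  proof -
    have "eventually (\<lambda>k. k \<ge> max j n \<and> s (r k) \<inter> {- int n..<int n + 1} = A \<inter> {- int n..<int n + 1}) sequentially"
      using eventually_ge_at_top eventually_Int_window_eq[of "\<lambda>k. s (r k)", OF A] by (rule eventually_conj)
    then obtain k where k: "k \<ge> max j n" "s (r k) \<inter> {- int n..<int n + 1} = A \<inter> {- int n..<int n + 1}"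
      by (auto simp: eventually_sequentially)
    have "wcount A (- int n) (int n + 1) = wcount (s (r k)) (- int n) (int n + 1)" unfolding wcount_card k(2) ..
    also have "\<dots> \<le> (2 * real n + 1) * h + \<epsilon> j * (2 * real n + 2) + R j"
      using k(1) seq_suble[OF r, of k] by (intro s) auto
    finally show ?thesis .
  qed
  \<comment> \<open>This half holds for every member of \<open>X\<close>: all windows of length
    \<open>R j\<close> have at least \<open>\<mu> (R j)\<close> points, and averaging over their
    positions gives the count.\<close>
  have low: "(2 * real n + 1) * (h - \<eta> j) - R j \<le> wcount A (- int n) (int n + 1)" for j n
  proof -
    have "(2 * real n + 1) * \<mu> (R j) \<le> (\<Sum>y\<in>{- int n..<int n + 1}. wcount A y (y + int (R j)))"
      using sum_mono[of "{- int n..<int n + 1}" "\<lambda>_. real (\<mu> (R j))" "\<lambda>y. wcount A y (y + int (R j))"] \<mu>_le[OF AX] by simp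
    also have "\<dots> \<le> R j * wcount A (- int n) (int n + 1) + (real (R j))\<^sup>2"
      using wcount_window_average[of "- int n" "int n + 1" A "R j"] by (simp add: abs_le_iff)
    finally have "real (R j) * ((2 * real n + 1) * (\<mu> (R j) / R j)) \<le> R j * (wcount A (- int n) (int n + 1) + R j)"
      using R(1)[of j] unfolding power2_eq_square by (simp add: distrib_left)
    hence "(2 * real n + 1) * (\<mu> (R j) / R j) \<le> wcount A (- int n) (int n + 1) + R j"
      using R(1)[of j] by (simp only: mult_le_cancel_left_pos of_nat_0_less_iff)
    moreover have "(2 * real n + 1) * (h - \<eta> j) \<le> (2 * real n + 1) * (\<mu> (R j) / R j)"
      using R(2)[of j] by (intro mult_left_mono) auto
    ultimately show ?thesis by linarith
  qed
  have "has_density A h" unfolding has_density_def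
  proof (rule LIMSEQ_I)
    fix e :: real assume e: "e > 0"
    obtain j where j: "\<epsilon> j < e / 2" using e reals_Archimedean[of "e/2"] by (auto simp: \<epsilon>_def inverse_eq_divide)
    define K where "K = \<bar>h\<bar> + 2 * \<epsilon> j + R j"
    define n0 where "n0 = nat \<lceil>K / e\<rceil> + 1"
    have "norm (real (card (A \<inter> {- int n..int n})) / (2 * real n) - h) < e" if n: "n \<ge> n0" for n
    proof -
      have n': "real n > 0" "K < e * n"
      proof -
        have "real n > K / e" using n unfolding n0_def by linarith
        thus "K < e * n" using e by (simp add: field_simps)
        show "real n > 0" using n by (simp add: n0_def)
      qed
      have c: "real (card (A \<inter> {- int n..int n})) = wcount A (- int n) (int n + 1)"
        unfolding wcount_card by (intro arg_cong[of _ _ "\<lambda>S. real (card (A \<inter> S))"]) auto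
      have "\<eta> j \<le> \<epsilon> j" unfolding \<eta>_def using \<epsilon>0[of j] by (simp add: field_simps)
      hence "(2 * real n + 1) * \<eta> j \<le> (2 * real n + 1) * \<epsilon> j" by (intro mult_left_mono) auto
      hence "\<bar>wcount A (- int n) (int n + 1) - 2 * real n * h\<bar> \<le> 2 * real n * \<epsilon> j + K"
        using up[of n j] low[of n j] \<epsilon>0[of j] unfolding K_def by (simp add: abs_le_iff algebra_simps) linarith
      also have "\<dots> < 2 * real n * (e / 2) + e * n"
      proof -
        have "2 * real n * \<epsilon> j < 2 * real n * (e / 2)" using j n' by (intro mult_strict_left_mono) auto
        thus ?thesis using n' by linarith
      qed
      also have "\<dots> = e * (2 * real n)" by simp
      finally have "\<bar>wcount A (- int n) (int n + 1) - 2 * real n * h\<bar> / (2 * real n) < e" using n' by (simp add: divide_less_eq)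
      moreover have "wcount A (- int n) (int n + 1) / (2 * real n) - h = (wcount A (- int n) (int n + 1) - 2 * real n * h) / (2 * real n)"
        using n' by (simp add: field_simps)
      ultimately show ?thesis unfolding c using n' by (simp add: abs_divide)
    qed
    thus "\<exists>n0. \<forall>n\<ge>n0. norm (real (card (A \<inter> {- int n..int n})) / (2 * real n) - h) < e" by blast
  qed
  thus ?thesis using AX hD by blast
qed

section \<open>Sampling sets\<close>

lemma sum_roots_of_unity:
  fixes m :: nat and k :: int
  assumes m: "m > 0" and k: "\<bar>k\<bar> < int m"
  shows "(\<Sum>j<m. cis (2 * pi * real j * of_int k / real m)) = (if k = 0 then of_nat m else 0)"
proof (cases "k = 0")
  case False
  define z where "z = cis (2 * pi * of_int k / real m)"
  have z1: "z \<noteq> 1"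
  proof
    assume "z = 1"
    hence "cos (2 * pi * of_int k / real m) = 1" by (simp add: z_def complex_eq_iff)
    then obtain n :: int where "2 * pi * of_int k / real m = of_int n * 2 * pi" by (auto simp: cos_one_2pi_int)
    hence "real_of_int k = of_int (n * int m)" using m by (simp add: field_simps)
    hence "k = n * int m" by linarith
    thus False using k False by (auto simp: abs_mult zmult_zless_mono2 dest: mult_less_cancel_right1[THEN iffD1])
  qed
  have "z ^ m = 1" using m by (simp add: z_def Complex.DeMoivre cis_multiple_2pi)
  moreover have "(\<Sum>j<m. cis (2 * pi * real j * of_int k / real m)) = (\<Sum>j<m. z ^ j)"
    by (intro sum.cong refl) (simp add: z_def Complex.DeMoivre mult_ac)
  ultimately show ?thesis using False z1 by (simp add: sum_gp_strict)
qed simp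

section \<open>Cells, residue classes and sampling bounds\<close>

text \<open>Encoded by a floor so that disjointness is immediate and dyadic refinement is integer
  division by two.\<close>

definition cell :: "nat \<Rightarrow> nat \<Rightarrow> real set" where
  "cell m l = {x. \<lfloor>x * real m / (2 * pi)\<rfloor> = int l}"

lemma cell_interval:
  assumes "m > 0"
  shows "cell m l = {2 * pi * l / m..<2 * pi * (l + 1) / m}"
  using assms unfolding cell_def floor_eq_iff by (auto simp: field_simps)

lemma cell_sets [measurable]: "m > 0 \<Longrightarrow> cell m l \<in> sets borel"
  by (simp add: cell_interval)

lemma cell_affine: "m > 0 \<Longrightarrow> 2 * pi * l / m + 1 / m * s \<in> cell m l \<longleftrightarrow> s \<in> {0..<2*pi}"
proof -
  assume m: "m > 0"
  have "(2 * pi * l / m + 1 / m * s) * real m / (2 * pi) = of_int (int l) + s / (2 * pi)"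
    using m by (simp add: field_simps)
  hence "2 * pi * l / m + 1 / m * s \<in> cell m l \<longleftrightarrow> \<lfloor>s / (2 * pi)\<rfloor> = 0"
    unfolding cell_def mem_Collect_eq by (simp only: floor_add_int[symmetric]) simp
  also have "\<dots> \<longleftrightarrow> s \<in> {0..<2*pi}" by (auto simp: floor_eq_iff field_simps)
  finally show ?thesis .
qed

lemma integral_cell:
  fixes F :: "real \<Rightarrow> 'a :: {banach, second_countable_topology}"
  assumes m: "m > 0"
  shows "(\<integral>x. indicator (cell m l) x *\<^sub>R F x \<partial>lborel)
     = (1 / m) *\<^sub>R (\<integral>s. indicator {0..<2*pi} s *\<^sub>R F (2 * pi * l / m + 1 / m * s) \<partial>lborel)"
proof -
  have i: "indicat_real (cell m l) (2 * pi * l / m + 1 / m * s) = indicator {0..<2*pi} s" for s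
    unfolding indicator_def using cell_affine[OF m, of l s] by simp
  show ?thesis
    by (subst lborel_integral_real_affine[where c = "1 / m" and t = "2 * pi * l / m"]) (use m in \<open>simp_all only: i, simp_all\<close>)
qed

lemma sum_cells:
  fixes F :: "real \<Rightarrow> 'a :: real_vector"
  assumes "finite L" and "\<And>x. x \<notin> (\<Union>l\<in>L. cell m l) \<Longrightarrow> F x = 0"
  shows "(\<Sum>l\<in>L. indicator (cell m l) x *\<^sub>R F x) = F x"
proof (cases "x \<in> (\<Union>l\<in>L. cell m l)")
  case True
  then obtain l0 where l0: "l0 \<in> L" "x \<in> cell m l0" by auto
  have "(\<Sum>l\<in>L. indicator (cell m l) x *\<^sub>R F x) = (\<Sum>l\<in>L. if l = l0 then F x else 0)"
    using l0 by (intro sum.cong refl) (auto simp: indicator_def cell_def)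
  thus ?thesis using assms(1) l0 by simp
next
  case False
  thus ?thesis using assms(2) by simp
qed

definition residue_set :: "nat \<Rightarrow> nat set \<Rightarrow> int set" where
  "residue_set m J = {k. nat (k mod int m) \<in> J}"

text \<open>A lower bound \<open>v\<close> for the energy of the samples along \<open>A\<close>,
  phrased with finite subsets and an arbitrarily small loss: this form is suited to pointwise limits
  of \<open>A\<close> and carries no summability conditions.\<close>

definition samples_bound :: "int set \<Rightarrow> real \<Rightarrow> (real \<Rightarrow> complex) \<Rightarrow> bool" where
  "samples_bound A v g \<longleftrightarrow> (\<forall>e>0. \<exists>K. finite K \<and> K \<subseteq> A \<and> v - e < (\<Sum>k\<in>K. (cmod (fourier g (of_int k)))\<^sup>2))"

text \<open>Splitting \<open>[0,2\<pi>)\<close> into \<open>m\<close> cells, the samples of \<open>g\<close> along \<open>j + m\<int>\<close> are the Fourier coefficients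
  of the discrete Fourier transform, at frequency \<open>j\<close>, of the pieces of \<open>g\<close>.\<close>
lemma residue_set_samples_bound:
  assumes m: "m > 0" and L: "L \<subseteq> {..<m}" and J: "J \<subseteq> {..<m}"
    and g: "g \<in> L2per" and supp: "\<And>t. t \<notin> (\<Union>l\<in>L. cell m l) \<Longrightarrow> g t = 0"
    and frame: "\<And>x :: nat \<Rightarrow> complex. B * (\<Sum>l\<in>L. (cmod (x l))\<^sup>2)
        \<le> (\<Sum>j\<in>J. (cmod (\<Sum>l\<in>L. cis (2 * pi * real j * real l / real m) * x l))\<^sup>2)"
  shows "samples_bound (residue_set m J) (2 * pi * B / m * L2_sq g) g"
proof -
  have finL: "finite L" and finJ: "finite J" using L J finite_subset by blast+
  \<comment> \<open>\<open>h l\<close> is the piece of \<open>g\<close> on cell \<open>l\<close>,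
    stretched to the full period. \<open>H j\<close> superposes the pieces with the phases that make
    its \<open>q\<close>-th coefficient the sample of \<open>g\<close> at
    \<open>j + m * q\<close>.\<close>
  define h where "h = (\<lambda>l s. indicator {0..<2*pi} s * g (2 * pi * real l / m + 1 / m * s))"
  define H where "H = (\<lambda>j s. \<Sum>l\<in>L. (1 / of_nat m * cis (j * (2 * pi * real l / m + 1 / m * s))) * h l s)"
  have gm[measurable]: "g \<in> borel_measurable borel" by (rule L2perD(1)[OF g])
  have hL: "h l \<in> L2per" for l
  proof -
    have "integrable lborel (\<lambda>x. indicator (cell m l) x * (cmod (g x))\<^sup>2)"
      using integrable_real_mult_indicator[OF _ L2perD(3)[OF g], of "cell m l"] m by (simp add: mult.commute)
    hence "integrable lborel (\<lambda>s. indicator (cell m l) (2 * pi * l / m + 1 / m * s) * (cmod (g (2 * pi * l / m + 1 / m * s)))\<^sup>2)"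
      by (rule lborel_integrable_real_affine) (use m in simp)
    moreover have "indicat_real (cell m l) (2 * pi * l / m + 1 / m * s) * (cmod (g (2 * pi * l / m + 1 / m * s)))\<^sup>2 = (cmod (h l s))\<^sup>2" for s
      unfolding h_def indicator_def using cell_affine[OF m, of l s] by (simp add: norm_mult)
    ultimately have "integrable lborel (\<lambda>s. (cmod (h l s))\<^sup>2)" by (simp only:)
    moreover have "h l \<in> borel_measurable borel" unfolding h_def by measurable
    ultimately show ?thesis by (auto simp: L2per_def h_def indicator_def)
  qed
  have [measurable]: "h l \<in> borel_measurable borel" for l by (rule L2perD(1)[OF hL])
  have HL: "H j \<in> L2per" for j
    unfolding H_def by (intro L2per_sum L2per_mult_bounded[OF hL, where B = "1 / m"]) (auto simp: norm_mult norm_divide)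
  have fourier_H: "fourier (H j) (of_int q) = fourier g (j + m * of_int q)" for j :: real and q :: int
  proof -
    let ?y = "\<lambda>l s. 2 * pi * real l / m + 1 / m * s"
    have "fourier (H j) (of_int q) = (\<integral>s. (\<Sum>l\<in>L. (1 / m) *\<^sub>R (indicator {0..<2*pi} s *\<^sub>R (g (?y l s) * cis ((j + m * of_int q) * ?y l s)))) \<partial>lborel)"
      unfolding fourier_def
    proof (intro Bochner_Integration.integral_cong refl)
      fix s
      \<comment> \<open>The frequency \<open>m * q\<close> times the offset
        \<open>2 * pi * l / m\<close> of a cell is a multiple of \<open>2 * pi\<close>; within a
        residue class the position of the cell is thus felt only through \<open>j\<close>.\<close>
      have c: "cis ((j + m * of_int q) * ?y l s) = cis (j * ?y l s) * cis (of_int q * s)" for l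
      proof -
        have "(j + m * of_int q) * ?y l s = j * ?y l s + of_int q * s + 2 * pi * of_int (q * int l)"
          using m by (simp add: field_simps)
        moreover have "cis (2 * pi * of_int (q * int l)) = 1" by (rule cis_multiple_2pi) simp
        ultimately show ?thesis by (simp only: cis_mult[symmetric] mult_1_right)
      qed
      show "H j s * cis (of_int q * s) = (\<Sum>l\<in>L. (1 / m) *\<^sub>R (indicator {0..<2*pi} s *\<^sub>R (g (?y l s) * cis ((j + m * of_int q) * ?y l s))))"
        unfolding H_def h_def c sum_distrib_right
        by (intro sum.cong refl) (simp add: scaleR_conv_of_real indicator_def)
    qed
    also have "\<dots> = (\<Sum>l\<in>L. \<integral>s. (1 / m) *\<^sub>R (indicator {0..<2*pi} s *\<^sub>R (g (?y l s) * cis ((j + m * of_int q) * ?y l s))) \<partial>lborel)"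
    proof (intro Bochner_Integration.integral_sum integrable_scaleR_right)
      fix l
      have "integrable lborel (\<lambda>s. h l s)" by (rule L2per_integrable[OF hL])
      hence "integrable lborel (\<lambda>s. h l s * cis ((j + m * of_int q) * ?y l s))"
        by (rule Bochner_Integration.integrable_bound) (measurable, auto simp: norm_mult)
      thus "integrable lborel (\<lambda>s. indicator {0..<2*pi} s *\<^sub>R (g (?y l s) * cis ((j + m * of_int q) * ?y l s)))"
        by (simp add: h_def scaleR_conv_of_real of_real_indicator mult.assoc)
    qed
    also have "\<dots> = (\<Sum>l\<in>L. \<integral>x. indicator (cell m l) x *\<^sub>R (g x * cis ((j + m * of_int q) * x)) \<partial>lborel)"
      unfolding integral_cell[OF m] by (simp only: integral_scaleR_right)
    also have "\<dots> = (\<integral>x. (\<Sum>l\<in>L. indicator (cell m l) x *\<^sub>R (g x * cis ((j + m * of_int q) * x))) \<partial>lborel)"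
      using m by (intro Bochner_Integration.integral_sum[symmetric] integrable_mult_indicator fourier_integrable g) auto
    also have "\<dots> = fourier g (j + m * of_int q)"
      unfolding fourier_def by (intro Bochner_Integration.integral_cong refl sum_cells finL) (simp add: supp)
    finally show ?thesis .
  qed
  have low: "B / m * L2_sq g \<le> (\<Sum>j\<in>J. L2_sq (H (real j)))"
  proof -
    have "(\<Sum>l\<in>L. L2_sq (h l)) = (\<Sum>l\<in>L. m * (\<integral>x. indicator (cell m l) x *\<^sub>R (cmod (g x))\<^sup>2 \<partial>lborel))"
    proof (intro sum.cong refl)
      fix l
      have "L2_sq (h l) = (\<integral>s. indicator {0..<2*pi} s *\<^sub>R (cmod (g (2 * pi * l / m + 1 / m * s)))\<^sup>2 \<partial>lborel)"
        unfolding L2_sq_def h_def by (intro Bochner_Integration.integral_cong refl) (auto simp: indicator_def)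
      thus "L2_sq (h l) = m * (\<integral>x. indicator (cell m l) x *\<^sub>R (cmod (g x))\<^sup>2 \<partial>lborel)"
        unfolding integral_cell[OF m] using m by simp
    qed
    also have "\<dots> = m * (\<integral>x. (\<Sum>l\<in>L. indicator (cell m l) x *\<^sub>R (cmod (g x))\<^sup>2) \<partial>lborel)"
      unfolding sum_distrib_left[symmetric] using m L2perD(3)[OF g]
      by (subst Bochner_Integration.integral_sum) (auto intro!: integrable_mult_indicator simp del: real_scaleR_def)
    also have "(\<integral>x. (\<Sum>l\<in>L. indicator (cell m l) x *\<^sub>R (cmod (g x))\<^sup>2) \<partial>lborel) = L2_sq g"
      unfolding L2_sq_def by (intro Bochner_Integration.integral_cong refl sum_cells finL) (simp add: supp)
    finally have 1: "(\<Sum>l\<in>L. L2_sq (h l)) = m * L2_sq g" .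
    \<comment> \<open>The phase \<open>cis (j * s / m)\<close> is common to all cells and drops out
      of the modulus. What remains is row \<open>j\<close> of the discrete Fourier matrix applied to
      the vector of the \<open>h l s\<close>, so \<open>frame\<close> applies pointwise in
      \<open>s\<close>.\<close>
    have ph: "(cmod (H (real j) s))\<^sup>2 = (cmod (\<Sum>l\<in>L. cis (2 * pi * real j * real l / real m) * h l s))\<^sup>2 / m\<^sup>2" for j s
    proof -
      have "H (real j) s = (1 / of_nat m * cis (j * s / m)) * (\<Sum>l\<in>L. cis (2 * pi * real j * real l / real m) * h l s)"
        unfolding H_def sum_distrib_left
        by (intro sum.cong refl) (simp add: distrib_left cis_mult[symmetric] mult_ac)
      thus ?thesis by (simp add: norm_mult norm_divide power_divide)
    qed
    have "B / m * L2_sq g = B / m\<^sup>2 * (\<Sum>l\<in>L. L2_sq (h l))" unfolding 1 using m by (simp add: power2_eq_square)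
    also have "\<dots> = (\<integral>s. B / m\<^sup>2 * (\<Sum>l\<in>L. (cmod (h l s))\<^sup>2) \<partial>lborel)"
      unfolding L2_sq_def using L2perD(3)[OF hL] by simp
    also have "\<dots> \<le> (\<integral>s. (\<Sum>j\<in>J. (cmod (H (real j) s))\<^sup>2) \<partial>lborel)"
    proof (rule Bochner_Integration.integral_mono)
      show "integrable lborel (\<lambda>s. B / m\<^sup>2 * (\<Sum>l\<in>L. (cmod (h l s))\<^sup>2))" using L2perD(3)[OF hL] by simp
      show "integrable lborel (\<lambda>s. \<Sum>j\<in>J. (cmod (H (real j) s))\<^sup>2)" using L2perD(3)[OF HL] by simp
      show "B / m\<^sup>2 * (\<Sum>l\<in>L. (cmod (h l s))\<^sup>2) \<le> (\<Sum>j\<in>J. (cmod (H (real j) s))\<^sup>2)" for s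
        unfolding ph sum_divide_distrib[symmetric] using divide_right_mono[OF frame[of "\<lambda>l. h l s"], of "(real m)\<^sup>2"] by simp
    qed
    also have "\<dots> = (\<Sum>j\<in>J. L2_sq (H (real j)))"
      unfolding L2_sq_def using L2perD(3)[OF HL] by (simp add: Bochner_Integration.integral_sum)
    finally show ?thesis .
  qed
  show ?thesis unfolding samples_bound_def
  proof (intro allI impI)
    fix e :: real assume e: "e > 0"
    define e' where "e' = e / (card J + 1)"
    have e': "e' > 0" "card J * e' < e" using e by (auto simp: e'_def field_simps)
    have "\<forall>j\<in>J. \<exists>K. finite K \<and> 2 * pi * L2_sq (H (real j)) - e' < (\<Sum>q\<in>K. (cmod (fourier (H (real j)) (of_int q)))\<^sup>2)"
      using parseval_lower[OF HL e'(1)] by blast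
    then obtain K where K: "\<And>j. j \<in> J \<Longrightarrow> finite (K j)"
      "\<And>j. j \<in> J \<Longrightarrow> 2 * pi * L2_sq (H (real j)) - e' < (\<Sum>q\<in>K j. (cmod (fourier (H (real j)) (of_int q)))\<^sup>2)"
      by metis
    define \<phi> where "\<phi> = (\<lambda>(j, q). int j + int m * q)"
    have inj: "inj_on \<phi> (Sigma J K)"
    proof (rule inj_onI, clarify)
      fix j q j' q' assume jq: "j \<in> J" "j' \<in> J" "\<phi> (j, q) = \<phi> (j', q')"
      have lt: "j < m" "j' < m" using jq J by auto
      have "int j = \<phi> (j, q) mod int m" "int j' = \<phi> (j', q') mod int m" using lt by (simp_all add: \<phi>_def)
      hence "j = j'" unfolding jq(3) by simp
      thus "j = j' \<and> q = q'" using jq(3) m by (simp add: \<phi>_def)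
    qed
    have fin: "finite (\<phi> ` Sigma J K)" using finJ K by auto
    have sub: "\<phi> ` Sigma J K \<subseteq> residue_set m J"
      using J by (auto simp: \<phi>_def residue_set_def)
    have "2 * pi * B / m * L2_sq g - e < (\<Sum>j\<in>J. 2 * pi * L2_sq (H (real j)) - e')"
    proof -
      have "2 * pi * (B / m * L2_sq g) \<le> 2 * pi * (\<Sum>j\<in>J. L2_sq (H (real j)))" using low by (intro mult_left_mono) auto
      thus ?thesis using e'(2) by (simp add: sum_subtractf sum_distrib_left)
    qed
    also have "\<dots> \<le> (\<Sum>j\<in>J. \<Sum>q\<in>K j. (cmod (fourier (H (real j)) (of_int q)))\<^sup>2)"
      using K(2) by (intro sum_mono less_imp_le)
    also have "\<dots> = (\<Sum>(j, q)\<in>Sigma J K. (cmod (fourier g (of_int (\<phi> (j, q)))))\<^sup>2)"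
      using finJ K(1) by (simp add: sum.Sigma fourier_H \<phi>_def)
    also have "\<dots> = (\<Sum>k\<in>\<phi> ` Sigma J K. (cmod (fourier g (of_int k)))\<^sup>2)"
      by (subst sum.reindex[OF inj]) (simp add: case_prod_unfold)
    finally show "\<exists>K. finite K \<and> K \<subseteq> residue_set m J \<and> 2 * pi * B / m * L2_sq g - e < (\<Sum>k\<in>K. (cmod (fourier g (of_int k)))\<^sup>2)"
      using fin sub by blast
  qed
qed

section \<open>Stability of sampling bounds, and window counts of residue classes\<close>

lemma samples_bound_shift:
  assumes "samples_bound A v (\<lambda>t. cis (of_int p * t) * g t)"
  shows "samples_bound ((+) p ` A) v g"
  unfolding samples_bound_def
proof (intro allI impI)
  fix e :: real assume "e > 0"
  then obtain K where K: "finite K" "K \<subseteq> A" "v - e < (\<Sum>k\<in>K. (cmod (fourier (\<lambda>t. cis (of_int p * t) * g t) (of_int k)))\<^sup>2)"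
    using assms unfolding samples_bound_def by blast
  have "(\<Sum>k\<in>K. (cmod (fourier (\<lambda>t. cis (of_int p * t) * g t) (of_int k)))\<^sup>2) = (\<Sum>k\<in>(+) p ` K. (cmod (fourier g (of_int k)))\<^sup>2)"
    by (subst sum.reindex) (auto simp: fourier_modulate)
  thus "\<exists>K. finite K \<and> K \<subseteq> (+) p ` A \<and> v - e < (\<Sum>k\<in>K. (cmod (fourier g (of_int k)))\<^sup>2)"
    using K by (intro exI[of _ "(+) p ` K"]) auto
qed

text \<open>By Bessel's inequality the squared samples along all integers have bounded finite sums,
  so a finite \<open>K0\<close> carries all but \<open>e/2\<close> of them. On \<open>K0\<close> the
  sets eventually agree with the limit.\<close>

lemma samples_bound_limit:
  assumes g: "g \<in> L2per" and s: "eventually (\<lambda>k. samples_bound (s k) v g) sequentially"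
    and lim: "\<And>x. eventually (\<lambda>k. x \<in> s k \<longleftrightarrow> x \<in> A) sequentially"
  shows "samples_bound A v g"
  unfolding samples_bound_def
proof (intro allI impI)
  fix e :: real assume e: "e > 0"
  let ?S = "\<lambda>K. \<Sum>k\<in>K. (cmod (fourier g (of_int k)))\<^sup>2"
  have bdd: "bdd_above (?S ` {K. finite K})" using bessel[OF g] by (intro bdd_aboveI[of _ "2 * pi * L2_sq g"]) auto
  have "\<exists>K0\<in>{K. finite K}. (SUP K\<in>{K. finite K}. ?S K) - e/2 < ?S K0"
    using e bdd by (subst less_cSUP_iff[symmetric]) auto
  then obtain K0 where K0: "finite K0" "(SUP K\<in>{K. finite K}. ?S K) - e/2 < ?S K0" by blast
  have tail: "?S K \<le> ?S K0 + e/2" if "finite K" for K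
    using cSUP_upper[OF _ bdd, of K] that K0(2) by simp
  have "eventually (\<lambda>k. \<forall>x\<in>K0. x \<in> s k \<longleftrightarrow> x \<in> A) sequentially"
    using lim K0(1) by (intro eventually_ball_finite) auto
  from eventually_conj[OF this s] obtain k where k: "\<forall>x\<in>K0. x \<in> s k \<longleftrightarrow> x \<in> A" "samples_bound (s k) v g"
    by (auto simp: eventually_sequentially)
  have "e/2 > 0" using e by simp
  then obtain K where K: "finite K" "K \<subseteq> s k" "v - e/2 < ?S K" using k(2) unfolding samples_bound_def by blast
  have "?S K = ?S (K \<inter> K0) + ?S (K - K0)"
    using K(1) by (metis sum.Int_Diff)
  moreover have "?S (K - K0) + ?S K0 = ?S (K \<union> K0)"
    using K(1) K0(1) by (metis Un_Diff_cancel2 finite_Diff Diff_disjoint Int_commute sum.union_disjoint)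
  moreover have "?S (K \<union> K0) \<le> ?S K0 + e/2" using K(1) K0(1) by (intro tail) auto
  moreover have "?S (K \<inter> K0) \<le> ?S (A \<inter> K0)"
    using K0(1) K(2) k(1) by (intro sum_mono2) auto
  ultimately have "v - e < ?S (A \<inter> K0)" using K(3) by linarith
  thus "\<exists>K. finite K \<and> K \<subseteq> A \<and> v - e < ?S K" using K0(1) by (intro exI[of _ "A \<inter> K0"]) auto
qed


lemma samples_bound_mono: "samples_bound A v g \<Longrightarrow> w \<le> v \<Longrightarrow> samples_bound A w g"
  unfolding samples_bound_def by (meson diff_right_mono order.strict_trans1)

text \<open>Minkowski's inequality for the samples over a finite \<open>K\<close>: the samples of
  \<open>g - h n\<close> are small by Bessel, uniformly in \<open>K\<close>, so the bound for
  \<open>h n\<close> passes to \<open>g\<close> with the same \<open>c\<close>.\<close>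

lemma samples_bound_dense:
  assumes g: "g \<in> L2per" and h: "\<And>n. h n \<in> L2per"
    and lim: "(\<lambda>n. L2_sq (\<lambda>t. g t - h n t)) \<longlonglongrightarrow> 0"
    and orth: "\<And>n. L2_sq (h n) = L2_sq g - L2_sq (\<lambda>t. g t - h n t)"
    and sb: "eventually (\<lambda>n::nat. samples_bound A (c * L2_sq (h n)) (h n)) sequentially"
  shows "samples_bound A (c * L2_sq g) g"
  unfolding samples_bound_def
proof (intro allI impI)
  fix e :: real assume e: "e > 0"
  define \<delta> where "\<delta> = (\<lambda>n. L2_sq (\<lambda>t. g t - h n t))"
  define M where "M = sqrt (2 * pi * L2_sq g)"
  have "(\<lambda>n. c * \<delta> n + 2 * sqrt (2 * pi * \<delta> n) * M + 2 * pi * \<delta> n) \<longlonglongrightarrow> c * 0 + 2 * sqrt (2 * pi * 0) * M + 2 * pi * 0"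
    unfolding \<delta>_def by (intro tendsto_intros lim)
  hence "eventually (\<lambda>n. c * \<delta> n + 2 * sqrt (2 * pi * \<delta> n) * M + 2 * pi * \<delta> n < e/2) sequentially"
    using e by (intro order_tendstoD) auto
  from eventually_conj[OF this sb] obtain n where n: "c * \<delta> n + 2 * sqrt (2 * pi * \<delta> n) * M + 2 * pi * \<delta> n < e/2"
    "samples_bound A (c * L2_sq (h n)) (h n)" by (auto simp: eventually_sequentially)
  have "e/2 > 0" using e by simp
  then obtain K where K: "finite K" "K \<subseteq> A" "c * L2_sq (h n) - e/2 < (\<Sum>k\<in>K. (cmod (fourier (h n) (of_int k)))\<^sup>2)"
    using n(2) unfolding samples_bound_def by blast
  define G Hh Df where "G = L2_set (\<lambda>k. cmod (fourier g (of_int k))) K" and "Hh = L2_set (\<lambda>k. cmod (fourier (h n) (of_int k))) K"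
    and "Df = L2_set (\<lambda>k. cmod (fourier (\<lambda>t. g t - h n t) (of_int k))) K"
  have sq: "(L2_set f K)\<^sup>2 = (\<Sum>k\<in>K. (f k)\<^sup>2)" for f :: "int \<Rightarrow> real"
    unfolding L2_set_def by (simp add: sum_nonneg)
  have "Hh \<le> L2_set (\<lambda>k. cmod (fourier g (of_int k)) + cmod (fourier (\<lambda>t. g t - h n t) (of_int k))) K"
    unfolding Hh_def
  proof (intro L2_set_mono)
    fix k
    have "fourier (h n) (of_int k) = fourier g (of_int k) - fourier (\<lambda>t. g t - h n t) (of_int k)" using fourier_diff[OF g h] by simp
    thus "cmod (fourier (h n) (of_int k)) \<le> cmod (fourier g (of_int k)) + cmod (fourier (\<lambda>t. g t - h n t) (of_int k))"
      by (simp add: norm_triangle_ineq4)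
  qed auto
  also have "\<dots> \<le> G + Df" unfolding G_def Df_def by (rule L2_set_triangle_ineq)
  finally have HGD: "Hh \<le> G + Df" .
  have DfB: "Df \<le> sqrt (2 * pi * \<delta> n)"
    unfolding Df_def L2_set_def \<delta>_def by (intro real_sqrt_le_mono bessel L2per_diff g h K)
  have GB: "G \<le> M" unfolding G_def L2_set_def M_def by (intro real_sqrt_le_mono bessel g K)
  have nn: "0 \<le> G" "0 \<le> Df" "0 \<le> Hh" unfolding G_def Df_def Hh_def by auto
  have \<delta>0: "0 \<le> \<delta> n" unfolding \<delta>_def by (rule L2_sq_nonneg)
  have "Hh\<^sup>2 \<le> (G + Df)\<^sup>2" using HGD nn by (intro power_mono) auto
  also have "\<dots> = G\<^sup>2 + 2 * Df * G + Df\<^sup>2" by (simp add: power2_sum)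
  also have "\<dots> \<le> G\<^sup>2 + 2 * sqrt (2 * pi * \<delta> n) * M + 2 * pi * \<delta> n"
  proof -
    have "Df * G \<le> sqrt (2 * pi * \<delta> n) * M" using DfB GB nn \<delta>0 by (intro mult_mono) auto
    moreover have "Df\<^sup>2 \<le> (sqrt (2 * pi * \<delta> n))\<^sup>2" using DfB nn by (intro power_mono) auto
    moreover have "(sqrt (2 * pi * \<delta> n))\<^sup>2 = 2 * pi * \<delta> n" using \<delta>0 by simp
    ultimately show ?thesis by linarith
  qed
  finally have "Hh\<^sup>2 \<le> G\<^sup>2 + 2 * sqrt (2 * pi * \<delta> n) * M + 2 * pi * \<delta> n" .
  moreover have "c * L2_sq (h n) = c * L2_sq g - c * \<delta> n" unfolding \<delta>_def using orth[of n] by (simp add: right_diff_distrib)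
  moreover have "c * L2_sq (h n) - e/2 < Hh\<^sup>2" using K(3) unfolding Hh_def sq .
  ultimately have "c * L2_sq g - e < G\<^sup>2" using n(1) by linarith
  thus "\<exists>K. finite K \<and> K \<subseteq> A \<and> c * L2_sq g - e < (\<Sum>k\<in>K. (cmod (fourier g (of_int k)))\<^sup>2)"
    using K(1,2) unfolding G_def sq by blast
qed

text \<open>Over one full period of starting points the window counts average exactly
  \<open>card J / m * n\<close>, so some translate does not exceed this mean.\<close>

lemma residue_set_window:
  assumes m: "m > 0" and J: "J \<subseteq> {..<m}"
  shows "\<exists>p. wcount ((+) p ` residue_set m J) 0 (int n) \<le> card J / m * n"
proof -
  let ?A = "residue_set m J"
  have per: "(+) (int m) ` ?A = ?A"
  proof (intro set_eqI iffI)
    fix x assume "x \<in> ?A"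
    hence "x - int m \<in> ?A" by (simp add: residue_set_def)
    thus "x \<in> (+) (int m) ` ?A" by (intro image_eqI[of _ _ "x - int m"]) auto
  qed (auto simp: residue_set_def)
  have "?A \<inter> {0..<int m} = int ` J"
  proof (intro set_eqI iffI)
    fix x assume "x \<in> ?A \<inter> {0..<int m}"
    hence "nat x \<in> J" "x = int (nat x)" by (auto simp: residue_set_def)
    thus "x \<in> int ` J" by blast
  qed (use J in \<open>auto simp: residue_set_def\<close>)
  hence one: "wcount ?A 0 (int m) = card J" by (simp add: wcount_card card_image)
  have "wcount ?A (0 + int i) (int m + int i) = card J" for i
  proof -
    have "wcount ?A (int m) (int m + int i) = wcount ?A 0 (int i)"
      using wcount_shift[of "int m" ?A 0 "int i"] unfolding per by simp
    thus ?thesis using wcount_split[of 0 "int i" "int m + int i" ?A] wcount_split[of 0 "int m" "int m + int i" ?A] one by simp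
  qed
  hence sum: "(\<Sum>y\<in>{0..<int m}. wcount ?A y (y + int n)) = n * card J" unfolding wcount_window_sum by simp
  have "\<exists>y\<in>{0..<int m}. wcount ?A y (y + int n) \<le> card J / m * n"
  proof (rule ccontr)
    assume "\<not> ?thesis"
    hence "(\<Sum>y\<in>{0..<int m}. card J / m * n) < (\<Sum>y\<in>{0..<int m}. wcount ?A y (y + int n))"
      using m by (intro sum_strict_mono) (auto simp: not_le)
    thus False unfolding sum using m by simp
  qed
  then obtain y where y: "wcount ?A y (y + int n) \<le> card J / m * n" by blast
  have "wcount ((+) (- y) ` ?A) (- y + y) (- y + (y + int n)) = wcount ?A y (y + int n)" by (rule wcount_shift)
  thus ?thesis using y by (intro exI[of _ "- y"]) simp
qed

text \<open>Distinct columns of the full Fourier matrix are orthogonal with squared norm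
  \<open>m\<close>, hence any set \<open>L\<close> of columns gives a tight frame. The vectors
  \<open>u\<close> carry the conjugate phase because \<open>row_selection\<close> pairs with
  \<open>cnj u\<close>.\<close>

lemma fourier_row_selection:
  fixes d :: real
  assumes m: "m > 0" and L: "L \<subseteq> {..<m}" and d: "d > 0" and large: "d * card L \<ge> 4"
  shows "\<exists>J\<subseteq>{..<m}. card J \<le> (1 + d) * card L \<and>
    (\<forall>x. d\<^sup>2 / (4 * (1 + d) * (d + 2)) * card L * (\<Sum>l\<in>L. (cmod (x l))\<^sup>2)
        \<le> (\<Sum>j\<in>J. (cmod (\<Sum>l\<in>L. cis (2 * pi * real j * real l / real m) * x l))\<^sup>2))"
proof -
  define u where "u = (\<lambda>(j::nat) (l::nat). cis (- (2 * pi * real j * real l / real m)))"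
  have finL: "finite L" using L finite_subset by blast
  have ne: "L \<noteq> {}" using large by auto
  have le: "card L \<le> card {..<m}" using L by (intro card_mono) auto
  have tight: "(\<Sum>j<m. u j i * cnj (u j l)) = (if i = l then of_nat (card {..<m}) else 0)" if "i \<in> L" "l \<in> L" for i l
  proof -
    have "(\<Sum>j<m. u j i * cnj (u j l)) = (\<Sum>j<m. cis (2 * pi * real j * of_int (int l - int i) / real m))"
      unfolding u_def by (intro sum.cong refl) (simp add: cis_cnj cis_mult diff_divide_distrib right_diff_distrib)
    also have "\<dots> = (if int l - int i = 0 then of_nat m else 0)"
      using that L m by (intro sum_roots_of_unity) (auto simp: abs_less_iff)
    finally show ?thesis by auto
  qed
  from row_selection[OF finL ne finite_lessThan le tight d large] show ?thesis
    unfolding u_def by (simp add: cis_cnj)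
qed

section \<open>Exhausting an open set by dyadic cells\<close>

definition inner_cells :: "real set \<Rightarrow> nat \<Rightarrow> nat set" where
  "inner_cells U k = {l. l < 2 ^ k \<and> cell (2 ^ k) l \<subseteq> U}"

definition inner_set :: "real set \<Rightarrow> nat \<Rightarrow> real set" where
  "inner_set U k = (\<Union>l\<in>inner_cells U k. cell (2 ^ k) l)"

lemma inner_cells_finite: "finite (inner_cells U k)"
  unfolding inner_cells_def by (rule finite_subset[of _ "{..<2^k}"]) auto

lemma inner_set_sets [measurable]: "inner_set U k \<in> sets borel"
  unfolding inner_set_def using inner_cells_finite by (intro sets.finite_UN cell_sets) auto

lemma cell_bounds:
  assumes "l < 2 ^ k" "x \<in> cell (2 ^ k) l"
  shows "x \<in> {0..<2*pi}"
proof -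
  have x: "2 * pi * l / 2^k \<le> x" "x < 2 * pi * (l + 1) / 2^k" using assms(2) unfolding cell_interval[of "2^k", simplified] by auto
  have "0 \<le> 2 * pi * l / 2^k" by simp
  moreover have "2 * pi * (l + 1) / 2^k \<le> 2 * pi"
  proof -
    have "real (l + 1) \<le> real (2 ^ k)" using assms(1) by (intro of_nat_mono) simp
    hence "2 * pi * real (l + 1) \<le> 2 * pi * 2 ^ k" by simp
    thus ?thesis by (simp add: divide_le_eq)
  qed
  ultimately have "0 \<le> x" "x < 2 * pi" using x by linarith+
  thus ?thesis by simp
qed

lemma inner_set_subset: "inner_set U k \<subseteq> U \<inter> {0..<2*pi}"
  unfolding inner_set_def inner_cells_def using cell_bounds by blast

lemma inner_set_Suc: "inner_set U k \<subseteq> inner_set U (Suc k)"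
proof
  fix x assume "x \<in> inner_set U k"
  then obtain l where l: "l < 2 ^ k" "cell (2 ^ k) l \<subseteq> U" "x \<in> cell (2 ^ k) l"
    by (auto simp: inner_set_def inner_cells_def)
  have fl: "\<lfloor>y * 2 ^ k / (2 * pi)\<rfloor> = \<lfloor>y * 2 ^ Suc k / (2 * pi)\<rfloor> div 2" for y
  proof -
    have "y * 2 ^ k / (2 * pi) = (y * 2 ^ Suc k / (2 * pi)) / real_of_int 2" by simp
    thus ?thesis by (simp only: floor_divide_real_eq_div[of 2])
  qed
  define l' where "l' = nat \<lfloor>x * 2 ^ Suc k / (2 * pi)\<rfloor>"
  have e: "\<lfloor>x * 2 ^ Suc k / (2 * pi)\<rfloor> div 2 = int l" using l(3) fl[of x] by (simp add: cell_def)
  hence p: "0 \<le> \<lfloor>x * 2 ^ Suc k / (2 * pi)\<rfloor>" by (metis of_nat_0_le_iff pos_imp_zdiv_nonneg_iff zero_less_numeral)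
  hence l': "int l' = \<lfloor>x * 2 ^ Suc k / (2 * pi)\<rfloor>" by (simp add: l'_def)
  have l'2: "int l' div 2 = int l" using e l' by simp
  have "x \<in> cell (2 ^ Suc k) l'" unfolding cell_def using l' by simp
  moreover have "l' < 2 ^ Suc k" using l'2 l(1) by simp
  moreover have "cell (2 ^ Suc k) l' \<subseteq> cell (2 ^ k) l"
  proof
    fix y assume "y \<in> cell (2 ^ Suc k) l'"
    hence "\<lfloor>y * 2 ^ Suc k / (2 * pi)\<rfloor> = int l'" by (simp add: cell_def)
    hence "\<lfloor>y * 2 ^ k / (2 * pi)\<rfloor> = int l" using fl[of y] l'2 by simp
    thus "y \<in> cell (2 ^ k) l" by (simp add: cell_def)
  qed
  ultimately show "x \<in> inner_set U (Suc k)" using l(2) unfolding inner_set_def inner_cells_def by blast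
qed

lemma inner_set_mono: "j \<le> k \<Longrightarrow> inner_set U j \<subseteq> inner_set U k"
  by (rule lift_Suc_mono_le[of "inner_set U"]) (auto dest: inner_set_Suc[THEN subsetD])

lemma inner_set_eventually:
  assumes U: "open U" and x: "x \<in> U \<inter> {0..<2*pi}"
  shows "\<exists>k. x \<in> inner_set U k"
proof -
  obtain e where e: "e > 0" "ball x e \<subseteq> U" using U x by (auto simp: open_contains_ball)
  obtain k where k: "2 * pi / e < 2 ^ k" using real_arch_pow[of 2 "2 * pi / e"] by auto
  define l where "l = nat \<lfloor>x * 2 ^ k / (2 * pi)\<rfloor>"
  have "0 \<le> x * 2 ^ k / (2 * pi)" using x by simp
  hence l: "int l = \<lfloor>x * 2 ^ k / (2 * pi)\<rfloor>" by (simp add: l_def)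
  have "x * 2 ^ k / (2 * pi) < 2 ^ k" using x by (simp add: divide_less_eq mult.commute)
  hence "l < 2 ^ k" using l by (metis floor_less_iff of_int_numeral of_int_power of_nat_less_iff of_nat_numeral of_nat_power)
  moreover have "x \<in> cell (2 ^ k) l" using l by (simp add: cell_def)
  moreover have "cell (2 ^ k) l \<subseteq> U"
  proof
    fix y assume "y \<in> cell (2 ^ k) l"
    hence "\<lfloor>y * 2 ^ k / (2 * pi)\<rfloor> = \<lfloor>x * 2 ^ k / (2 * pi)\<rfloor>" using l by (simp add: cell_def)
    hence "\<bar>y * 2 ^ k / (2 * pi) - x * 2 ^ k / (2 * pi)\<bar> < 1" by linarith
    hence "\<bar>(y - x) * (2 ^ k / (2 * pi))\<bar> < 1" by (simp add: left_diff_distrib diff_divide_distrib)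
    hence "\<bar>y - x\<bar> * (2 ^ k / (2 * pi)) < 1" by (simp add: abs_mult)
    hence "\<bar>y - x\<bar> * 2 ^ k < 2 * pi" by (simp add: field_simps)
    also have "\<dots> < e * 2 ^ k" using k e(1) by (simp add: field_simps)
    finally have "\<bar>y - x\<bar> < e" by simp
    thus "y \<in> U" using e(2) by (auto simp: dist_real_def abs_minus_commute)
  qed
  ultimately show ?thesis unfolding inner_set_def inner_cells_def by blast
qed

lemma measure_inner_set: "measure lborel (inner_set U k) = card (inner_cells U k) * (2 * pi / 2 ^ k)"
proof -
  have c: "measure lborel (cell (2 ^ k) l) = 2 * pi / 2 ^ k" for l
  proof -
    have "measure lborel (cell (2 ^ k) l) = 2 * pi * (l + 1) / 2 ^ k - 2 * pi * l / 2 ^ k"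
      unfolding cell_interval[of "2^k", simplified] by (subst measure_lborel_Ico) (auto simp: divide_right_mono)
    thus ?thesis by (simp add: diff_divide_distrib[symmetric] algebra_simps)
  qed
  have "measure lborel (inner_set U k) = (\<Sum>l\<in>inner_cells U k. measure lborel (cell (2 ^ k) l))"
    unfolding inner_set_def
  proof (rule measure_finite_Union)
    show "disjoint_family_on (cell (2 ^ k)) (inner_cells U k)" by (auto simp: disjoint_family_on_def cell_def)
    show "emeasure lborel (cell (2 ^ k) l) \<noteq> \<infinity>" for l
      unfolding cell_interval[of "2^k", simplified] by (subst emeasure_lborel_Ico) (auto simp: divide_right_mono)
  qed (auto simp: inner_cells_finite)
  thus ?thesis unfolding c by simp
qed


lemma L2_sq_truncate_tendsto:
  assumes g: "g \<in> L2per" and U: "open U" and supp: "\<And>t. t \<notin> U \<inter> {0..<2*pi} \<Longrightarrow> g t = 0"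
  shows "(\<lambda>k. L2_sq (\<lambda>t. g t - indicator (inner_set U k) t * g t)) \<longlonglongrightarrow> 0"
proof -
  have "(\<lambda>k. \<integral>t. (cmod (g t - indicator (inner_set U k) t * g t))\<^sup>2 \<partial>lborel) \<longlonglongrightarrow> (\<integral>t. 0 \<partial>(lborel :: real measure))"
  proof (rule integral_dominated_convergence[where w = "\<lambda>t. (cmod (g t))\<^sup>2"])
    show "AE t in lborel. (\<lambda>k. (cmod (g t - indicator (inner_set U k) t * g t))\<^sup>2) \<longlonglongrightarrow> 0"
    proof (rule AE_I2)
      fix t
      show "(\<lambda>k. (cmod (g t - indicator (inner_set U k) t * g t))\<^sup>2) \<longlonglongrightarrow> 0"
      proof (cases "t \<in> U \<inter> {0..<2*pi}")
        case True
        then obtain k0 where k0: "t \<in> inner_set U k0" using inner_set_eventually[OF U] by blast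
        have "(cmod (g t - indicator (inner_set U k) t * g t))\<^sup>2 = 0" if "k \<ge> k0" for k
          using subsetD[OF inner_set_mono[OF that] k0] by simp
        thus ?thesis by (intro tendsto_eventually eventually_sequentiallyI[of k0])
      qed (simp add: supp)
    qed
    show "(\<lambda>t. (cmod (g t - indicator (inner_set U k) t * g t))\<^sup>2) \<in> borel_measurable lborel" for k
      using L2perD(1)[OF g] by measurable
    show "AE t in lborel. norm ((cmod (g t - indicator (inner_set U k) t * g t))\<^sup>2) \<le> (cmod (g t))\<^sup>2" for k
      by (rule AE_I2) (auto simp: indicator_def)
  qed (use L2perD(3)[OF g] in auto)
  thus ?thesis by (simp add: L2_sq_def)
qed

lemma L2_sq_truncate:
  assumes g: "g \<in> L2per" and A: "A \<in> sets borel"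
  shows "L2_sq (\<lambda>t. indicator A t * g t) = L2_sq g - L2_sq (\<lambda>t. g t - indicator A t * g t)"
proof -
  have t: "(\<lambda>t. indicator A t * g t) \<in> L2per"
    by (rule L2per_mult_bounded[OF g, where B = 1]) (use A in \<open>auto simp: indicator_def\<close>)
  have "L2_sq g - L2_sq (\<lambda>t. g t - indicator A t * g t)
     = (\<integral>t. (cmod (g t))\<^sup>2 - (cmod (g t - indicator A t * g t))\<^sup>2 \<partial>lborel)"
    unfolding L2_sq_def using L2perD(3)[OF g] L2perD(3)[OF L2per_diff[OF g t]] by simp
  also have "\<dots> = L2_sq (\<lambda>t. indicator A t * g t)"
    unfolding L2_sq_def by (intro Bochner_Integration.integral_cong refl) (auto simp: indicator_def)
  finally show ?thesis by simp
qed

lemma inner_set_measure_tendsto: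
  assumes U: "open U"
  shows "(\<lambda>k. measure lborel (inner_set U k)) \<longlonglongrightarrow> measure lborel (U \<inter> {0..<2*pi})"
proof -
  have eq: "(\<Union>k. inner_set U k) = U \<inter> {0..<2*pi}"
  proof (intro equalityI subsetI)
    fix x assume "x \<in> U \<inter> {0..<2*pi}"
    thus "x \<in> (\<Union>k. inner_set U k)" using inner_set_eventually[OF U, of x] by blast
  next
    fix x assume "x \<in> (\<Union>k. inner_set U k)"
    then obtain k where "x \<in> inner_set U k" by blast
    thus "x \<in> U \<inter> {0..<2*pi}" by (rule subsetD[OF inner_set_subset])
  qed
  have "emeasure lborel (U \<inter> {0..<2*pi}) \<le> emeasure lborel {0..<2*pi}" using U by (intro emeasure_mono) auto
  hence "emeasure lborel (U \<inter> {0..<2*pi}) \<noteq> \<infinity>" by (auto simp: top_unique)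
  thus ?thesis unfolding eq[symmetric] by (intro Lim_measure_incseq) (auto simp: incseq_def dest: inner_set_mono[THEN subsetD])
qed

lemma sampling_set_exists:
  fixes d :: real
  assumes U: "open U" and d: "d > 0"
  defines "\<beta> \<equiv> measure lborel (U \<inter> {0..<2*pi}) / (2 * pi)"
    and "c0 \<equiv> d\<^sup>2 / (4 * (1 + d) * (d + 2))"
  assumes \<beta>: "\<beta> > 0"
  shows "\<exists>A h. has_density A h \<and> h \<le> (1 + d) * \<beta> \<and>
    (\<forall>g\<in>L2per. (\<forall>t. t \<notin> U \<inter> {0..<2*pi} \<longrightarrow> g t = 0) \<longrightarrow> samples_bound A (pi * c0 * \<beta> * L2_sq g) g)"
proof -
  define a where "a = (\<lambda>k. card (inner_cells U k) / 2 ^ k)"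
  have a: "a k = measure lborel (inner_set U k) / (2 * pi)" for k
    by (simp add: a_def measure_inner_set)
  have a_lim: "a \<longlonglongrightarrow> \<beta>" unfolding a \<beta>_def by (intro tendsto_intros inner_set_measure_tendsto[OF U]) simp
  have a_le: "a k \<le> \<beta>" for k
  proof -
    have "incseq a" unfolding incseq_def
    proof (intro allI impI)
      fix i j :: nat assume "i \<le> j"
      have "emeasure lborel (inner_set U j) \<le> emeasure lborel {0..<2*pi}"
        using inner_set_subset[of U j] by (intro emeasure_mono) auto
      hence "inner_set U j \<in> fmeasurable lborel" by (auto simp: fmeasurable_def order_le_less_trans)
      thus "a i \<le> a j" unfolding a using inner_set_mono[OF \<open>i \<le> j\<close>]
        by (intro divide_right_mono measure_mono_fmeasurable) auto
    qed
    thus ?thesis using a_lim by (rule incseq_le)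
  qed
  have c0: "c0 > 0" using d by (simp add: c0_def)
  have ev1: "eventually (\<lambda>k. a k > \<beta> / 2) sequentially" using a_lim \<beta> by (intro order_tendstoD) auto
  \<comment> \<open>From level \<open>k0\<close> on, the cells inside \<open>U\<close> fill more
    than half of its measure, and \<open>k1\<close> makes them numerous enough for the rounding
    condition of the row selection.\<close>
  obtain k1 where k1: "8 / (d * \<beta>) < 2 ^ k1" using real_arch_pow[of 2 "8 / (d * \<beta>)"] by auto
  obtain k0 where k0: "\<And>k. k \<ge> k0 \<Longrightarrow> a k > \<beta> / 2" "k0 \<ge> k1"
    using ev1 unfolding eventually_sequentially by (metis nle_le order_trans)
  have large: "d * card (inner_cells U k) \<ge> 4" if "k \<ge> k0" for k
  proof -
    have "(2::real) ^ k1 \<le> 2 ^ k" using that k0(2) by (intro power_increasing) auto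
    hence "8 / (d * \<beta>) < 2 ^ k" using k1 by linarith
    hence "8 < 2 ^ k * (d * \<beta>)" using d \<beta> by (simp add: divide_less_eq)
    hence "4 < d * (2 ^ k * (\<beta> / 2))" by (simp add: algebra_simps)
    also have "\<dots> \<le> d * (2 ^ k * a k)" using d k0(1)[OF that] by (intro mult_left_mono) auto
    also have "\<dots> = d * card (inner_cells U k)" by (simp add: a_def)
    finally show ?thesis by simp
  qed
  \<comment> \<open>Level \<open>k\<close> yields the constant \<open>2 * pi * c0 * a k\<close>,
    which exceeds \<open>c\<close> since \<open>a k > \<beta> / 2\<close>. Using the same
    \<open>c\<close> at all levels makes the families \<open>Y k\<close> decreasing.\<close>
  define c where "c = pi * c0 * \<beta>"
  define Y where "Y = (\<lambda>k. {A. \<forall>g\<in>L2per. (\<forall>t. t \<notin> inner_set U k \<longrightarrow> g t = 0) \<longrightarrow> samples_bound A (c * L2_sq g) g})"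
  have Y_shift: "(+) p ` A \<in> Y k" if "A \<in> Y k" for A p k
    unfolding Y_def
  proof (intro CollectI ballI impI)
    fix g assume g: "g \<in> L2per" "\<forall>t. t \<notin> inner_set U k \<longrightarrow> g t = 0"
    have "samples_bound A (c * L2_sq (\<lambda>t. cis (of_int p * t) * g t)) (\<lambda>t. cis (of_int p * t) * g t)"
      using that g modulate_L2per[OF g(1)] unfolding Y_def by auto
    thus "samples_bound ((+) p ` A) (c * L2_sq g) g" unfolding L2_sq_modulate by (rule samples_bound_shift)
  qed
  have Y_mono: "Y j \<subseteq> Y k" if "k \<le> j" for j k
    using inner_set_mono[OF that, of U] unfolding Y_def by blast
  have Y_limit: "A \<in> Y k" if "eventually (\<lambda>i. s i \<in> Y k) sequentially"
    "\<And>x. eventually (\<lambda>i. x \<in> s i \<longleftrightarrow> x \<in> A) sequentially" for s A k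
    unfolding Y_def
  proof (intro CollectI ballI impI)
    fix g assume g: "g \<in> L2per" "\<forall>t. t \<notin> inner_set U k \<longrightarrow> g t = 0"
    show "samples_bound A (c * L2_sq g) g"
      by (rule samples_bound_limit[OF g(1) _ that(2)])
         (use that(1) g in \<open>auto elim!: eventually_mono simp: Y_def\<close>)
  qed
  have Y_small: "\<exists>A\<in>Y k. wcount A 0 (int n) \<le> (1 + d) * \<beta> * n" if k: "k \<ge> k0" for k n
  proof -
    let ?L = "inner_cells U k" and ?m = "2 ^ k :: nat"
    have L: "?L \<subseteq> {..<?m}" by (auto simp: inner_cells_def)
    obtain J where J: "J \<subseteq> {..<?m}" "card J \<le> (1 + d) * card ?L"
      "\<And>x. c0 * card ?L * (\<Sum>l\<in>?L. (cmod (x l))\<^sup>2)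
        \<le> (\<Sum>j\<in>J. (cmod (\<Sum>l\<in>?L. cis (2 * pi * real j * real l / real ?m) * x l))\<^sup>2)"
      using fourier_row_selection[OF _ L d large[OF k]] unfolding c0_def by auto
    have "residue_set ?m J \<in> Y k" unfolding Y_def
    proof (intro CollectI ballI impI)
      fix g assume g: "g \<in> L2per" "\<forall>t. t \<notin> inner_set U k \<longrightarrow> g t = 0"
      have "samples_bound (residue_set ?m J) (2 * pi * (c0 * card ?L) / ?m * L2_sq g) g"
        by (rule residue_set_samples_bound[OF _ L J(1) g(1) _ J(3)]) (use g(2) in \<open>auto simp: inner_set_def\<close>)
      moreover have "c * L2_sq g \<le> 2 * pi * (c0 * card ?L) / ?m * L2_sq g"
      proof (intro mult_right_mono L2_sq_nonneg)
        have "pi * c0 * \<beta> \<le> pi * c0 * (2 * a k)" using c0 k0(1)[OF k] by (intro mult_left_mono) auto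
        thus "c \<le> 2 * pi * (c0 * card ?L) / ?m" by (simp add: c_def a_def mult_ac)
      qed
      ultimately show "samples_bound (residue_set ?m J) (c * L2_sq g) g" by (rule samples_bound_mono)
    qed
    moreover obtain p where p: "wcount ((+) p ` residue_set ?m J) 0 (int n) \<le> card J / ?m * n"
      using residue_set_window[OF _ J(1), of n] by auto
    moreover have "card J / ?m * n \<le> (1 + d) * \<beta> * n"
    proof (intro mult_right_mono)
      have "card J / ?m \<le> (1 + d) * card ?L / ?m" using J(2) by (intro divide_right_mono) auto
      also have "\<dots> = (1 + d) * a k" by (simp add: a_def)
      also have "\<dots> \<le> (1 + d) * \<beta>" using d a_le by (intro mult_left_mono) auto
      finally show "card J / ?m \<le> (1 + d) * \<beta>" .
    qed auto
    ultimately show ?thesis using Y_shift by (meson order_trans)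
  qed
  define X where "X = (\<Inter>k\<in>{k0..}. Y k)"
  have X_shift: "(+) p ` A \<in> X" if "A \<in> X" for A p using that Y_shift unfolding X_def by blast
  have X_closed: "A \<in> X" if "\<And>k::nat. s k \<in> X" "\<And>x. eventually (\<lambda>k. x \<in> s k \<longleftrightarrow> x \<in> A) sequentially" for s A
    using Y_limit[of s _ A] that unfolding X_def by auto
  \<comment> \<open>For each \<open>n\<close> separately, a limit of members of higher and higher
    \<open>Y k\<close> lies in all of them and keeps the count in the one window considered. The
    limit set may vary with \<open>n\<close>, and the density lemma permits this.\<close>
  have X_small: "\<exists>A\<in>X. wcount A 0 (int n) \<le> ((1 + d) * \<beta>) * real n" for n
  proof -
    have "\<exists>A\<in>Y (r + k0). wcount A 0 (int n) \<le> (1 + d) * \<beta> * n" for r using Y_small[of "r + k0" n] by simp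
    then obtain s where s: "\<And>r. s r \<in> Y (r + k0)" "\<And>r. wcount (s r) 0 (int n) \<le> (1 + d) * \<beta> * n" by metis
    obtain r A where r: "strict_mono r" and A: "\<And>x. eventually (\<lambda>i. x \<in> s (r i) \<longleftrightarrow> x \<in> A) sequentially"
      using sets_convergent_subsequence[of s] by blast
    have "A \<in> Y k" for k
    proof (rule Y_limit[of "\<lambda>i. s (r i)", OF _ A])
      show "eventually (\<lambda>i. s (r i) \<in> Y k) sequentially"
      proof (rule eventually_sequentiallyI[of k])
        fix i assume "k \<le> i"
        hence "k \<le> r i + k0" using seq_suble[OF r, of i] by simp
        thus "s (r i) \<in> Y k" using Y_mono s(1) by blast
      qed
    qed
    hence "A \<in> X" by (simp add: X_def)
    moreover have "wcount A 0 (int n) \<le> (1 + d) * \<beta> * n"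
    proof -
      have "eventually (\<lambda>i. s (r i) \<inter> {0..<int n} = A \<inter> {0..<int n}) sequentially"
        by (rule eventually_Int_window_eq[OF A])
      then obtain i where "s (r i) \<inter> {0..<int n} = A \<inter> {0..<int n}" by (auto simp: eventually_sequentially)
      hence "wcount A 0 (int n) = wcount (s (r i)) 0 (int n)" by (simp add: wcount_card)
      thus ?thesis using s(2) by simp
    qed
    ultimately show ?thesis by blast
  qed
  have "\<exists>A\<in>X. \<exists>h\<le>(1 + d) * \<beta>. has_density A h"
  proof (rule closed_shift_invariant_density)
    show "(+) p ` A \<in> X" if "A \<in> X" for A p using that by (rule X_shift)
    show "A \<in> X" if "\<And>k::nat. s k \<in> X" "\<And>x. eventually (\<lambda>k. x \<in> s k \<longleftrightarrow> x \<in> A) sequentially" for s A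
      using that by (rule X_closed)
    show "\<exists>A\<in>X. wcount A 0 (int n) \<le> ((1 + d) * \<beta>) * real n" for n by (rule X_small)
  qed
  then obtain A h where A: "A \<in> X" "h \<le> (1 + d) * \<beta>" "has_density A h" by blast
  \<comment> \<open>Membership in \<open>X\<close> only tests functions supported in some
    \<open>inner_set U k\<close>; truncating \<open>g\<close> to these sets and letting
    \<open>k\<close> grow reaches all of \<open>U\<close>.\<close>
  have "samples_bound A (c * L2_sq g) g" if g: "g \<in> L2per" and supp: "\<forall>t. t \<notin> U \<inter> {0..<2*pi} \<longrightarrow> g t = 0" for g
  proof (rule samples_bound_dense[OF g])
    have m: "inner_set U k \<in> sets borel" for k by simp
    show t: "(\<lambda>t. indicator (inner_set U k) t * g t) \<in> L2per" for k
      by (rule L2per_mult_bounded[OF g, where B = 1]) (auto simp: indicator_def)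
    show "(\<lambda>k. L2_sq (\<lambda>t. g t - indicator (inner_set U k) t * g t)) \<longlonglongrightarrow> 0"
      using supp by (intro L2_sq_truncate_tendsto[OF g U]) auto
    show "L2_sq (\<lambda>t. indicator (inner_set U k) t * g t) = L2_sq g - L2_sq (\<lambda>t. g t - indicator (inner_set U k) t * g t)" for k
      by (rule L2_sq_truncate[OF g m])
    show "eventually (\<lambda>k. samples_bound A (c * L2_sq (\<lambda>t. indicator (inner_set U k) t * g t)) (\<lambda>t. indicator (inner_set U k) t * g t)) sequentially"
    proof (rule eventually_sequentiallyI[of k0])
      fix k assume "k0 \<le> k"
      hence "A \<in> Y k" using A(1) by (auto simp: X_def)
      thus "samples_bound A (c * L2_sq (\<lambda>t. indicator (inner_set U k) t * g t)) (\<lambda>t. indicator (inner_set U k) t * g t)"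
        using t[of k] unfolding Y_def by auto
    qed
  qed
  thus ?thesis using A(2,3) unfolding c_def by blast
qed

section \<open>Passage to the Paley-Wiener space\<close>

lemma samples_bound_infsum:
  assumes "samples_bound A v g"
  shows "ennreal v \<le> (\<Sum>\<^sub>\<infinity>k\<in>A. ennreal ((cmod (fourier g (of_int k)))\<^sup>2))"
proof (rule ennreal_le_epsilon)
  fix e :: real assume "e > 0"
  then obtain K where K: "finite K" "K \<subseteq> A" "v - e < (\<Sum>k\<in>K. (cmod (fourier g (of_int k)))\<^sup>2)"
    using assms unfolding samples_bound_def by blast
  have "ennreal v \<le> ennreal ((\<Sum>k\<in>K. (cmod (fourier g (of_int k)))\<^sup>2) + e)" using K(3) by (intro ennreal_leI) simp
  also have "\<dots> = (\<Sum>k\<in>K. ennreal ((cmod (fourier g (of_int k)))\<^sup>2)) + ennreal e"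
    using \<open>e > 0\<close> by (subst ennreal_plus) (auto simp: sum_nonneg sum_ennreal)
  also have "(\<Sum>k\<in>K. ennreal ((cmod (fourier g (of_int k)))\<^sup>2)) \<le> (\<Sum>\<^sub>\<infinity>k\<in>A. ennreal ((cmod (fourier g (of_int k)))\<^sup>2))"
    using K by (subst nonneg_infsum_complete) (auto intro!: SUP_upper)
  finally show "ennreal v \<le> (\<Sum>\<^sub>\<infinity>k\<in>A. ennreal ((cmod (fourier g (of_int k)))\<^sup>2)) + ennreal e"
    by (simp add: add_right_mono)
qed

text \<open>The spectrum cut off to \<open>S\<close> is replaced by a Borel function equal to it
  almost everywhere. The half-open interval loses at most the point \<open>2 * pi\<close> of
  \<open>S\<close>, a null set, so the synthesis integral is unchanged at every
  \<open>x\<close>.\<close>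

lemma PW_fourier:
  assumes S: "S \<in> sets lebesgue" "S \<subseteq> {0..2*pi}" and U: "open U" "S \<subseteq> U" and f: "f \<in> PW S"
  shows "\<exists>g\<in>L2per. (\<forall>t. t \<notin> U \<inter> {0..<2*pi} \<longrightarrow> g t = 0) \<and> f = fourier g"
proof -
  obtain F where F[measurable]: "F \<in> borel_measurable lebesgue"
    and iF: "integrable lebesgue (\<lambda>t. indicator S t * (cmod (F t))\<^sup>2)"
    and f_eq: "\<And>x. f x = (\<integral>t. indicator S t *\<^sub>R (F t * cis (x * t)) \<partial>lebesgue)"
    using f unfolding PW_def by blast
  note [measurable] = S(1)
  define G where "G = (\<lambda>t. indicator S t *\<^sub>R F t)"
  have [measurable]: "G \<in> borel_measurable lebesgue" unfolding G_def by measurable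
  have "(\<lambda>t. Re (G t)) \<in> borel_measurable lebesgue" "(\<lambda>t. Im (G t)) \<in> borel_measurable lebesgue" by measurable
  from this[THEN completion_ex_borel_measurable_real] obtain g1 g2
    where g1[measurable]: "g1 \<in> borel_measurable lborel" and e1: "AE t in lborel. Re (G t) = g1 t"
      and g2[measurable]: "g2 \<in> borel_measurable lborel" and e2: "AE t in lborel. Im (G t) = g2 t" by blast
  define g where "g = (\<lambda>t. indicator (U \<inter> {0..<2*pi}) t *\<^sub>R (complex_of_real (g1 t) + \<i> * complex_of_real (g2 t)))"
  have Um[measurable]: "U \<inter> {0..<2*pi} \<in> sets borel" using U by simp
  have gm[measurable]: "g \<in> borel_measurable borel" unfolding g_def using g1 g2 by measurable
  have gz: "g t = 0" if "t \<notin> U \<inter> {0..<2*pi}" for t using that by (simp add: g_def)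
  have "AE t in lborel. G t = g t"
    using e1 e2 AE_lborel_singleton[of "2 * pi"]
  proof eventually_elim
    case (elim t)
    show ?case
    proof (cases "t \<in> U \<inter> {0..<2*pi}")
      case True
      thus ?thesis using elim by (simp add: g_def complex_eq_iff)
    next
      case False
      hence "t \<notin> S" using S(2) U(2) elim(3) by force
      thus ?thesis using False by (simp add: G_def g_def)
    qed
  qed
  hence Gg: "AE t in lebesgue. G t = g t" by (rule AE_completion)
  have "integrable lebesgue (\<lambda>t. (cmod (g t))\<^sup>2)"
  proof (rule integrable_cong_AE_imp[OF iF])
    show "(\<lambda>t. (cmod (g t))\<^sup>2) \<in> borel_measurable lebesgue"
      using measurable_completion[of "\<lambda>t. (cmod (g t))\<^sup>2" lborel borel] by simp
    show "AE t in lebesgue. indicator S t * (cmod (F t))\<^sup>2 = (cmod (g t))\<^sup>2"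
      using Gg by eventually_elim (auto simp: G_def indicator_def)
  qed
  hence "integrable lborel (\<lambda>t. (cmod (g t))\<^sup>2)" by (subst (asm) integrable_completion) auto
  moreover have "g t = 0" if "t \<notin> {0..2*pi}" for t using that by (intro gz) auto
  ultimately have gL: "g \<in> L2per" using gm by (auto simp: L2per_def)
  have "f x = fourier g x" for x
  proof -
    have "f x = (\<integral>t. g t * cis (x * t) \<partial>lebesgue)" unfolding f_eq
    proof (rule integral_cong_AE)
      show "AE t in lebesgue. indicator S t *\<^sub>R (F t * cis (x * t)) = g t * cis (x * t)"
        using Gg by eventually_elim (auto simp: G_def indicator_def)
      have c: "(\<lambda>t. cis (x * t)) \<in> borel_measurable lebesgue" by (rule measurable_completion) measurable
      show "(\<lambda>t. indicator S t *\<^sub>R (F t * cis (x * t))) \<in> borel_measurable lebesgue" using c by measurable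
      show "(\<lambda>t. g t * cis (x * t)) \<in> borel_measurable lebesgue" by (rule measurable_completion) measurable
    qed
    also have "\<dots> = fourier g x" unfolding fourier_def by (rule integral_completion) measurable
    finally show ?thesis .
  qed
  thus ?thesis using gL gz by blast
qed

text \<open>The half of Plancherel's identity that is used; membership in \<open>PW S\<close>
  supplies the integrability over the line.\<close>

lemma L2norm_sq_le:
  assumes "g \<in> L2per" "fourier g \<in> PW S"
  shows "L2norm_sq (fourier g) \<le> 2 * pi * L2_sq g"
proof -
  have m: "(\<lambda>x. (cmod (fourier g x))\<^sup>2) \<in> borel_measurable lborel"
    using borel_measurable_continuous_onI[OF continuous_fourier[OF assms(1)]] by measurable
  have "integrable lborel (\<lambda>x. (cmod (fourier g x))\<^sup>2)"
    using assms(2) unfolding PW_def by (simp add: integrable_completion[OF m])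
  thus ?thesis unfolding L2norm_sq_def integral_completion[OF m] by (rule integral_fourier_le[OF assms(1)])
qed

theorem theorem2:
  fixes d :: real
  assumes "d > 0"
  shows "\<exists>C>0. \<forall>S. S \<in> sets lebesgue \<and> S \<subseteq> {0..2*pi} \<and> nmeasure S > 0 \<longrightarrow>
           (\<exists>\<Lambda> :: int set. \<exists>D. has_density \<Lambda> D \<and> D < (1 + d) * nmeasure S \<and>
              (\<forall>f \<in> PW S. ennreal (C * nmeasure S * L2norm_sq f)
                  \<le> (\<Sum>\<^sub>\<infinity>k\<in>\<Lambda>. ennreal ((cmod (f (of_int k)))\<^sup>2))))"
proof -
  define d' where "d' = d / 2"
  have d': "d' > 0" using assms by (simp add: d'_def)
  define c0 where "c0 = d'\<^sup>2 / (4 * (1 + d') * (d' + 2))"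
  have c0: "c0 > 0" using d' by (simp add: c0_def)
  have "\<exists>\<Lambda> :: int set. \<exists>D. has_density \<Lambda> D \<and> D < (1 + d) * nmeasure S \<and>
              (\<forall>f \<in> PW S. ennreal (c0 / 2 * nmeasure S * L2norm_sq f)
                  \<le> (\<Sum>\<^sub>\<infinity>k\<in>\<Lambda>. ennreal ((cmod (f (of_int k)))\<^sup>2)))"
    if S: "S \<in> sets lebesgue" "S \<subseteq> {0..2*pi}" "nmeasure S > 0" for S
  proof -
    define \<sigma> where "\<sigma> = nmeasure S"
    \<comment> \<open>Chosen so that \<open>\<beta> < \<sigma> * (1 + 2 * d') / (1 + d')\<close>,
      that is, \<open>(1 + d') * \<beta> < (1 + d) * \<sigma>\<close>.\<close>
    define e where "e = 2 * pi * \<sigma> * (d' / (1 + d'))"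
    have e: "e > 0" using S(3) d' by (simp add: e_def \<sigma>_def)
    obtain U where U: "open U" "S \<subseteq> U" "U - S \<in> lmeasurable" "emeasure lebesgue (U - S) < ennreal e"
      by (rule sets_lebesgue_outer_open[OF S(1) e])
    define \<beta> where "\<beta> = measure lborel (U \<inter> {0..<2*pi}) / (2 * pi)"
    have Sfin: "S \<in> lmeasurable"
      using S(1,2) by (meson bounded_closed_interval bounded_subset bounded_set_imp_lmeasurable)
    have Ufin: "U \<inter> {0..<2*pi} \<in> lmeasurable"
      using U(1) by (intro bounded_set_imp_lmeasurable) (auto intro: bounded_subset[of "{0..2*pi}"])
    have mU: "measure lborel (U \<inter> {0..<2*pi}) = measure lebesgue (U \<inter> {0..<2*pi})" using U(1) by simp
    \<comment> \<open>The point \<open>2 * pi\<close> may belong to \<open>S\<close> but not to the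
      half-open interval; it is added at no cost in measure.\<close>
    have Upi: "(U \<inter> {0..<2*pi}) \<union> {2*pi} \<in> lmeasurable" using Ufin by (intro fmeasurable.Un) (auto intro!: bounded_set_imp_lmeasurable)
    have "S \<subseteq> (U \<inter> {0..<2*pi}) \<union> {2*pi}" using S(2) U(2) by force
    hence "measure lebesgue S \<le> measure lebesgue ((U \<inter> {0..<2*pi}) \<union> {2*pi})"
      using S(1) Upi by (intro measure_mono_fmeasurable)
    also have "\<dots> \<le> measure lebesgue (U \<inter> {0..<2*pi}) + measure lebesgue {2*pi}"
      using Ufin by (intro measure_Un_le) (auto simp: fmeasurableD)
    finally have "measure lebesgue S \<le> measure lborel (U \<inter> {0..<2*pi})" unfolding mU by simp
    hence lo: "\<sigma> \<le> \<beta>" unfolding \<sigma>_def \<beta>_def nmeasure_def by (intro divide_right_mono) auto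
    have "measure lebesgue (U \<inter> {0..<2*pi}) \<le> measure lebesgue (S \<union> (U - S))"
      using fmeasurableD[OF Ufin] fmeasurable.Un[OF Sfin U(3)] by (intro measure_mono_fmeasurable) auto
    also have "\<dots> \<le> measure lebesgue S + measure lebesgue (U - S)"
      using Sfin U(3) by (intro measure_Un_le) (auto simp: fmeasurableD)
    also have "measure lebesgue (U - S) < e"
      using U(3,4) e by (simp add: emeasure_eq_measure2 ennreal_less_iff)
    finally have "measure lborel (U \<inter> {0..<2*pi}) < measure lebesgue S + e" unfolding mU by simp
    hence "\<beta> < \<sigma> + e / (2 * pi)" unfolding \<sigma>_def \<beta>_def nmeasure_def by (simp add: field_simps)
    also have "e / (2 * pi) = \<sigma> * (d' / (1 + d'))" by (simp add: e_def)
    also have "\<sigma> + \<sigma> * (d' / (1 + d')) = \<sigma> * (1 + 2 * d') / (1 + d')" using d' by (simp add: field_simps)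
    also have "2 * d' = d" by (simp add: d'_def)
    finally have "(1 + d') * \<beta> < (1 + d) * \<sigma>" using d' by (simp add: field_simps)
    note hi = this
    have \<beta>: "\<beta> > 0" using lo S(3) by (simp add: \<sigma>_def)
    obtain \<Lambda> h where \<Lambda>: "has_density \<Lambda> h" "h \<le> (1 + d') * \<beta>"
      "\<And>g. g \<in> L2per \<Longrightarrow> \<forall>t. t \<notin> U \<inter> {0..<2*pi} \<longrightarrow> g t = 0 \<Longrightarrow> samples_bound \<Lambda> (pi * c0 * \<beta> * L2_sq g) g"
      using sampling_set_exists[OF U(1) d' \<beta>[unfolded \<beta>_def]] unfolding \<beta>_def c0_def by blast
    have "ennreal (c0 / 2 * \<sigma> * L2norm_sq f) \<le> (\<Sum>\<^sub>\<infinity>k\<in>\<Lambda>. ennreal ((cmod (f (of_int k)))\<^sup>2))" if f: "f \<in> PW S" for f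
    proof -
      obtain g where g: "g \<in> L2per" "\<forall>t. t \<notin> U \<inter> {0..<2*pi} \<longrightarrow> g t = 0" "f = fourier g"
        using PW_fourier[OF S(1,2) U(1,2) f] by blast
      \<comment> \<open>The factor \<open>2 * pi\<close> of the norm comparison against the
        \<open>pi\<close> in the sampling constant accounts for the final constant
        \<open>c0 / 2\<close>.\<close>
      have "c0 / 2 * \<sigma> * L2norm_sq f \<le> c0 / 2 * \<beta> * (2 * pi * L2_sq g)"
        using L2norm_sq_le[OF g(1), of S] f g(3) lo c0 \<beta> S(3)
        by (intro mult_mono) (auto simp: L2norm_sq_def \<sigma>_def)
      also have "\<dots> = pi * c0 * \<beta> * L2_sq g" by simp
      finally have "ennreal (c0 / 2 * \<sigma> * L2norm_sq f) \<le> ennreal (pi * c0 * \<beta> * L2_sq g)" by (rule ennreal_leI)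
      also have "\<dots> \<le> (\<Sum>\<^sub>\<infinity>k\<in>\<Lambda>. ennreal ((cmod (f (of_int k)))\<^sup>2))"
        unfolding g(3) by (rule samples_bound_infsum[OF \<Lambda>(3)[OF g(1,2)]])
      finally show ?thesis .
    qed
    thus ?thesis using \<Lambda>(1,2) hi unfolding \<sigma>_def by (meson order_le_less_trans)
  qed
  thus ?thesis using c0 by (intro exI[of _ "c0 / 2"]) auto
qed

end
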